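(* Let $\pi$ be a probability measure on $\{0,1,2,\dots\}$ with finite positive expectation and generating function $\phi$, and let $\hat\pi(k)=k\pi(k)/\phi'(1)$, $\hat\phi=\phi'/\phi'(1)$. Suppose that $\hat\pi\ne\delta_0$, $\hat\pi_0>0$, and that $t\mapsto\hat\phi(1-\hat\phi(1-t))$ has a finite number of fixed points in $[0,1]$. Let $(\mathbb{T},o)$ be the unimodular Bienaymé-Galton-Watson tree with reproduction law $\pi$. Let $C_w(\pi)$ be the convex hull of the distributions of the variables $(\mathbb{T},o,\mathbb{M}^\omega)$, where $\omega$ ranges over the probability measures on $\mathbb{R}$ with finite expectation that are atomless and admit a (positive) density on some nonempty open interval. Let $C_{\mathcal U}(\pi)$ be the convex hull of the subsequential Benjamini-Schramm limits of $(G_n,M_{n,\mathcal U}(G_n))$, where $(G_n)$ is any sequence of finite graphs converging in the Benjamini-Schramm sense to $(\mathbb{T},o)$ and $M_{n,\mathcal U}(G_n)$ is picked uniformly among all maximum size matchings of $G_n$. Then $$d_{\mathrm{TV}}(C_w(\pi),C_{\mathcal U}(\pi))>0.$$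
   Context: Rooted graphs are locally finite and considered up to root-preserving isomorphism; a matching $M$ (set of edges no two sharing a vertex) is encoded as the edge mark $\mathbf{1}_M$. A sequence of finite (random, possibly marked) graphs converges in the Benjamini-Schramm sense if, when rooted at a uniform vertex, it converges in law for the local topology (two rooted graphs are close if large balls around their roots are isomorphic, with the same marks). For two distributions $\mu,\mu'$ of unweighted rooted matched trees $(\mathbb{T},o,\mathbb{M})$ and $(\mathbb{T},o,\mathbb{M}')$, $d_{\mathrm{TV}}(\mu,\mu')=\sup_A|\mu(A)-\mu'(A)|$ over events $A$; the distance between two sets of distributions is the infimum of $d_{\mathrm{TV}}(\mu,\mu')$ over $\mu$ in the first and $\mu'$ in the second. UBGW tree with reproduction law $\pi$: the root has a number of children of law $\pi$, every other vertex has a number of children of law $\hat\pi$, all independent. $(\mathbb{T},o,\mathbb{M}^\omega)$: put i.i.d. weights $w$ of law $\omega$ on the edges of $\mathbb{T}$; a random matched weighted rooted graph is unimodular if $\mathbb{E}[\sum_v f(\mathbb G,o,v)]=\mathbb{E}[\sum_v f(\mathbb G,v,o)]$ for every nonnegative measurable $f$ of isomorphism classes of doubly rooted weighted matched graphs. A unimodular matching $\mathbb{M}$ on $(\mathbb{T},o,w)$ is optimal if $\big(\mathbb{P}(\exists v\sim o:\{o,v\}\in\mathbb{M}),\mathbb{E}[\sum_{v\sim o}w(o,v)\mathbf{1}_{\{o,v\}\in\mathbb{M}}]\big)$ is lexicographically maximal among unimodular matchings on a weighted tree with the same law. When $\pi$ has finite positive expectation and $t\mapsto\hat\phi(1-\hat\phi(1-t))$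 has a finite number of fixed points in $[0,1]$, and $\omega$ is a probability measure on $\mathbb{R}$ with finite expectation that is atomless and admits a (positive) density on some nonempty open interval, the optimal unimodular matching exists and is unique in law; $\mathbb{M}^\omega$ denotes it, and weights are then forgotten.
   Formalization: The formula π̂(k)=kπ(k)/φ'(1) is replaced by π̂(k)=(k+1)π(k+1)/φ'(1), the law whose generating function is φ̂=φ'/φ'(1); the printed formula gives π̂_0=0, contradicting the hypothesis π̂_0>0. *)

theory Defs
  imports "HOL-Probability.Probability"
begin

section \<open>Graphs and matchings\<close>

text \<open>Vertices are natural numbers; every locally finite connected graph is countable, so each
  isomorphism class has such a representative.\<close>

record graph =
  verts :: "nat set"
  edges :: "nat set set"

definition simple_graph :: "graph \<Rightarrow> bool" where
  "simple_graph G \<longleftrightarrow> (\<forall>e\<in>edges G. e \<subseteq> verts G \<and> card e = 2)"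

definition neighbours :: "graph \<Rightarrow> nat \<Rightarrow> nat set" where
  "neighbours G u = {v. {u, v} \<in> edges G}"

definition adj_rel :: "graph \<Rightarrow> (nat \<times> nat) set" where
  "adj_rel G = {(u, v). {u, v} \<in> edges G}"

definition locally_finite_graph :: "graph \<Rightarrow> bool" where
  "locally_finite_graph G \<longleftrightarrow> (\<forall>u\<in>verts G. finite (neighbours G u))"

definition connected_graph :: "graph \<Rightarrow> bool" where
  "connected_graph G \<longleftrightarrow> (\<forall>u\<in>verts G. \<forall>v\<in>verts G. (u, v) \<in> (adj_rel G)\<^sup>*)"

definition finite_graph :: "graph \<Rightarrow> bool" where
  "finite_graph G \<longleftrightarrow> simple_graph G \<and> finite (verts G) \<and> verts G \<noteq> {}"

definition induced_subgraph :: "graph \<Rightarrow> nat set \<Rightarrow> graph" where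
  "induced_subgraph G S = \<lparr>verts = verts G \<inter> S, edges = {e \<in> edges G. e \<subseteq> S}\<rparr>"

definition graph_component :: "graph \<Rightarrow> nat \<Rightarrow> graph" where
  "graph_component G v = induced_subgraph G {u. (v, u) \<in> (adj_rel G)\<^sup>*}"

definition graph_iso :: "(nat \<Rightarrow> nat) \<Rightarrow> graph \<Rightarrow> graph \<Rightarrow> bool" where
  "graph_iso \<phi> G H \<longleftrightarrow> bij_betw \<phi> (verts G) (verts H) \<and> edges H = (`) \<phi> ` edges G"

definition is_matching :: "graph \<Rightarrow> nat set set \<Rightarrow> bool" where
  "is_matching G M \<longleftrightarrow> M \<subseteq> edges G \<and> pairwise disjnt M"

definition maximum_matchings :: "graph \<Rightarrow> nat set set set" where
  "maximum_matchings G =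
     {M. is_matching G M \<and> (\<forall>M'. is_matching G M' \<longrightarrow> card M' \<le> card M)}"


section \<open>Isomorphism classes of rooted edge-marked graphs\<close>

text \<open>A rooted marked graph is a triple \<open>(G, m, rs)\<close>, where \<open>m\<close> assigns marks to the edges (its
  values on non-edges are irrelevant) and \<open>rs\<close> is a nonempty list of roots, not necessarily
  distinct.  Lists of length one give rooted graphs, lists of length two doubly rooted graphs.\<close>

definition rooted_graph :: "graph \<Rightarrow> nat list \<Rightarrow> bool" where
  "rooted_graph G rs \<longleftrightarrow> simple_graph G \<and> locally_finite_graph G \<and> connected_graph G \<and>
     rs \<noteq> [] \<and> set rs \<subseteq> verts G"

fun rooted_iso ::
  "graph \<times> (nat set \<Rightarrow> 'm) \<times> nat list \<Rightarrow> graph \<times> (nat set \<Rightarrow> 'm) \<times> nat list \<Rightarrow> bool" where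
  "rooted_iso (G, m, rs) (H, n, ss) \<longleftrightarrow> rooted_graph G rs \<and> rooted_graph H ss \<and>
     (\<exists>\<phi>. graph_iso \<phi> G H \<and> map \<phi> rs = ss \<and> (\<forall>e\<in>edges G. n (\<phi> ` e) = m e))"

lemma edge_subset_verts: "simple_graph G \<Longrightarrow> e \<in> edges G \<Longrightarrow> e \<subseteq> verts G"
  by (auto simp: simple_graph_def)

lemma hd_root: "rooted_graph G rs \<Longrightarrow> hd rs \<in> verts G"
  using hd_in_set unfolding rooted_graph_def by blast

lemma rooted_isoE:
  assumes "rooted_iso (G, m, rs) (H, n, ss)"
  obtains \<phi> where "simple_graph G" "graph_iso \<phi> G H" "\<forall>e\<in>edges G. n (\<phi> ` e) = m e"
    "map \<phi> rs = ss" "rs \<noteq> []" "hd rs \<in> verts G"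
proof -
  from assms obtain \<phi> where *: "graph_iso \<phi> G H" "map \<phi> rs = ss" "\<forall>e\<in>edges G. n (\<phi> ` e) = m e"
    by auto
  have "simple_graph G" "rs \<noteq> []" "hd rs \<in> verts G"
    using assms by (auto simp: rooted_graph_def intro: hd_root[unfolded rooted_graph_def])
  then show thesis using * that by blast
qed

lemma rooted_iso_sym:
  assumes "rooted_iso x y" shows "rooted_iso y x"
proof -
  obtain G m rs where x: "x = (G, m, rs)" by (cases x)
  obtain H n ss where y: "y = (H, n, ss)" by (cases y)
  from assms obtain \<phi> where G: "rooted_graph G rs" and H: "rooted_graph H ss"
    and \<phi>: "graph_iso \<phi> G H" "map \<phi> rs = ss" "\<forall>e\<in>edges G. n (\<phi> ` e) = m e"
    by (auto simp: x y)
  define \<psi> where "\<psi> = inv_into (verts G) \<phi>"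
  have b: "bij_betw \<phi> (verts G) (verts H)" and E: "edges H = (`) \<phi> ` edges G"
    using \<phi> by (auto simp: graph_iso_def)
  have \<psi>: "\<psi> (\<phi> v) = v" if "v \<in> verts G" for v
    using b that by (simp add: \<psi>_def bij_betw_inv_into_left)
  have im: "\<psi> ` \<phi> ` e = e" if "e \<in> edges G" for e
  proof -
    have "e \<subseteq> verts G" using G that by (auto simp: rooted_graph_def simple_graph_def)
    then show ?thesis using \<psi> by (force simp: image_image)
  qed
  have "graph_iso \<psi> H G"
    unfolding graph_iso_def
  proof
    show "bij_betw \<psi> (verts H) (verts G)" using b by (simp add: \<psi>_def bij_betw_inv_into)
    show "edges G = (`) \<psi> ` edges H" unfolding E using im by (force simp: image_image)
  qed
  moreover have "map \<psi> ss = rs"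
  proof -
    have "set rs \<subseteq> verts G" using G by (simp add: rooted_graph_def)
    then have "map (\<psi> \<circ> \<phi>) rs = rs" using \<psi> by (intro map_idI) auto
    then show ?thesis using \<phi>(2) by auto
  qed
  moreover have "\<forall>e\<in>edges H. m (\<psi> ` e) = n e" using im \<phi>(3) E by auto
  ultimately show ?thesis using G H by (auto simp: x y)
qed

lemma rooted_iso_trans:
  assumes "rooted_iso x y" "rooted_iso y z" shows "rooted_iso x z"
proof -
  obtain G m rs where x: "x = (G, m, rs)" by (cases x)
  obtain H n ss where y: "y = (H, n, ss)" by (cases y)
  obtain K k ts where z: "z = (K, k, ts)" by (cases z)
  from assms obtain \<phi> \<psi> where G: "rooted_graph G rs" "rooted_graph K ts"
    and \<phi>: "graph_iso \<phi> G H" "map \<phi> rs = ss" "\<forall>e\<in>edges G. n (\<phi> ` e) = m e"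
    and \<psi>: "graph_iso \<psi> H K" "map \<psi> ss = ts" "\<forall>e\<in>edges H. k (\<psi> ` e) = n e"
    by (auto simp: x y z)
  have "graph_iso (\<psi> \<circ> \<phi>) G K"
    using \<phi>(1) \<psi>(1) by (auto simp: graph_iso_def image_comp intro: bij_betw_trans)
  moreover have "map (\<psi> \<circ> \<phi>) rs = ts" using \<phi>(2) \<psi>(2) by auto
  moreover have "\<forall>e\<in>edges G. k ((\<psi> \<circ> \<phi>) ` e) = m e"
  proof
    fix e assume e: "e \<in> edges G"
    then have "\<phi> ` e \<in> edges H" using \<phi>(1) by (simp add: graph_iso_def)
    then have "k (\<psi> ` \<phi> ` e) = m e" using \<phi>(3) \<psi>(3) e by simp
    then show "k ((\<psi> \<circ> \<phi>) ` e) = m e" by (simp add: image_image)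
  qed
  ultimately show ?thesis using G by (auto simp: x z)
qed

lemma rooted_iso_ex: "\<exists>x. rooted_iso x x"
proof
  show "rooted_iso (\<lparr>verts = {0}, edges = {}\<rparr>, (\<lambda>_. undefined), [0])
                   (\<lparr>verts = {0}, edges = {}\<rparr>, (\<lambda>_. undefined), [0])"
    by (auto simp: rooted_graph_def simple_graph_def locally_finite_graph_def neighbours_def
      connected_graph_def graph_iso_def intro!: exI[of _ id])
qed

quotient_type 'm rooted = "graph \<times> (nat set \<Rightarrow> 'm) \<times> nat list" / partial: rooted_iso
proof (rule part_equivpI)
  show "\<exists>x :: graph \<times> (nat set \<Rightarrow> 'm) \<times> nat list. rooted_iso x x" by (rule rooted_iso_ex)
qed (auto intro!: sympI transpI intro: rooted_iso_sym rooted_iso_trans)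

lemma rooted_iso_neighbours:
  assumes "simple_graph G" "graph_iso \<phi> G H" "v \<in> verts G"
  shows "bij_betw \<phi> (neighbours G v) (neighbours H (\<phi> v))"
proof -
  have b: "bij_betw \<phi> (verts G) (verts H)" and E: "edges H = (`) \<phi> ` edges G"
    using assms by (auto simp: graph_iso_def)
  have inj: "inj_on \<phi> (verts G)" using b by (rule bij_betw_imp_inj_on)
  have sub: "neighbours G v \<subseteq> verts G"
    using assms(1) by (auto simp: neighbours_def simple_graph_def)
  have "\<phi> ` neighbours G v = neighbours H (\<phi> v)"
  proof (intro equalityI subsetI)
    fix y assume "y \<in> \<phi> ` neighbours G v"
    then obtain u where u: "{v, u} \<in> edges G" "y = \<phi> u" by (auto simp: neighbours_def)
    then have "\<phi> ` {v, u} \<in> edges H" unfolding E by blast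
    then show "y \<in> neighbours H (\<phi> v)" using u by (simp add: neighbours_def)
  next
    fix y assume "y \<in> neighbours H (\<phi> v)"
    then obtain e where e: "e \<in> edges G" "{\<phi> v, y} = \<phi> ` e"
      unfolding neighbours_def E by auto
    have es: "e \<subseteq> verts G" "card e = 2" using assms(1) e by (auto simp: simple_graph_def)
    then obtain a c where ac: "e = {a, c}" "a \<noteq> c" by (auto simp: card_2_iff)
    have "\<phi> a \<noteq> \<phi> c" using inj ac es by (auto dest: inj_onD)
    with e ac have "(\<phi> v = \<phi> a \<and> y = \<phi> c) \<or> (\<phi> v = \<phi> c \<and> y = \<phi> a)"
      by (auto simp: doubleton_eq_iff)
    then have "(v = a \<and> y = \<phi> c) \<or> (v = c \<and> y = \<phi> a)"
      using inj es ac assms(3) by (auto dest: inj_onD)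
    then show "y \<in> \<phi> ` neighbours G v"
      using e ac by (auto simp: neighbours_def insert_commute)
  qed
  then show ?thesis using inj_on_subset[OF inj sub] by (simp add: bij_betw_def)
qed

lift_definition map_marks :: "('m \<Rightarrow> 'k) \<Rightarrow> 'm rooted \<Rightarrow> 'k rooted" is
  "\<lambda>f (G, m, rs). (G, f \<circ> m, rs)"
  by (clarsimp, rule_tac x=\<phi> in exI, simp)

lift_definition matched_graph :: "bool rooted \<Rightarrow> bool" is
  "\<lambda>(G, m, rs). is_matching G {e \<in> edges G. m e}"
proof -
  have imp: "is_matching H {e \<in> edges H. n e}"
    if "rooted_iso (G, m, rs) (H, n, ss)" "is_matching G {e \<in> edges G. m e}"
    for G H m n rs ss
  proof -
    from that obtain \<phi> where G: "simple_graph G" and \<phi>: "graph_iso \<phi> G H"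
      "\<forall>e\<in>edges G. n (\<phi> ` e) = m e" by (elim rooted_isoE)
    have inj: "inj_on \<phi> (verts G)" and E: "edges H = (`) \<phi> ` edges G"
      using \<phi> by (auto simp: graph_iso_def bij_betw_def)
    have "disjnt (\<phi> ` e) (\<phi> ` e')"
      if "e \<in> edges G" "e' \<in> edges G" "disjnt e e'" for e e'
      using inj_on_image_Int[OF inj edge_subset_verts[OF G that(1)] edge_subset_verts[OF G that(2)]] that(3)
      by (simp add: disjnt_def)
    then have *: "disjnt (\<phi> ` e) (\<phi> ` e')"
      if "e \<in> edges G" "e' \<in> edges G" "m e" "m e'" "e \<noteq> e'" for e e'
      using \<open>is_matching G _\<close> that by (simp add: is_matching_def pairwise_def)
    show ?thesis
      unfolding is_matching_def pairwise_def
    proof (intro conjI ballI impI)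
      fix d d' assume d: "d \<in> {e \<in> edges H. n e}" "d' \<in> {e \<in> edges H. n e}" "d \<noteq> d'"
      then obtain e e' where "d = \<phi> ` e" "d' = \<phi> ` e'" "e \<in> edges G" "e' \<in> edges G"
        unfolding E by auto
      with d \<phi>(2) show "disjnt d d'" using *[of e e'] by auto
    qed auto
  qed
  show "\<And>x y. rooted_iso x y \<Longrightarrow>
    (case x of (G, m, rs) \<Rightarrow> is_matching G {e \<in> edges G. m e}) =
    (case y of (G, m, rs) \<Rightarrow> is_matching G {e \<in> edges G. m e})"
    using imp rooted_iso_sym by (clarsimp simp del: rooted_iso.simps) blast
qed

lift_definition root_matched :: "bool rooted \<Rightarrow> bool" is
  "\<lambda>(G, m, rs). \<exists>v\<in>neighbours G (hd rs). m {hd rs, v}"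
proof -
  have imp: "\<exists>v\<in>neighbours H (hd ss). n {hd ss, v}"
    if "rooted_iso (G, m, rs) (H, n, ss)" "v \<in> neighbours G (hd rs)" "m {hd rs, v}"
    for G H m n rs ss v
  proof -
    from that obtain \<phi> where G: "simple_graph G" and \<phi>: "graph_iso \<phi> G H"
      "\<forall>e\<in>edges G. n (\<phi> ` e) = m e" and rs: "map \<phi> rs = ss" "rs \<noteq> []" "hd rs \<in> verts G"
      by (elim rooted_isoE)
    have "\<phi> v \<in> neighbours H (\<phi> (hd rs))"
      using rooted_iso_neighbours[OF G \<phi>(1) rs(3)] that(2) by (auto simp: bij_betw_def)
    moreover have "n (\<phi> ` {hd rs, v})"
      using bspec[OF \<phi>(2), of "{hd rs, v}"] that(2,3) by (simp add: neighbours_def)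
    ultimately show ?thesis using rs by (auto simp: hd_map)
  qed
  show "\<And>x y. rooted_iso x y \<Longrightarrow>
    (case x of (G, m, rs) \<Rightarrow> \<exists>v\<in>neighbours G (hd rs). m {hd rs, v}) =
    (case y of (G, m, rs) \<Rightarrow> \<exists>v\<in>neighbours G (hd rs). m {hd rs, v})"
    using imp rooted_iso_sym by (clarsimp simp del: rooted_iso.simps) blast
qed

lift_definition root_matched_weight :: "(real \<times> bool) rooted \<Rightarrow> real" is
  "\<lambda>(G, m, rs). \<Sum>v\<in>neighbours G (hd rs).
     if snd (m {hd rs, v}) then fst (m {hd rs, v}) else 0"
proof -
  have imp: "(\<Sum>v\<in>neighbours G (hd rs). if snd (m {hd rs, v}) then fst (m {hd rs, v}) else 0) =
    (\<Sum>v\<in>neighbours H (hd ss). if snd (n {hd ss, v}) then fst (n {hd ss, v}) else 0)"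
    if "rooted_iso (G, m, rs) (H, n, ss)"
    for G H rs ss and m n :: "nat set \<Rightarrow> real \<times> bool"
  proof -
    from that obtain \<phi> where G: "simple_graph G" and \<phi>: "graph_iso \<phi> G H"
      "\<forall>e\<in>edges G. n (\<phi> ` e) = m e" and rs: "map \<phi> rs = ss" "rs \<noteq> []" "hd rs \<in> verts G"
      by (elim rooted_isoE)
    have hd: "hd ss = \<phi> (hd rs)" using rs by (auto simp: hd_map)
    have "n {hd ss, \<phi> v} = m {hd rs, v}" if "v \<in> neighbours G (hd rs)" for v
    proof -
      have "{hd rs, v} \<in> edges G" using that by (simp add: neighbours_def)
      with \<phi>(2) have "n (\<phi> ` {hd rs, v}) = m {hd rs, v}" by (rule bspec)
      then show ?thesis by (simp add: hd)
    qed
    then show ?thesis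
      unfolding sum.reindex_bij_betw[OF rooted_iso_neighbours[OF G \<phi>(1) rs(3), folded hd], symmetric]
      by (intro sum.cong) auto
  qed
  fix x y :: "graph \<times> (nat set \<Rightarrow> real \<times> bool) \<times> nat list"
  assume "rooted_iso x y"
  then show "(case x of (G, m, rs) \<Rightarrow> \<Sum>v\<in>neighbours G (hd rs).
       if snd (m {hd rs, v}) then fst (m {hd rs, v}) else 0) =
    (case y of (G, m, rs) \<Rightarrow> \<Sum>v\<in>neighbours G (hd rs).
       if snd (m {hd rs, v}) then fst (m {hd rs, v}) else 0)"
    by (cases x, cases y) (simp only: prod.case, rule imp)
qed

lemma rooted_iso_vertex:
  assumes "rooted_graph G rs" "rooted_graph H ss" "graph_iso \<phi> G H" "map \<phi> rs = ss"
    "\<forall>e\<in>edges G. n (\<phi> ` e) = m e" "v \<in> verts G"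
  shows "abs_rooted (G, m, [hd rs, v]) = abs_rooted (H, n, [hd ss, \<phi> v])"
    and "abs_rooted (G, m, [v, hd rs]) = abs_rooted (H, n, [\<phi> v, hd ss])"
proof -
  have "hd rs \<in> verts G" "hd ss \<in> verts H" using assms(1,2) by (simp_all add: hd_root)
  moreover have "hd ss = \<phi> (hd rs)" "\<phi> v \<in> verts H"
    using assms by (auto simp: rooted_graph_def hd_map graph_iso_def bij_betw_def)
  ultimately have "rooted_iso (G, m, [hd rs, v]) (H, n, [hd ss, \<phi> v])"
    "rooted_iso (G, m, [v, hd rs]) (H, n, [\<phi> v, hd ss])"
    using assms by (auto simp: rooted_graph_def intro!: exI[of _ \<phi>])
  then show "abs_rooted (G, m, [hd rs, v]) = abs_rooted (H, n, [hd ss, \<phi> v])"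
    "abs_rooted (G, m, [v, hd rs]) = abs_rooted (H, n, [\<phi> v, hd ss])"
    using Quotient_rel_abs[OF Quotient_rooted] by blast+
qed

text \<open>The sums \<open>\<Sum>\<^sub>v f(G, o, v)\<close> and \<open>\<Sum>\<^sub>v f(G, v, o)\<close> of the mass transport principle.\<close>

lift_definition mass_out :: "('m rooted \<Rightarrow> ennreal) \<Rightarrow> 'm rooted \<Rightarrow> ennreal" is
  "\<lambda>f (G, m, rs). \<integral>\<^sup>+ v. f (abs_rooted (G, m, [hd rs, v])) \<partial>count_space (verts G)"
proof (clarsimp)
  fix f :: "'m rooted \<Rightarrow> ennreal" and G H m n rs \<phi>
  assume *: "rooted_graph G rs" "rooted_graph H (map \<phi> rs)" "graph_iso \<phi> G H"
    "\<forall>e\<in>edges G. n (\<phi> ` e) = (m e :: 'm)"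
  have b: "bij_betw \<phi> (verts G) (verts H)" using * by (simp add: graph_iso_def)
  show "(\<integral>\<^sup>+ v. f (abs_rooted (G, m, [hd rs, v])) \<partial>count_space (verts G)) =
    (\<integral>\<^sup>+ v. f (abs_rooted (H, n, [hd (map \<phi> rs), v])) \<partial>count_space (verts H))"
    unfolding nn_integral_bij_count_space[OF b, symmetric]
    by (intro nn_integral_cong) (use rooted_iso_vertex(1)[OF *(1-3) refl *(4)] in auto)
qed

lift_definition mass_in :: "('m rooted \<Rightarrow> ennreal) \<Rightarrow> 'm rooted \<Rightarrow> ennreal" is
  "\<lambda>f (G, m, rs). \<integral>\<^sup>+ v. f (abs_rooted (G, m, [v, hd rs])) \<partial>count_space (verts G)"
proof (clarsimp)
  fix f :: "'m rooted \<Rightarrow> ennreal" and G H m n rs \<phi>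
  assume *: "rooted_graph G rs" "rooted_graph H (map \<phi> rs)" "graph_iso \<phi> G H"
    "\<forall>e\<in>edges G. n (\<phi> ` e) = (m e :: 'm)"
  have b: "bij_betw \<phi> (verts G) (verts H)" using * by (simp add: graph_iso_def)
  show "(\<integral>\<^sup>+ v. f (abs_rooted (G, m, [v, hd rs])) \<partial>count_space (verts G)) =
    (\<integral>\<^sup>+ v. f (abs_rooted (H, n, [v, hd (map \<phi> rs)])) \<partial>count_space (verts H))"
    unfolding nn_integral_bij_count_space[OF b, symmetric]
    by (intro nn_integral_cong) (use rooted_iso_vertex(2)[OF *(1-3) refl *(4)] in auto)
qed


section \<open>Local topology and convergence in law\<close>

text \<open>The ball around a list of roots is the union of the balls around the single roots; for
  connected graphs and a fixed number of roots this yields the same topology as balls around the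
  first root.\<close>

definition graph_ball :: "graph \<Rightarrow> nat list \<Rightarrow> nat \<Rightarrow> graph" where
  "graph_ball G rs r =
     induced_subgraph G {v. \<exists>u\<in>set rs. \<exists>k\<le>r. (u, v) \<in> adj_rel G ^^ k}"

text \<open>The graphs whose \<open>r\<close>-ball is isomorphic to that of \<open>(H, ss)\<close>, the mark of the edge
  corresponding to \<open>e\<close> lying in \<open>U e\<close>.  For discrete marks and singletons \<open>U e\<close> this says that the
  balls are isomorphic as marked graphs.\<close>

definition local_nbhd :: "graph \<Rightarrow> nat list \<Rightarrow> nat \<Rightarrow> (nat set \<Rightarrow> 'm set) \<Rightarrow> 'm rooted set" where
  "local_nbhd H ss r U =
     abs_rooted ` {(G, m, rs). rooted_graph G rs \<and>
       (\<exists>\<phi>. graph_iso \<phi> (graph_ball H ss r) (graph_ball G rs r) \<and> map \<phi> ss = rs \<and>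
            (\<forall>e\<in>edges (graph_ball H ss r). m (\<phi> ` e) \<in> U e))}"

instantiation rooted :: (topological_space) topological_space
begin

definition open_rooted :: "'a rooted set \<Rightarrow> bool" where
  "open_rooted =
     generate_topology {local_nbhd H ss r U | H ss r U. rooted_graph H ss \<and> (\<forall>e. open (U e))}"

instance
  by standard (auto simp: open_rooted_def intro: generate_topology.intros)

end

text \<open>Unmarked graphs are graphs with marks in \<open>unit\<close>.\<close>

instantiation unit :: topological_space
begin

definition open_unit :: "unit set \<Rightarrow> bool" where "open_unit S = True"

instance
  by standard (auto simp: open_unit_def)

end

definition borel_law :: "'a::topological_space measure \<Rightarrow> bool" where
  "borel_law \<mu> \<longleftrightarrow> prob_space \<mu> \<and> sets \<mu> = sets borel"

definition converges_in_law ::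
  "(nat \<Rightarrow> 'a::topological_space measure) \<Rightarrow> 'a measure \<Rightarrow> bool" where
  "converges_in_law \<mu>s \<mu> \<longleftrightarrow> borel_law \<mu> \<and> (\<forall>n. borel_law (\<mu>s n)) \<and>
     (\<forall>f :: 'a \<Rightarrow> real. continuous_on UNIV f \<and> bounded (range f) \<longrightarrow>
        (\<lambda>n. \<integral>x. f x \<partial>\<mu>s n) \<longlonglongrightarrow> (\<integral>x. f x \<partial>\<mu>))"

text \<open>The law of a random finite marked graph rooted at a uniform vertex; only the component of the
  root is kept.\<close>

definition uniform_root_law ::
  "(graph \<times> (nat set \<Rightarrow> 'm::topological_space)) pmf \<Rightarrow> 'm rooted measure" where
  "uniform_root_law p =
     distr (measure_pmf
              (bind_pmf p (\<lambda>(G, m). map_pmf (\<lambda>v. (graph_component G v, m, [v]))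
                                            (pmf_of_set (verts G)))))
           borel abs_rooted"

definition BS_converges ::
  "(nat \<Rightarrow> (graph \<times> (nat set \<Rightarrow> 'm::topological_space)) pmf) \<Rightarrow> 'm rooted measure \<Rightarrow> bool" where
  "BS_converges p \<mu> \<longleftrightarrow> converges_in_law (\<lambda>n. uniform_root_law (p n)) \<mu>"


section \<open>The unimodular Bienayme-Galton-Watson tree\<close>

definition gen_fun :: "nat pmf \<Rightarrow> real \<Rightarrow> real" where
  "gen_fun \<pi> t = (\<Sum>k. pmf \<pi> k * t ^ k)"

text \<open>The derivative is taken within the unit interval, hence one-sided at its end points.\<close>

definition gen_fun_deriv :: "nat pmf \<Rightarrow> real \<Rightarrow> real" where
  "gen_fun_deriv \<pi> t = vector_derivative (gen_fun \<pi>) (at t within {0..1})"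

definition hat_gen_fun :: "nat pmf \<Rightarrow> real \<Rightarrow> real" where
  "hat_gen_fun \<pi> t = gen_fun_deriv \<pi> t / gen_fun_deriv \<pi> 1"

text \<open>The probability measure with generating function \<^term>\<open>hat_gen_fun \<pi>\<close>: the size-biased
  version of \<open>\<pi>\<close> minus one, that is, the number of children of a non-root vertex.\<close>

definition hat_pmf :: "nat pmf \<Rightarrow> nat pmf" where
  "hat_pmf \<pi> = embed_pmf (\<lambda>k. real (Suc k) * pmf \<pi> (Suc k) / gen_fun_deriv \<pi> 1)"

text \<open>The tree in which the word \<open>u\<close> has the children \<open>u @ [i]\<close>, \<open>i < N u\<close> (Ulam-Harris encoding).\<close>

definition ulam_harris_words :: "(nat list \<Rightarrow> nat) \<Rightarrow> nat list set" where
  "ulam_harris_words N = {u. \<forall>j<length u. u ! j < N (take j u)}"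

definition ulam_harris_tree :: "(nat list \<Rightarrow> nat) \<Rightarrow> graph" where
  "ulam_harris_tree N =
     \<lparr>verts = to_nat ` ulam_harris_words N,
      edges = {{to_nat u, to_nat (u @ [i])} | u i. u @ [i] \<in> ulam_harris_words N}\<rparr>"

definition offspring_law :: "nat pmf \<Rightarrow> (nat list \<Rightarrow> nat) measure" where
  "offspring_law \<pi> =
     PiM UNIV (\<lambda>u :: nat list. measure_pmf (if u = [] then \<pi> else hat_pmf \<pi>))"

definition ubgw_law :: "nat pmf \<Rightarrow> unit rooted measure" where
  "ubgw_law \<pi> = distr (offspring_law \<pi>) borel
     (\<lambda>N. abs_rooted (ulam_harris_tree N, (\<lambda>_. ()), [to_nat ([] :: nat list)]))"

text \<open>I.i.d. weights are put on all pairs of natural numbers, independently of the tree; only those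
  on the edges of the tree are retained.\<close>

definition weighted_ubgw_law :: "nat pmf \<Rightarrow> real measure \<Rightarrow> real rooted measure" where
  "weighted_ubgw_law \<pi> \<omega> =
     distr (offspring_law \<pi> \<Otimes>\<^sub>M PiM {e :: nat set. card e = 2} (\<lambda>_. \<omega>)) borel
       (\<lambda>(N, w). abs_rooted (ulam_harris_tree N, w, [to_nat ([] :: nat list)]))"


section \<open>Optimal unimodular matchings\<close>

definition admissible_weights :: "real measure \<Rightarrow> bool" where
  "admissible_weights \<omega> \<longleftrightarrow> borel_law \<omega> \<and> integrable \<omega> (\<lambda>x. x) \<and> (\<forall>x. measure \<omega> {x} = 0) \<and>
     (\<exists>a b. \<exists>g \<in> borel_measurable borel. a < b \<and> (\<forall>x\<in>{a<..<b}. 0 < g x) \<and>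
        restrict_space \<omega> {a<..<b} =
        density (restrict_space lborel {a<..<b}) (\<lambda>x. ennreal (g x)))"

definition unimodular :: "'m::topological_space rooted measure \<Rightarrow> bool" where
  "unimodular \<mu> \<longleftrightarrow> (\<forall>f \<in> borel_measurable borel.
     (\<integral>\<^sup>+ x. mass_out f x \<partial>\<mu>) = (\<integral>\<^sup>+ x. mass_in f x \<partial>\<mu>))"

text \<open>An edge mark \<open>(x, b)\<close> consists of the weight \<open>x\<close> and of the indicator \<open>b\<close> of the matching.\<close>

definition unimodular_matching ::
  "nat pmf \<Rightarrow> real measure \<Rightarrow> (real \<times> bool) rooted measure \<Rightarrow> bool" where
  "unimodular_matching \<pi> \<omega> \<mu> \<longleftrightarrow> borel_law \<mu> \<and> unimodular \<mu> \<and>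
     (AE x in \<mu>. matched_graph (map_marks snd x)) \<and>
     distr \<mu> borel (map_marks fst) = weighted_ubgw_law \<pi> \<omega>"

definition matching_size :: "(real \<times> bool) rooted measure \<Rightarrow> real" where
  "matching_size \<mu> = measure \<mu> {x. root_matched (map_marks snd x)}"

definition matching_weight :: "(real \<times> bool) rooted measure \<Rightarrow> real" where
  "matching_weight \<mu> = (\<integral>x. root_matched_weight x \<partial>\<mu>)"

definition optimal_matching ::
  "nat pmf \<Rightarrow> real measure \<Rightarrow> (real \<times> bool) rooted measure \<Rightarrow> bool" where
  "optimal_matching \<pi> \<omega> \<mu> \<longleftrightarrow> unimodular_matching \<pi> \<omega> \<mu> \<and>
     (\<forall>\<nu>. unimodular_matching \<pi> \<omega> \<nu> \<longrightarrow>
        matching_size \<nu> < matching_size \<mu> \<or>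
        (matching_size \<nu> = matching_size \<mu> \<and> matching_weight \<nu> \<le> matching_weight \<mu>))"


section \<open>The two sets of laws and their distance\<close>

definition law_hull :: "'a::topological_space measure set \<Rightarrow> 'a measure set" where
  "law_hull S = {\<mu>. borel_law \<mu> \<and>
     (\<exists>F c. finite F \<and> F \<subseteq> S \<and> (\<forall>\<nu>\<in>F. 0 \<le> c \<nu>) \<and> sum c F = 1 \<and>
        (\<forall>A\<in>sets borel. measure \<mu> A = (\<Sum>\<nu>\<in>F. c \<nu> * measure \<nu> A)))}"

definition C_w :: "nat pmf \<Rightarrow> bool rooted measure set" where
  "C_w \<pi> = law_hull {distr \<mu> borel (map_marks snd) | \<mu> \<omega>.
     admissible_weights \<omega> \<and> optimal_matching \<pi> \<omega> \<mu>}"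

text \<open>Graphs are themselves allowed to be random; a deterministic sequence is the case of point
  masses.  Given the graph, the matching is uniform among those of maximum size.\<close>

definition uniform_maximum_matching :: "graph pmf \<Rightarrow> (graph \<times> (nat set \<Rightarrow> bool)) pmf" where
  "uniform_maximum_matching p =
     bind_pmf p (\<lambda>G. map_pmf (\<lambda>M. (G, \<lambda>e. e \<in> M)) (pmf_of_set (maximum_matchings G)))"

definition C_U :: "nat pmf \<Rightarrow> bool rooted measure set" where
  "C_U \<pi> = law_hull {\<mu>. \<exists>(Gs :: nat \<Rightarrow> graph pmf) (s :: nat \<Rightarrow> nat).
     (\<forall>n. \<forall>G\<in>set_pmf (Gs n). finite_graph G) \<and>
     BS_converges (\<lambda>n. map_pmf (\<lambda>G. (G, \<lambda>_. ())) (Gs n)) (ubgw_law \<pi>) \<and>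
     strict_mono s \<and> BS_converges (\<lambda>n. uniform_maximum_matching (Gs (s n))) \<mu>}"

definition dTV :: "'a::topological_space measure \<Rightarrow> 'a measure \<Rightarrow> real" where
  "dTV \<mu> \<nu> = (SUP A\<in>sets borel. \<bar>measure \<mu> A - measure \<nu> A\<bar>)"

definition set_dTV :: "'a::topological_space measure set \<Rightarrow> 'a measure set \<Rightarrow> ereal" where
  "set_dTV C D = (INF \<mu>\<in>C. INF \<nu>\<in>D. ereal (dTV \<mu> \<nu>))"

end

theory Submission
  imports Defs
begin

text \<open>Both families of laws are compared on finite components of one shape.  Since \<open>hat \<pi>\<close> charges
  \<open>0\<close> and some \<open>d - 1 \<ge> 1\<close>, the tree is with positive probability a spider rooted at its centre: the
  root and its neighbours have degree \<open>d\<close> and all other vertices are leaves.  Let \<open>A\<close> be the event that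
  this happens and that the matching leaves the centre unmatched but covers its neighbours.

  A maximum matching of a spider either matches each of the \<open>d\<close> neighbours to one of its \<open>d - 1\<close>
  leaves, or it matches one of them to the centre and each of the others to a leaf.  So a uniform
  maximum matching leaves the centre unmatched with probability \<open>(d - 1) / (2 d - 1)\<close>, whatever the
  rest of the graph is (\<open>card_unmatched_centre\<close>).  A matching of maximal weight leaves it unmatched if
  and only if each of its edges is outweighed by an edge to a leaf of the same leg, which for
  independent weights without atoms happens with probability \<open>(1 - 1/d)^d\<close> (\<open>prob_outweighed\<close>).  This
  number does not depend on the law of the weights, and by Bernoulli's inequality it is smaller than
  the first one (\<open>spider_probabilities_less\<close>).  Both bounds on the probability of \<open>A\<close> are inherited by
  convex combinations, so the event \<open>A\<close> separates the two hulls.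

  The bound passes to limits of uniform maximum matchings because \<open>A\<close> and the event that the root is
  the centre of a spider depend only on the ball of radius three, hence are open and closed in the
  local topology.

  For optimal matchings it must be shown that optimality in mean implies optimality on spiders.  If
  the centre is unmatched although one of its edges is heavier than the matched edge next to it, then
  exchanging the two edges improves the matching.  For a threshold \<open>q\<close> strictly between the two
  weights, and if the pair of edges is the only one separated by \<open>q\<close> in this way, the exchange is a
  map on isomorphism classes that is continuous on an open set of finite graphs and the identity
  elsewhere.  The image of a unimodular matching under this map is a unimodular matching of the same
  size by the mass transport principle, and it has a larger weight if such an exchange takes place
  with positive probability (\<open>optimal_swap_centre_null\<close>).  Rational thresholds suffice, because among
  the improving edges of the centre the heaviest one can be isolated (\<open>swappable_exists\<close>).\<close>

section \<open>Balls in rooted graphs\<close>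

definition ball_verts :: "graph \<Rightarrow> nat list \<Rightarrow> nat \<Rightarrow> nat set" where
  "ball_verts G rs r = {v. \<exists>u\<in>set rs. \<exists>k\<le>r. (u, v) \<in> adj_rel G ^^ k}"

lemma verts_graph_ball: "verts (graph_ball G rs r) = verts G \<inter> ball_verts G rs r"
  and edges_graph_ball: "edges (graph_ball G rs r) = {e \<in> edges G. e \<subseteq> ball_verts G rs r}"
  by (simp_all add: graph_ball_def ball_verts_def induced_subgraph_def)

lemma ball_verts_0 [simp]: "ball_verts G rs 0 = set rs"
  by (auto simp: ball_verts_def)

lemma ball_verts_Suc:
  "ball_verts G rs (Suc r) = ball_verts G rs r \<union> (\<Union>v\<in>ball_verts G rs r. neighbours G v)"
proof (intro equalityI subsetI)
  fix v assume "v \<in> ball_verts G rs (Suc r)"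
  then obtain u k where u: "u \<in> set rs" "k \<le> Suc r" "(u, v) \<in> adj_rel G ^^ k"
    by (auto simp: ball_verts_def)
  show "v \<in> ball_verts G rs r \<union> (\<Union>v\<in>ball_verts G rs r. neighbours G v)"
  proof (cases "k \<le> r")
    case True
    then show ?thesis using u by (auto simp: ball_verts_def)
  next
    case False
    then have "k = Suc r" using u by simp
    then obtain w where "(u, w) \<in> adj_rel G ^^ r" "(w, v) \<in> adj_rel G"
      using u(3) by auto
    then have "w \<in> ball_verts G rs r" "v \<in> neighbours G w"
      using u(1) by (auto simp: ball_verts_def adj_rel_def neighbours_def)
    then show ?thesis by blast
  qed
next
  fix v assume "v \<in> ball_verts G rs r \<union> (\<Union>v\<in>ball_verts G rs r. neighbours G v)"
  then consider "v \<in> ball_verts G rs r"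
    | w where "w \<in> ball_verts G rs r" "v \<in> neighbours G w" by auto
  then show "v \<in> ball_verts G rs (Suc r)"
  proof cases
    case 1
    then show ?thesis unfolding ball_verts_def using le_SucI by blast
  next
    case 2
    then obtain u k where "u \<in> set rs" "k \<le> r" "(u, w) \<in> adj_rel G ^^ k"
      by (auto simp: ball_verts_def)
    moreover from this 2 have "(u, v) \<in> adj_rel G ^^ Suc k"
      by (auto simp: adj_rel_def neighbours_def)
    ultimately show ?thesis unfolding ball_verts_def using Suc_le_mono by blast
  qed
qed

lemma neighbours_subset_verts: "simple_graph G \<Longrightarrow> neighbours G v \<subseteq> verts G"
  by (auto simp: neighbours_def simple_graph_def)

lemma neighbours_sym: "v \<in> neighbours G u \<longleftrightarrow> u \<in> neighbours G v"
  by (simp add: neighbours_def insert_commute)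

lemma not_self_neighbour: "simple_graph G \<Longrightarrow> v \<notin> neighbours G v"
  by (auto simp: neighbours_def simple_graph_def)

lemma edge_neighbour: "v \<in> neighbours G u \<Longrightarrow> {u, v} \<in> edges G"
  by (simp add: neighbours_def)

lemma edgeE:
  assumes "simple_graph G" "e \<in> edges G"
  obtains u v where "e = {u, v}" "u \<noteq> v" "v \<in> neighbours G u" "u \<in> verts G" "v \<in> verts G"
  using assms by (force simp: simple_graph_def card_2_iff neighbours_def)

lemma ball_verts_mono: "r \<le> s \<Longrightarrow> ball_verts G rs r \<subseteq> ball_verts G rs s"
  unfolding ball_verts_def using order_trans by blast

lemma ball_verts_roots: "set rs \<subseteq> ball_verts G rs r"
  using ball_verts_mono[of 0 r] by simp

lemma neighbours_ball_verts: "v \<in> ball_verts G rs k \<Longrightarrow> k < r \<Longrightarrow> neighbours G v \<subseteq> ball_verts G rs r"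
  using ball_verts_Suc[of G rs k] ball_verts_mono[of "Suc k" r G rs] by auto

lemma ball_verts_subset:
  assumes "simple_graph G" "set rs \<subseteq> verts G" shows "ball_verts G rs r \<subseteq> verts G"
  using neighbours_subset_verts[OF assms(1)] assms(2) by (induction r) (auto simp: ball_verts_Suc)

lemma ball_verts_trans:
  assumes "set rs' \<subseteq> ball_verts G rs j" shows "ball_verts G rs' r \<subseteq> ball_verts G rs (j + r)"
proof (induction r)
  case (Suc r)
  then show ?case using ball_verts_Suc[of G rs "j + r"] by (auto simp: ball_verts_Suc)
qed (use assms in simp)

lemma finite_ball_verts:
  assumes "rooted_graph G rs" shows "finite (ball_verts G rs r)"
proof (induction r)
  case (Suc r)
  have "ball_verts G rs r \<subseteq> verts G"
    using assms by (intro ball_verts_subset) (auto simp: rooted_graph_def)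
  then show ?case
    using Suc assms by (auto simp: ball_verts_Suc rooted_graph_def locally_finite_graph_def)
qed simp

lemma finite_ball_edges:
  assumes "rooted_graph G rs" shows "finite (edges (graph_ball G rs r))"
  using finite_subset[of "edges (graph_ball G rs r)" "Pow (ball_verts G rs r)"]
    finite_ball_verts[OF assms] by (auto simp: edges_graph_ball)

lemma in_ball_verts:
  assumes "rooted_graph G rs" "v \<in> verts G" shows "\<exists>r. v \<in> ball_verts G rs r"
proof -
  have "hd rs \<in> set rs" "hd rs \<in> verts G" using assms by (auto simp: rooted_graph_def)
  then have "(hd rs, v) \<in> (adj_rel G)\<^sup>*"
    using assms by (auto simp: rooted_graph_def connected_graph_def)
  then obtain k where "(hd rs, v) \<in> adj_rel G ^^ k" using rtrancl_imp_relpow by blast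
  then show ?thesis using \<open>hd rs \<in> set rs\<close> by (auto simp: ball_verts_def)
qed

lemma finite_in_ball_verts:
  assumes "rooted_graph G rs" "finite V" "V \<subseteq> verts G" shows "\<exists>r. V \<subseteq> ball_verts G rs r"
  using assms(2,3)
proof (induction V rule: finite_induct)
  case (insert v V)
  then obtain r s where "V \<subseteq> ball_verts G rs r" "v \<in> ball_verts G rs s"
    using in_ball_verts[OF assms(1)] by blast
  then have "insert v V \<subseteq> ball_verts G rs (max r s)"
    using ball_verts_mono[of r "max r s" G rs] ball_verts_mono[of s "max r s" G rs] by auto
  then show ?case ..
qed simp

lemma simple_graph_ball: "simple_graph G \<Longrightarrow> simple_graph (graph_ball G rs r)"
  by (auto simp: simple_graph_def edges_graph_ball verts_graph_ball)

lemma neighbours_graph_ball: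
  assumes "v \<in> ball_verts G rs k" "k < r" shows "neighbours (graph_ball G rs r) v = neighbours G v"
  using neighbours_ball_verts[OF assms] ball_verts_mono[of k r G rs] assms
  by (auto simp: neighbours_def edges_graph_ball)

lemma rooted_graph_roots: "rooted_graph G rs \<Longrightarrow> set rs \<subseteq> verts G"
  and rooted_graph_simple: "rooted_graph G rs \<Longrightarrow> simple_graph G"
  by (auto simp: rooted_graph_def)

lemma rooted_graph_change_roots:
  "rooted_graph G rs \<Longrightarrow> rs' \<noteq> [] \<Longrightarrow> set rs' \<subseteq> verts G \<Longrightarrow> rooted_graph G rs'"
  by (auto simp: rooted_graph_def)

lemma connected_graphI:
  assumes "\<And>u. u \<in> verts G \<Longrightarrow> (v, u) \<in> (adj_rel G)\<^sup>*" shows "connected_graph G"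
  unfolding connected_graph_def
proof (intro ballI)
  have "sym (adj_rel G)" by (auto simp: sym_def adj_rel_def insert_commute)
  then have sym: "sym ((adj_rel G)\<^sup>*)" by (rule sym_rtrancl)
  fix x y assume "x \<in> verts G" "y \<in> verts G"
  then show "(x, y) \<in> (adj_rel G)\<^sup>*" using assms symD[OF sym] by (blast intro: rtrancl_trans)
qed

text \<open>An isomorphism of rooted balls determines the second list of roots, which is therefore not a
  parameter.\<close>

definition ball_iso :: "(nat \<Rightarrow> nat) \<Rightarrow> graph \<Rightarrow> nat list \<Rightarrow> graph \<Rightarrow> nat \<Rightarrow> bool" where
  "ball_iso \<phi> G rs H r \<longleftrightarrow> graph_iso \<phi> (graph_ball G rs r) (graph_ball H (map \<phi> rs) r)"

lemma graph_iso_induced: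
  assumes "graph_iso \<phi> G H" "simple_graph G" "S \<subseteq> verts G"
  shows "graph_iso \<phi> (induced_subgraph G S) (induced_subgraph H (\<phi> ` S))"
proof -
  have inj: "inj_on \<phi> (verts G)" and V: "verts H = \<phi> ` verts G" and E: "edges H = (`) \<phi> ` edges G"
    using assms(1) by (auto simp: graph_iso_def bij_betw_def)
  have "bij_betw \<phi> (verts G \<inter> S) (verts H \<inter> \<phi> ` S)"
    using assms(3) inj by (auto simp: V bij_betw_def inj_on_def)
  moreover have "e \<subseteq> S \<longleftrightarrow> \<phi> ` e \<subseteq> \<phi> ` S" if "e \<in> edges G" for e
    using inj_on_image_subset_iff[OF inj edge_subset_verts[OF assms(2) that] assms(3)] by simp
  ultimately show ?thesis
    unfolding graph_iso_def induced_subgraph_def by (auto simp: E)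
qed

lemma graph_ball_induced:
  "graph_ball G rs r = induced_subgraph G (ball_verts G rs r)"
  by (simp add: graph_ball_def ball_verts_def)

lemma graph_iso_ball_verts:
  assumes "graph_iso \<phi> G H" "simple_graph G" "set rs \<subseteq> verts G"
  shows "ball_verts H (map \<phi> rs) r = \<phi> ` ball_verts G rs r"
proof (induction r)
  case (Suc r)
  have "neighbours H (\<phi> v) = \<phi> ` neighbours G v" if "v \<in> ball_verts G rs r" for v
    using rooted_iso_neighbours[OF assms(2,1)] ball_verts_subset[OF assms(2,3), of r] that
    by (auto simp: bij_betw_def)
  then show ?case by (auto simp: Suc ball_verts_Suc)
qed simp

lemma graph_iso_imp_ball_iso:
  assumes "graph_iso \<phi> G H" "simple_graph G" "set rs \<subseteq> verts G"
  shows "ball_iso \<phi> G rs H r"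
  unfolding ball_iso_def graph_ball_induced graph_iso_ball_verts[OF assms]
  by (intro graph_iso_induced assms ball_verts_subset)

text \<open>A ball isomorphism respects neighbourhoods strictly inside the ball.  By induction on the
  radius it therefore maps smaller balls, around any roots near the original ones, to balls.\<close>

lemma ball_iso_neighbours_aux:
  assumes "ball_iso \<phi> G rs H r" "simple_graph G" "set rs \<subseteq> verts G" "k < r"
    "v \<in> ball_verts G rs k" "\<phi> v \<in> ball_verts H (map \<phi> rs) k"
  shows "bij_betw \<phi> (neighbours G v) (neighbours H (\<phi> v))"
proof -
  have "v \<in> verts (graph_ball G rs r)"
    using assms ball_verts_subset[OF assms(2,3)] ball_verts_mono[of k r G rs]
    by (auto simp: verts_graph_ball)
  with rooted_iso_neighbours[OF simple_graph_ball[OF assms(2)] assms(1)[unfolded ball_iso_def]]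
  have "bij_betw \<phi> (neighbours (graph_ball G rs r) v) (neighbours (graph_ball H (map \<phi> rs) r) (\<phi> v))"
    by blast
  then show ?thesis
    unfolding neighbours_graph_ball[OF assms(5,4)] neighbours_graph_ball[OF assms(6,4)] .
qed

lemma ball_iso_ball_verts_same:
  assumes "ball_iso \<phi> G rs H r" "simple_graph G" "set rs \<subseteq> verts G" "k \<le> r"
  shows "ball_verts H (map \<phi> rs) k = \<phi> ` ball_verts G rs k"
  using assms(4)
proof (induction k)
  case (Suc k)
  then have IH: "ball_verts H (map \<phi> rs) k = \<phi> ` ball_verts G rs k" by simp
  have "neighbours H (\<phi> v) = \<phi> ` neighbours G v" if "v \<in> ball_verts G rs k" for v
    using ball_iso_neighbours_aux[OF assms(1-3), of k v] that Suc.prems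
    by (simp add: IH bij_betw_def)
  then show ?case by (auto simp: IH ball_verts_Suc)
qed simp

lemma ball_iso_neighbours:
  assumes "ball_iso \<phi> G rs H r" "simple_graph G" "set rs \<subseteq> verts G" "k < r" "v \<in> ball_verts G rs k"
  shows "bij_betw \<phi> (neighbours G v) (neighbours H (\<phi> v))"
  using ball_iso_neighbours_aux[OF assms] ball_iso_ball_verts_same[OF assms(1-3), of k] assms(4,5)
  by simp

lemma ball_iso_ball_verts:
  assumes "ball_iso \<phi> G rs H R" "simple_graph G" "set rs \<subseteq> verts G"
    "set rs' \<subseteq> ball_verts G rs j" "j + r \<le> R"
  shows "ball_verts H (map \<phi> rs') r = \<phi> ` ball_verts G rs' r"
  using assms(5)
proof (induction r)
  case (Suc r)
  then have IH: "ball_verts H (map \<phi> rs') r = \<phi> ` ball_verts G rs' r" by simp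
  have "neighbours H (\<phi> v) = \<phi> ` neighbours G v" if "v \<in> ball_verts G rs' r" for v
    using ball_iso_neighbours[OF assms(1-3), of "j + r" v] Suc.prems that
      ball_verts_trans[OF assms(4), of r] by (auto simp: bij_betw_def)
  then show ?case by (auto simp: IH ball_verts_Suc)
qed simp

lemma induced_induced:
  "induced_subgraph (induced_subgraph G S) T = induced_subgraph G (S \<inter> T)"
  by (auto simp: induced_subgraph_def)

lemma ball_iso_restrict:
  assumes "ball_iso \<phi> G rs H R" "simple_graph G" "set rs \<subseteq> verts G"
    "set rs' \<subseteq> ball_verts G rs j" "j + r \<le> R"
  shows "ball_iso \<phi> G rs' H r"
proof -
  let ?S = "ball_verts G rs R" and ?T = "ball_verts G rs' r"
  have T: "?T \<subseteq> ?S"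
    using ball_verts_trans[OF assms(4), of r] ball_verts_mono[OF assms(5), of G rs] by blast
  have S: "?S \<subseteq> verts G" by (rule ball_verts_subset[OF assms(2,3)])
  have HS: "ball_verts H (map \<phi> rs) R = \<phi> ` ?S"
    by (rule ball_iso_ball_verts_same[OF assms(1-3) order_refl])
  have HT: "ball_verts H (map \<phi> rs') r = \<phi> ` ?T"
    by (rule ball_iso_ball_verts[OF assms])
  have "graph_iso \<phi> (induced_subgraph G ?S) (induced_subgraph H (\<phi> ` ?S))"
    using assms(1) by (simp only: ball_iso_def graph_ball_induced HS)
  then have "graph_iso \<phi> (induced_subgraph (induced_subgraph G ?S) ?T)
      (induced_subgraph (induced_subgraph H (\<phi> ` ?S)) (\<phi> ` ?T))"
    by (rule graph_iso_induced)
       (use assms(2) T S in \<open>auto simp: induced_subgraph_def simple_graph_def\<close>)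
  moreover have "?S \<inter> ?T = ?T" "\<phi> ` ?S \<inter> \<phi> ` ?T = \<phi> ` ?T" using T by auto
  ultimately show ?thesis
    unfolding ball_iso_def graph_ball_induced HT
    by (simp add: induced_induced)
qed

lemma ball_iso_mono:
  assumes "ball_iso \<phi> G rs H R" "simple_graph G" "set rs \<subseteq> verts G" "r \<le> R"
  shows "ball_iso \<phi> G rs H r"
  using ball_iso_restrict[OF assms(1-3), of rs 0 r] assms(4) by simp

lemma ball_iso_edges:
  assumes "ball_iso \<phi> G rs H r" "e \<in> edges (graph_ball G rs r)"
  shows "\<phi> ` e \<in> edges H"
proof -
  have "\<phi> ` e \<in> edges (graph_ball H (map \<phi> rs) r)"
    using assms by (auto simp: ball_iso_def graph_iso_def)
  then show ?thesis by (simp add: edges_graph_ball)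
qed

lemma ball_iso_inj:
  assumes "ball_iso \<phi> G rs H r" "simple_graph G" "set rs \<subseteq> verts G"
  shows "inj_on \<phi> (ball_verts G rs r)"
  using assms ball_verts_subset[OF assms(2,3), of r]
  by (auto simp: ball_iso_def graph_iso_def bij_betw_def verts_graph_ball Int_absorb1)

lemma induced_subgraph_verts: "simple_graph G \<Longrightarrow> induced_subgraph G (verts G) = G"
  using edge_subset_verts by (cases G) (fastforce simp: induced_subgraph_def)

text \<open>A graph that is exhausted by a ball is determined by the next larger ball: the image
  of the ball is closed under taking neighbours.\<close>

lemma ball_iso_exhausting:
  assumes "ball_iso \<phi> G rs H (Suc r)" "rooted_graph G rs" "rooted_graph H (map \<phi> rs)"
    "verts G \<subseteq> ball_verts G rs r"
  shows "graph_iso \<phi> G H"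
proof -
  have sG: "simple_graph G" "set rs \<subseteq> verts G" and sH: "simple_graph H" "set (map \<phi> rs) \<subseteq> verts H"
    using assms(2,3) by (auto simp: rooted_graph_def)
  have V: "ball_verts G rs k = verts G" if "k \<ge> r" for k
    using assms(4) ball_verts_mono[OF that, of G rs] ball_verts_subset[OF sG, of k] by blast
  have HV: "ball_verts H (map \<phi> rs) k = \<phi> ` verts G" if "k \<ge> r" "k \<le> Suc r" for k
    using ball_iso_ball_verts_same[OF assms(1) sG, of k] V that by simp
  have closed: "ball_verts H (map \<phi> rs) k \<subseteq> \<phi> ` verts G" for k
  proof (induction k)
    case 0
    then show ?case using sG by auto
  next
    case (Suc k)
    have "neighbours H w \<subseteq> \<phi> ` verts G" if "w \<in> \<phi> ` verts G" for w
    proof -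
      have "w \<in> ball_verts H (map \<phi> rs) r" using that HV[of r] by simp
      then show ?thesis using ball_verts_Suc[of H "map \<phi> rs" r] HV[of "Suc r"] by auto
    qed
    then show ?case using Suc unfolding ball_verts_Suc by blast
  qed
  have VH: "verts H = \<phi> ` verts G"
    using in_ball_verts[OF assms(3)] closed HV[of r] ball_verts_subset[OF sH, of r] by auto
  have "graph_ball G rs (Suc r) = G"
    using V[of "Suc r"] induced_subgraph_verts[OF sG(1)] by (simp add: graph_ball_induced)
  moreover have "graph_ball H (map \<phi> rs) (Suc r) = H"
    using HV[of "Suc r"] induced_subgraph_verts[OF sH(1)] by (simp add: graph_ball_induced VH)
  ultimately show ?thesis using assms(1) by (simp add: ball_iso_def)
qed

lemma ball_iso_comp:
  assumes "ball_iso \<phi> G rs H r" "ball_iso \<psi> H (map \<phi> rs) K r"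
  shows "ball_iso (\<psi> \<circ> \<phi>) G rs K r"
  using assms by (auto simp: ball_iso_def graph_iso_def image_comp intro: bij_betw_trans)

section \<open>The local topology\<close>

lemma rooted_iso_refl: "rooted_graph G rs \<Longrightarrow> rooted_iso (G, m, rs) (G, m, rs)"
  by (auto simp: graph_iso_def intro!: exI[of _ id])

lemma abs_rooted_eq_iff:
  assumes "rooted_graph G rs" "rooted_graph H ss"
  shows "abs_rooted (G, m, rs) = abs_rooted (H, n, ss) \<longleftrightarrow> rooted_iso (G, m, rs) (H, n, ss)"
  using Quotient_rel[OF Quotient_rooted, of "(G, m, rs)" "(H, n, ss)"]
    rooted_iso_refl[OF assms(1)] rooted_iso_refl[OF assms(2)] by blast

lemma abs_rooted_eqI:
  assumes "rooted_graph G rs" "rooted_graph H (map \<phi> rs)" "graph_iso \<phi> G H"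
    "\<forall>e\<in>edges G. n (\<phi> ` e) = m e"
  shows "abs_rooted (G, m, rs) = abs_rooted (H, n, map \<phi> rs)"
  unfolding abs_rooted_eq_iff[OF assms(1,2)] using assms by auto

lemma rooted_cases:
  obtains G m rs where "x = abs_rooted (G, m, rs)" "rooted_graph G rs"
proof -
  obtain G m rs where rep: "rep_rooted x = (G, m, rs)" by (cases "rep_rooted x")
  have "abs_rooted (rep_rooted x) = x" by (rule Quotient_abs_rep[OF Quotient_rooted])
  moreover have "rooted_iso (rep_rooted x) (rep_rooted x)"
    by (rule Quotient_rep_reflp[OF Quotient_rooted])
  ultimately show thesis using that rep by auto
qed

text \<open>Isomorphisms of graphs restrict to balls, so that membership in a basic open set can be tested on
  any representative.\<close>

lemma mem_local_nbhd:
  assumes "rooted_graph G rs"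
  shows "abs_rooted (G, m, rs) \<in> local_nbhd H ss r U \<longleftrightarrow>
    (\<exists>\<phi>. map \<phi> ss = rs \<and> ball_iso \<phi> H ss G r \<and> (\<forall>e\<in>edges (graph_ball H ss r). m (\<phi> ` e) \<in> U e))"
    (is "?L \<longleftrightarrow> ?R")
proof
  assume ?R
  then show ?L unfolding local_nbhd_def ball_iso_def using assms by blast
next
  assume ?L
  then obtain G' m' \<phi> where *: "rooted_graph G' (map \<phi> ss)" "ball_iso \<phi> H ss G' r"
    "\<forall>e\<in>edges (graph_ball H ss r). m' (\<phi> ` e) \<in> U e"
    "abs_rooted (G, m, rs) = abs_rooted (G', m', map \<phi> ss)"
    by (auto simp: local_nbhd_def ball_iso_def)
  then have "rooted_iso (G', m', map \<phi> ss) (G, m, rs)"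
    using abs_rooted_eq_iff[OF *(1) assms, of m' m] by simp
  then obtain \<psi> where \<psi>: "graph_iso \<psi> G' G" "map \<psi> (map \<phi> ss) = rs"
    "\<forall>e\<in>edges G'. m (\<psi> ` e) = m' e" by auto
  have "ball_iso \<psi> G' (map \<phi> ss) G r"
    using \<psi>(1) *(1) by (intro graph_iso_imp_ball_iso) (auto simp: rooted_graph_def)
  then have "ball_iso (\<psi> \<circ> \<phi>) H ss G r" by (rule ball_iso_comp[OF *(2)])
  moreover have "m ((\<psi> \<circ> \<phi>) ` e) \<in> U e" if e: "e \<in> edges (graph_ball H ss r)" for e
  proof -
    have "\<phi> ` e \<in> edges G'" by (rule ball_iso_edges[OF *(2) e])
    then have "m (\<psi> ` \<phi> ` e) = m' (\<phi> ` e)" using \<psi>(3) by simp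
    then show ?thesis using *(3) e by (simp add: image_comp)
  qed
  ultimately show ?R using \<psi>(2) by (intro exI[of _ "\<psi> \<circ> \<phi>"]) simp
qed

lemma open_local_nbhd:
  "rooted_graph H ss \<Longrightarrow> (\<And>e. open (U e)) \<Longrightarrow> open (local_nbhd H ss r U)"
  unfolding open_rooted_def by (rule generate_topology.Basis) blast

lemma self_mem_local_nbhd:
  assumes "rooted_graph G rs" "\<And>e. e \<in> edges (graph_ball G rs r) \<Longrightarrow> m e \<in> U e"
  shows "abs_rooted (G, m, rs) \<in> local_nbhd G rs r U"
  unfolding mem_local_nbhd[OF assms(1)]
  using assms(2) by (auto simp: ball_iso_def graph_iso_def intro!: exI[of _ id])

text \<open>A point is interior to a set if the graphs in the set include all those whose ball looks
  similar; to prove that a set is open this is checked at each representative.\<close>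

lemma interior_rootedI:
  assumes G: "rooted_graph G rs" and U: "\<And>e. open (U e)"
    and m: "\<And>e. e \<in> edges (graph_ball G rs r) \<Longrightarrow> m e \<in> U e"
    and Q: "\<And>\<phi> H n. rooted_graph H (map \<phi> rs) \<Longrightarrow> ball_iso \<phi> G rs H r \<Longrightarrow>
      \<forall>e\<in>edges (graph_ball G rs r). n (\<phi> ` e) \<in> U e \<Longrightarrow> abs_rooted (H, n, map \<phi> rs) \<in> Q"
  shows "abs_rooted (G, m, rs) \<in> interior Q"
proof -
  have "local_nbhd G rs r U \<subseteq> Q"
  proof
    fix x assume x: "x \<in> local_nbhd G rs r U"
    obtain H n ss where x': "x = abs_rooted (H, n, ss)" "rooted_graph H ss" by (rule rooted_cases)
    from x obtain \<phi> where "map \<phi> rs = ss" "ball_iso \<phi> G rs H r"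
      "\<forall>e\<in>edges (graph_ball G rs r). n (\<phi> ` e) \<in> U e"
      unfolding x' mem_local_nbhd[OF x'(2)] by blast
    then show "x \<in> Q" using Q[of H \<phi> n] x' by blast
  qed
  then have "local_nbhd G rs r U \<subseteq> interior Q" by (intro interior_maximal open_local_nbhd G U)
  moreover have "abs_rooted (G, m, rs) \<in> local_nbhd G rs r U" by (rule self_mem_local_nbhd[OF G m])
  ultimately show ?thesis by blast
qed

lemma open_rootedI:
  assumes "\<And>G m rs. rooted_graph G rs \<Longrightarrow> abs_rooted (G, m, rs) \<in> Q \<Longrightarrow> abs_rooted (G, m, rs) \<in> interior Q"
  shows "open Q"
proof -
  have "x \<in> interior Q" if "x \<in> Q" for x
  proof -
    obtain G m rs where "x = abs_rooted (G, m, rs)" "rooted_graph G rs" by (rule rooted_cases)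
    then show ?thesis using assms that by simp
  qed
  then have "interior Q = Q" using interior_subset by blast
  then show ?thesis using open_interior[of Q] by simp
qed

text \<open>The basic sets centred at a point form a neighbourhood base: a finite intersection of
  basic sets contains a basic set of the largest radius involved.\<close>

lemma open_rooted_local_base:
  assumes "open Q" "rooted_graph G rs" "abs_rooted (G, m, rs) \<in> Q"
  obtains r U where "\<And>e. open (U e)" "\<And>e. e \<in> edges (graph_ball G rs r) \<Longrightarrow> m e \<in> U e"
    "local_nbhd G rs r U \<subseteq> Q"
proof -
  note sG = rooted_graph_simple[OF assms(2)] rooted_graph_roots[OF assms(2)]
  define good where "good Q r U \<longleftrightarrow> (\<forall>e. open (U e)) \<and>
    (\<forall>e\<in>edges (graph_ball G rs r). m e \<in> U e) \<and> local_nbhd G rs r U \<subseteq> Q"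
    for Q :: "'a rooted set" and r and U :: "nat set \<Rightarrow> 'a set"
  have "generate_topology {local_nbhd H ss r U | H ss r U :: nat set \<Rightarrow> 'a set.
      rooted_graph H ss \<and> (\<forall>e. open (U e))} Q"
    using assms(1) by (simp add: open_rooted_def)
  then have "abs_rooted (G, m, rs) \<in> Q \<longrightarrow> (\<exists>r U. good Q r U)"
  proof (induction rule: generate_topology.induct)
    case UNIV
    then show ?case by (auto simp: good_def intro!: exI[of _ "\<lambda>_. UNIV"])
  next
    case (Int A B)
    show ?case
    proof
      assume "abs_rooted (G, m, rs) \<in> A \<inter> B"
      with Int obtain r U s V where g: "good A r U" "good B s V" by auto
      define W where "W e = (if e \<in> edges (graph_ball G rs r) then U e else UNIV) \<inter>
        (if e \<in> edges (graph_ball G rs s) then V e else UNIV)" for e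
      have *: "edges (graph_ball G rs r) \<subseteq> edges (graph_ball G rs (max r s))"
        "edges (graph_ball G rs s) \<subseteq> edges (graph_ball G rs (max r s))"
        using ball_verts_mono[of r "max r s" G rs] ball_verts_mono[of s "max r s" G rs]
        by (auto simp: edges_graph_ball)
      have "local_nbhd G rs (max r s) W \<subseteq> local_nbhd G rs r U \<inter> local_nbhd G rs s V"
      proof
        fix x assume x: "x \<in> local_nbhd G rs (max r s) W"
        obtain H n ss where x': "x = abs_rooted (H, n, ss)" "rooted_graph H ss"
          by (rule rooted_cases)
        from x obtain \<phi> where \<phi>: "map \<phi> rs = ss" "ball_iso \<phi> G rs H (max r s)"
          "\<forall>e\<in>edges (graph_ball G rs (max r s)). n (\<phi> ` e) \<in> W e"
          unfolding x' mem_local_nbhd[OF x'(2)] by blast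
        have "\<forall>e\<in>edges (graph_ball G rs r). n (\<phi> ` e) \<in> U e"
          "\<forall>e\<in>edges (graph_ball G rs s). n (\<phi> ` e) \<in> V e"
          using \<phi>(3) * by (auto simp: W_def dest!: subsetD)
        moreover have "ball_iso \<phi> G rs H r" "ball_iso \<phi> G rs H s"
          by (rule ball_iso_mono[OF \<phi>(2) sG], simp)+
        ultimately show "x \<in> local_nbhd G rs r U \<inter> local_nbhd G rs s V"
          unfolding x' Int_iff mem_local_nbhd[OF x'(2)] using \<phi>(1) by blast
      qed
      moreover have "\<forall>e. open (W e)" "\<forall>e\<in>edges (graph_ball G rs (max r s)). m e \<in> W e"
        using g by (auto simp: W_def good_def)
      ultimately have "good (A \<inter> B) (max r s) W" using g unfolding good_def by blast
      then show "\<exists>r U. good (A \<inter> B) r U" by blast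
    qed
  next
    case (UN K)
    show ?case
    proof
      assume "abs_rooted (G, m, rs) \<in> \<Union>K"
      then obtain k where k: "k \<in> K" "abs_rooted (G, m, rs) \<in> k" by blast
      with UN obtain r U where "good k r U" by meson
      with k(1) have "good (\<Union>K) r U" by (simp add: good_def) (meson Union_upper order_trans)
      then show "\<exists>r U. good (\<Union>K) r U" by blast
    qed
  next
    case (Basis A)
    then obtain H ss r U where A: "A = local_nbhd H ss r U" "rooted_graph H ss" "\<forall>e. open (U e)"
      by blast
    show ?case
    proof
      assume "abs_rooted (G, m, rs) \<in> A"
      then obtain \<phi> where \<phi>: "map \<phi> ss = rs" "ball_iso \<phi> H ss G r"
        "\<forall>e\<in>edges (graph_ball H ss r). m (\<phi> ` e) \<in> U e"
        unfolding A mem_local_nbhd[OF assms(2)] by blast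
      let ?\<psi> = "inv_into (ball_verts H ss r) \<phi>"
      note sH = rooted_graph_simple[OF A(2)] rooted_graph_roots[OF A(2)]
      have inj: "inj_on \<phi> (ball_verts H ss r)" by (rule ball_iso_inj[OF \<phi>(2) sH])
      have inv: "?\<psi> ` \<phi> ` e = e" if "e \<in> edges (graph_ball H ss r)" for e
        using that inj by (auto simp: edges_graph_ball)
      have E: "edges (graph_ball G rs r) = (`) \<phi> ` edges (graph_ball H ss r)"
        using \<phi>(1,2) by (auto simp: ball_iso_def graph_iso_def)
      have "local_nbhd G rs r (\<lambda>e. U (?\<psi> ` e)) \<subseteq> A"
      proof
        fix x assume x: "x \<in> local_nbhd G rs r (\<lambda>e. U (?\<psi> ` e))"
        obtain K n ts where x': "x = abs_rooted (K, n, ts)" "rooted_graph K ts"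
          by (rule rooted_cases)
        from x obtain \<psi> where \<psi>: "map \<psi> rs = ts" "ball_iso \<psi> G rs K r"
          "\<forall>e\<in>edges (graph_ball G rs r). n (\<psi> ` e) \<in> U (?\<psi> ` e)"
          unfolding x' mem_local_nbhd[OF x'(2)] by blast
        have "ball_iso (\<psi> \<circ> \<phi>) H ss K r"
          using ball_iso_comp[OF \<phi>(2)] \<psi>(2) \<phi>(1) by simp
        moreover have "\<forall>e\<in>edges (graph_ball H ss r). n ((\<psi> \<circ> \<phi>) ` e) \<in> U e"
          using \<psi>(3) inv by (force simp: E image_comp)
        moreover have "map (\<psi> \<circ> \<phi>) ss = ts" using \<phi>(1) \<psi>(1) by auto
        ultimately show "x \<in> A" unfolding A x' mem_local_nbhd[OF x'(2)] by blast
      qed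
      moreover have "\<forall>e\<in>edges (graph_ball G rs r). m e \<in> U (?\<psi> ` e)"
        using \<phi>(3) inv by (auto simp: E)
      ultimately have "good A r (\<lambda>e. U (?\<psi> ` e))" using A(3) by (simp add: good_def)
      then show "\<exists>r U. good A r U" by blast
    qed
  qed
  with assms(3) that show thesis unfolding good_def by blast
qed

definition iso_invariant :: "(graph \<Rightarrow> (nat set \<Rightarrow> 'm) \<Rightarrow> nat list \<Rightarrow> bool) \<Rightarrow> bool" where
  "iso_invariant P \<longleftrightarrow> (\<forall>G m rs H n \<phi>. rooted_graph G rs \<longrightarrow> rooted_graph H (map \<phi> rs) \<longrightarrow>
     graph_iso \<phi> G H \<longrightarrow> (\<forall>e\<in>edges G. n (\<phi> ` e) = m e) \<longrightarrow> P G m rs \<longrightarrow> P H n (map \<phi> rs))"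

definition rooted_set :: "(graph \<Rightarrow> (nat set \<Rightarrow> 'm) \<Rightarrow> nat list \<Rightarrow> bool) \<Rightarrow> 'm rooted set" where
  "rooted_set P = {abs_rooted (G, m, rs) | G m rs. rooted_graph G rs \<and> P G m rs}"

lemma iso_invariantD:
  assumes "iso_invariant P" "rooted_graph G rs" "rooted_graph H (map \<phi> rs)" "graph_iso \<phi> G H"
    "\<And>e. e \<in> edges G \<Longrightarrow> n (\<phi> ` e) = m e" "P G m rs"
  shows "P H n (map \<phi> rs)"
  using assms unfolding iso_invariant_def by blast

lemma mem_rooted_set:
  assumes "iso_invariant P" "rooted_graph G rs"
  shows "abs_rooted (G, m, rs) \<in> rooted_set P \<longleftrightarrow> P G m rs"
proof
  assume "abs_rooted (G, m, rs) \<in> rooted_set P"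
  then obtain H n ss where H: "abs_rooted (G, m, rs) = abs_rooted (H, n, ss)"
    "rooted_graph H ss" "P H n ss" by (auto simp: rooted_set_def)
  then have "rooted_iso (H, n, ss) (G, m, rs)"
    using abs_rooted_eq_iff[OF H(2) assms(2), of n m] by simp
  then obtain \<phi> where "graph_iso \<phi> H G" "map \<phi> ss = rs" "\<forall>e\<in>edges H. m (\<phi> ` e) = n e" by auto
  then show "P G m rs" using assms H unfolding iso_invariant_def by blast
qed (use assms in \<open>auto simp: rooted_set_def\<close>)

section \<open>Continuous functionals of marked graphs\<close>

lemma map_marks_abs:
  "rooted_graph G rs \<Longrightarrow> map_marks f (abs_rooted (G, m, rs)) = abs_rooted (G, f \<circ> m, rs)"
  using map_marks.abs_eq[OF rooted_iso_refl, of G rs f m] by simp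

lemma matched_graph_abs:
  "rooted_graph G rs \<Longrightarrow> matched_graph (abs_rooted (G, m, rs)) \<longleftrightarrow> is_matching G {e \<in> edges G. m e}"
  using matched_graph.abs_eq[OF rooted_iso_refl, of G rs m] by simp

lemma root_matched_abs:
  "rooted_graph G rs \<Longrightarrow>
    root_matched (abs_rooted (G, m, rs)) \<longleftrightarrow> (\<exists>v\<in>neighbours G (hd rs). m {hd rs, v})"
  using root_matched.abs_eq[OF rooted_iso_refl, of G rs m] by simp

lemma root_matched_weight_abs:
  "rooted_graph G rs \<Longrightarrow> root_matched_weight (abs_rooted (G, m, rs)) =
    (\<Sum>v\<in>neighbours G (hd rs). if snd (m {hd rs, v}) then fst (m {hd rs, v}) else 0)"
  using root_matched_weight.abs_eq[OF rooted_iso_refl, of G rs m] by simp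

lemma mass_out_abs:
  "rooted_graph G rs \<Longrightarrow> mass_out f (abs_rooted (G, m, rs)) =
    (\<integral>\<^sup>+ v. f (abs_rooted (G, m, [hd rs, v])) \<partial>count_space (verts G))"
  using mass_out.abs_eq[OF rooted_iso_refl, of G rs f m] by simp

lemma mass_in_abs:
  "rooted_graph G rs \<Longrightarrow> mass_in f (abs_rooted (G, m, rs)) =
    (\<integral>\<^sup>+ v. f (abs_rooted (G, m, [v, hd rs])) \<partial>count_space (verts G))"
  using mass_in.abs_eq[OF rooted_iso_refl, of G rs f m] by simp

lemma continuous_on_UNIV_I: "(\<And>Q. open Q \<Longrightarrow> open (f -` Q)) \<Longrightarrow> continuous_on UNIV f"
  by (simp add: continuous_on_open_vimage)

lemma continuous_map_marks:
  assumes "continuous_on UNIV f" shows "continuous_on UNIV (map_marks f)"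
proof (intro continuous_on_UNIV_I open_rootedI)
  fix Q :: "'b rooted set" and G m rs
  assume Q: "open Q" and G: "rooted_graph G rs" and "abs_rooted (G, m, rs) \<in> map_marks f -` Q"
  then have "abs_rooted (G, f \<circ> m, rs) \<in> Q" by (simp add: map_marks_abs)
  then obtain r U where U: "\<And>e. open (U e)"
    "\<And>e. e \<in> edges (graph_ball G rs r) \<Longrightarrow> (f \<circ> m) e \<in> U e" "local_nbhd G rs r U \<subseteq> Q"
    using open_rooted_local_base[OF Q G] by metis
  show "abs_rooted (G, m, rs) \<in> interior (map_marks f -` Q)"
  proof (rule interior_rootedI[OF G])
    show "open (f -` U e)" for e using assms U(1) by (simp add: continuous_on_open_vimage)
    show "m e \<in> f -` U e" if "e \<in> edges (graph_ball G rs r)" for e using U(2)[OF that] by simp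
    fix \<phi> H n assume H: "rooted_graph H (map \<phi> rs)" and \<phi>: "ball_iso \<phi> G rs H r"
      "\<forall>e\<in>edges (graph_ball G rs r). n (\<phi> ` e) \<in> f -` U e"
    then have "abs_rooted (H, f \<circ> n, map \<phi> rs) \<in> local_nbhd G rs r U"
      unfolding mem_local_nbhd[OF H] by (intro exI[of _ \<phi>]) auto
    then show "abs_rooted (H, n, map \<phi> rs) \<in> map_marks f -` Q"
      using U(3) by (auto simp: map_marks_abs[OF H])
  qed
qed

text \<open>Exchanging two roots turns incoming into outgoing mass.\<close>

lift_definition rev_roots :: "'m rooted \<Rightarrow> 'm rooted" is "\<lambda>(G, m, rs). (G, m, rev rs)"
  by (force simp: rooted_graph_def rev_map)

lemma rev_roots_abs:
  "rooted_graph G rs \<Longrightarrow> rev_roots (abs_rooted (G, m, rs)) = abs_rooted (G, m, rev rs)"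
  using rev_roots.abs_eq[OF rooted_iso_refl, of G rs m] by simp

lemma rooted_graph_rev: "rooted_graph G (rev rs) \<longleftrightarrow> rooted_graph G rs"
  by (simp add: rooted_graph_def)

lemma graph_ball_rev: "graph_ball G (rev rs) r = graph_ball G rs r"
  by (simp add: graph_ball_def)

lemma continuous_rev_roots:
  "continuous_on UNIV (rev_roots :: 'm::topological_space rooted \<Rightarrow> 'm rooted)"
proof (intro continuous_on_UNIV_I open_rootedI)
  fix Q :: "'m rooted set" and G m rs
  assume Q: "open Q" and G: "rooted_graph G rs" and "abs_rooted (G, m, rs) \<in> rev_roots -` Q"
  then have "abs_rooted (G, m, rev rs) \<in> Q" by (simp add: rev_roots_abs)
  then obtain r U where U: "\<And>e. open (U e)"
    "\<And>e. e \<in> edges (graph_ball G (rev rs) r) \<Longrightarrow> m e \<in> U e" "local_nbhd G (rev rs) r U \<subseteq> Q"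
    using open_rooted_local_base[OF Q] G rooted_graph_rev by metis
  show "abs_rooted (G, m, rs) \<in> interior (rev_roots -` Q)"
  proof (rule interior_rootedI[OF G U(1)])
    show "m e \<in> U e" if "e \<in> edges (graph_ball G rs r)" for e using U(2) that by (simp add: graph_ball_rev)
    fix \<phi> H n assume H: "rooted_graph H (map \<phi> rs)" and \<phi>: "ball_iso \<phi> G rs H r"
      "\<forall>e\<in>edges (graph_ball G rs r). n (\<phi> ` e) \<in> U e"
    have H': "rooted_graph H (map \<phi> (rev rs))" using H by (simp add: rev_map[symmetric] rooted_graph_rev)
    have "abs_rooted (H, n, map \<phi> (rev rs)) \<in> local_nbhd G (rev rs) r U"
      unfolding mem_local_nbhd[OF H'] using \<phi>
      by (intro exI[of _ \<phi>]) (simp add: ball_iso_def rev_map[symmetric] graph_ball_rev)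
    then show "abs_rooted (H, n, map \<phi> rs) \<in> rev_roots -` Q"
      using U(3) by (auto simp: rev_roots_abs[OF H] rev_map)
  qed
qed

lift_definition edge_sum :: "('m \<Rightarrow> real) \<Rightarrow> 'm rooted \<Rightarrow> real" is
  "\<lambda>h (G, m, rs). \<Sum>v\<in>neighbours G (hd rs). h (m {hd rs, v})"
proof (clarsimp, goal_cases)
  case (1 h G m rs H n \<phi>)
  have hd: "hd (map \<phi> rs) = \<phi> (hd rs)" using 1 by (auto simp: rooted_graph_def hd_map)
  have "bij_betw \<phi> (neighbours G (hd rs)) (neighbours H (hd (map \<phi> rs)))"
    unfolding hd using 1 by (intro rooted_iso_neighbours) (auto simp: rooted_graph_simple hd_root)
  then show ?case
  proof (subst sum.reindex_bij_betw[symmetric], assumption, intro sum.cong refl)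
    fix v assume "v \<in> neighbours G (hd rs)"
    then have "{hd rs, v} \<in> edges G" by (simp add: neighbours_def)
    with 1(4) have "n (\<phi> ` {hd rs, v}) = m {hd rs, v}" by (rule bspec)
    then show "h (m {hd rs, v}) = h (n {hd (map \<phi> rs), \<phi> v})" by (simp add: hd)
  qed
qed

lemma edge_sum_abs:
  "rooted_graph G rs \<Longrightarrow>
    edge_sum h (abs_rooted (G, m, rs)) = (\<Sum>v\<in>neighbours G (hd rs). h (m {hd rs, v}))"
  using edge_sum.abs_eq[OF rooted_iso_refl, of G rs h m] by simp

lemma root_edge_in_ball:
  assumes "rooted_graph G rs" "v \<in> neighbours G (hd rs)"
  shows "{hd rs, v} \<in> edges (graph_ball G rs 1)"
  using assms ball_verts_Suc[of G rs 0] by (auto simp: edges_graph_ball rooted_graph_def neighbours_def)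

text \<open>The sum depends on the ball of radius one and has finitely many terms.\<close>

lemma continuous_edge_sum:
  fixes h :: "'m::topological_space \<Rightarrow> real"
  assumes "continuous_on UNIV h" shows "continuous_on UNIV (edge_sum h)"
proof (intro continuous_on_UNIV_I open_rootedI)
  fix Q :: "real set" and G and m :: "nat set \<Rightarrow> 'm" and rs
  assume Q: "open Q" and G: "rooted_graph G rs" and "abs_rooted (G, m, rs) \<in> edge_sum h -` Q"
  then have inQ: "(\<Sum>v\<in>neighbours G (hd rs). h (m {hd rs, v})) \<in> Q" (is "?s \<in> Q")
    by (simp add: edge_sum_abs)
  then obtain \<epsilon> where \<epsilon>: "\<epsilon> > 0" "ball ?s \<epsilon> \<subseteq> Q" using Q openE by blast
  define N where "N = neighbours G (hd rs)"
  define \<delta> where "\<delta> = \<epsilon> / (real (card N) + 1)"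
  have \<delta>: "\<delta> > 0" "real (card N) * \<delta> < \<epsilon>" using \<epsilon>(1) by (auto simp: \<delta>_def field_simps)
  define U where "U e = h -` ball (h (m e)) \<delta>" for e
  have op: "open (U e)" for e
    using assms open_ball unfolding U_def by (simp add: continuous_on_open_vimage)
  have me: "m e \<in> U e" for e using \<delta> by (simp add: U_def)
  have "abs_rooted (H, n, map \<phi> rs) \<in> edge_sum h -` Q"
    if H: "rooted_graph H (map \<phi> rs)" and \<phi>: "ball_iso \<phi> G rs H 1"
      "\<forall>e\<in>edges (graph_ball G rs 1). n (\<phi> ` e) \<in> U e" for \<phi> H n
  proof -
    have hd: "hd (map \<phi> rs) = \<phi> (hd rs)" using G by (auto simp: rooted_graph_def hd_map)
    have "bij_betw \<phi> N (neighbours H (hd (map \<phi> rs)))"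
      unfolding hd N_def using G
      by (intro ball_iso_neighbours[OF \<phi>(1), of 0]) (auto simp: rooted_graph_def)
    then have s: "(\<Sum>v\<in>neighbours H (hd (map \<phi> rs)). h (n {hd (map \<phi> rs), v})) =
        (\<Sum>v\<in>N. h (n {\<phi> (hd rs), \<phi> v}))" (is "?t = _")
      unfolding hd by (rule sum.reindex_bij_betw[symmetric])
    have "\<bar>h (n {\<phi> (hd rs), \<phi> v}) - h (m {hd rs, v})\<bar> \<le> \<delta>" if "v \<in> N" for v
    proof -
      have "n (\<phi> ` {hd rs, v}) \<in> U {hd rs, v}"
        using \<phi>(2) root_edge_in_ball[OF G] that unfolding N_def by blast
      then show ?thesis by (simp add: U_def dist_real_def)
    qed
    then have "(\<Sum>v\<in>N. \<bar>h (n {\<phi> (hd rs), \<phi> v}) - h (m {hd rs, v})\<bar>) \<le> real (card N) * \<delta>"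
      by (rule sum_bounded_above)
    then have "\<bar>?t - ?s\<bar> \<le> real (card N) * \<delta>"
      unfolding s N_def[symmetric] sum_subtractf[symmetric]
      by (rule order_trans[OF sum_abs])
    then have "?t \<in> ball ?s \<epsilon>" using \<delta>(2) by (simp add: dist_real_def)
    then show ?thesis using \<epsilon>(2) by (auto simp: edge_sum_abs[OF H])
  qed
  then show "abs_rooted (G, m, rs) \<in> interior (edge_sum h -` Q)"
    by (rule interior_rootedI[OF G op me])
qed

text \<open>Two marked edges that share a vertex are visible in a finite ball.\<close>

lemma open_not_matched: "open {x. \<not> matched_graph x}"
proof (rule open_rootedI)
  fix G m rs assume G: "rooted_graph G rs" and "abs_rooted (G, m, rs) \<in> {x. \<not> matched_graph x}"
  then have "\<not> pairwise disjnt {e \<in> edges G. m e}"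
    by (auto simp: matched_graph_abs is_matching_def)
  then obtain e e' where e: "e \<in> edges G" "e' \<in> edges G" "m e" "m e'" "e \<noteq> e'" "\<not> disjnt e e'"
    by (auto simp: pairwise_def)
  have sub: "e \<union> e' \<subseteq> verts G" using e G by (auto dest: rooted_graph_simple edge_subset_verts)
  have "finite (e \<union> e')"
    using rooted_graph_simple[OF G] e(1,2) by (auto simp: simple_graph_def intro: card_ge_0_finite)
  then obtain r where r: "e \<union> e' \<subseteq> ball_verts G rs r" using finite_in_ball_verts[OF G _ sub] by blast
  have "abs_rooted (H, n, map \<phi> rs) \<in> {x. \<not> matched_graph x}"
    if H: "rooted_graph H (map \<phi> rs)" and \<phi>: "ball_iso \<phi> G rs H r"
      "\<forall>e\<in>edges (graph_ball G rs r). n (\<phi> ` e) \<in> {m e}" for \<phi> H n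
  proof -
    have eb: "e \<in> edges (graph_ball G rs r)" "e' \<in> edges (graph_ball G rs r)"
      using r e by (auto simp: edges_graph_ball)
    have "n (\<phi> ` e)" "n (\<phi> ` e')" using \<phi>(2) eb e by auto
    moreover have "\<phi> ` e \<in> edges H" "\<phi> ` e' \<in> edges H" using ball_iso_edges[OF \<phi>(1)] eb by auto
    moreover have "\<phi> ` e \<noteq> \<phi> ` e'"
      using ball_iso_inj[OF \<phi>(1) rooted_graph_simple[OF G] rooted_graph_roots[OF G]] r e(5)
      by (simp add: inj_on_image_eq_iff)
    moreover have "\<not> disjnt (\<phi> ` e) (\<phi> ` e')" using e(6) by (auto simp: disjnt_def)
    ultimately have "\<not> pairwise disjnt {e \<in> edges H. n e}"
      using pairwiseD[of disjnt "{e \<in> edges H. n e}" "\<phi> ` e" "\<phi> ` e'"] by blast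
    then show ?thesis by (simp add: matched_graph_abs[OF H] is_matching_def)
  qed
  moreover have "open {m e}" for e by (rule Topological_Spaces.open_discrete)
  ultimately show "abs_rooted (G, m, rs) \<in> interior ({x. \<not> matched_graph x})"
    by (intro interior_rootedI[OF G, where r = r and U = "\<lambda>e. {m e}"]) auto
qed

section \<open>Graphs with finitely many vertices\<close>

text \<open>Near a finite graph the topology is that of the marks: a large ball determines the graph.\<close>

lemma open_rooted_set_finite:
  assumes inv: "iso_invariant P"
    and fin: "\<And>G m rs. rooted_graph G rs \<Longrightarrow> P G m rs \<Longrightarrow> finite (verts G)"
    and op: "\<And>G rs. rooted_graph G rs \<Longrightarrow> finite (verts G) \<Longrightarrow> open {m. P G m rs}"
  shows "open (rooted_set P)"
proof (rule open_rootedI)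
  fix G m rs assume G: "rooted_graph G rs" and "abs_rooted (G, m, rs) \<in> rooted_set P"
  then have P: "P G m rs" by (simp add: mem_rooted_set[OF inv])
  have finG: "finite (verts G)" by (rule fin[OF G P])
  have "openin (product_topology (\<lambda>i. euclidean) UNIV) {m. P G m rs}"
    using op[OF G finG] by (simp add: open_fun_def)
  from product_topology_open_contains_basis[OF this, of m] P
  obtain U where U: "m \<in> Pi UNIV U" "\<And>e. open (U e)" "Pi UNIV U \<subseteq> {m. P G m rs}"
    by (auto simp: PiE_UNIV_domain)
  obtain r where r: "verts G \<subseteq> ball_verts G rs r" using finite_in_ball_verts[OF G finG] by auto
  have E: "edges G \<subseteq> edges (graph_ball G rs (Suc r))"
    using r ball_verts_mono[of r "Suc r" G rs] edge_subset_verts[OF rooted_graph_simple[OF G]]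
    by (auto simp: edges_graph_ball)
  have "abs_rooted (H, n, map \<phi> rs) \<in> rooted_set P"
    if H: "rooted_graph H (map \<phi> rs)" and \<phi>: "ball_iso \<phi> G rs H (Suc r)"
      "\<forall>e\<in>edges (graph_ball G rs (Suc r)). n (\<phi> ` e) \<in> U e" for \<phi> H n
  proof -
    have iso: "graph_iso \<phi> G H" by (rule ball_iso_exhausting[OF \<phi>(1) G H r])
    define n' where "n' e = (if e \<in> edges G then n (\<phi> ` e) else m e)" for e
    have "n' \<in> Pi UNIV U" using U(1) \<phi>(2) E by (auto simp: n'_def Pi_iff)
    then have "P G n' rs" using U(3) by auto
    then have "P H n (map \<phi> rs)" by (intro iso_invariantD[OF inv G H iso]) (simp_all add: n'_def)
    then show ?thesis by (simp add: mem_rooted_set[OF inv H])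
  qed
  then show "abs_rooted (G, m, rs) \<in> interior (rooted_set P)"
    using U by (intro interior_rootedI[OF G, where r = "Suc r" and U = U]) auto
qed

text \<open>Conversely, the class of a marked graph depends continuously on the marks, because a ball of a
  locally finite graph has finitely many edges.\<close>

lemma open_marks_vimage:
  fixes Q :: "'m::topological_space rooted set"
  assumes "open Q" "rooted_graph G rs"
  shows "open {m. abs_rooted (G, m, rs) \<in> Q}"
proof (rule Topological_Spaces.openI)
  fix m assume "m \<in> {m. abs_rooted (G, m, rs) \<in> Q}"
  then have "abs_rooted (G, m, rs) \<in> Q" by simp
  then obtain r U where U: "\<And>e. open (U e)"
    "\<And>e. e \<in> edges (graph_ball G rs r) \<Longrightarrow> m e \<in> U e" "local_nbhd G rs r U \<subseteq> Q"
    using open_rooted_local_base[OF assms] by metis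
  define V where "V = (\<Inter>e\<in>edges (graph_ball G rs r). (\<lambda>m. m e) -` U e)"
  have "open ((\<lambda>m. m e) -` U e)" for e
    by (rule open_vimage[OF U(1) continuous_on_product_coordinates])
  then have "open V" unfolding V_def by (intro open_INT finite_ball_edges assms) auto
  moreover have "m \<in> V" using U(2) by (auto simp: V_def)
  moreover have "V \<subseteq> {m. abs_rooted (G, m, rs) \<in> Q}"
    using self_mem_local_nbhd[OF assms(2), of r _ U] U(3) by (auto simp: V_def)
  ultimately show "\<exists>T. open T \<and> m \<in> T \<and> T \<subseteq> {m. abs_rooted (G, m, rs) \<in> Q}" by blast
qed

section \<open>Measurability in the mass transport principle\<close>

lemma mass_out_add: "mass_out (\<lambda>x. f x + g x) x = mass_out f x + mass_out g x"
proof -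
  obtain G m rs where x: "x = abs_rooted (G, m, rs)" "rooted_graph G rs" by (rule rooted_cases)
  show ?thesis by (simp add: x mass_out_abs nn_integral_add)
qed

lemma mass_out_cmult: "mass_out (\<lambda>x. c * f x) x = c * mass_out f x"
proof -
  obtain G m rs where x: "x = abs_rooted (G, m, rs)" "rooted_graph G rs" by (rule rooted_cases)
  show ?thesis by (simp add: x mass_out_abs nn_integral_cmult)
qed

lemma mass_out_suminf: "mass_out (\<lambda>x. \<Sum>i. f i x) x = (\<Sum>i. mass_out (f i) x)"
proof -
  obtain G m rs where x: "x = abs_rooted (G, m, rs)" "rooted_graph G rs" by (rule rooted_cases)
  show ?thesis by (simp add: x mass_out_abs nn_integral_suminf)
qed

lemma mass_out_SUP:
  assumes "incseq f" shows "mass_out (SUP i. f i) x = (SUP i. mass_out (f i) x)"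
proof -
  obtain G m rs where x: "x = abs_rooted (G, m, rs)" "rooted_graph G rs" by (rule rooted_cases)
  show ?thesis
    unfolding x mass_out_abs[OF x(2)] SUP_apply
    by (rule nn_integral_monotone_convergence_SUP)
       (use assms in \<open>auto simp: incseq_def le_fun_def\<close>)
qed

text \<open>The mass sent out under the indicator of an open set is lower semicontinuous: finitely many
  vertices that contribute keep contributing after a small perturbation of a large ball.\<close>

lemma open_mass_out_greater:
  fixes Q :: "'m::topological_space rooted set"
  assumes "open Q" shows "open {x. a < mass_out (indicator Q) x}"
proof (rule open_rootedI)
  fix G and m :: "nat set \<Rightarrow> 'm" and rs
  assume G: "rooted_graph G rs" and "abs_rooted (G, m, rs) \<in> {x. a < mass_out (indicator Q) x}"
  define o' where "o' = hd rs"
  have oG: "o' \<in> verts G" "o' \<in> set rs"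
    using hd_root[OF G] G by (auto simp: o'_def rooted_graph_def)
  define S where "S = {v \<in> verts G. abs_rooted (G, m, [o', v]) \<in> Q}"
  have ind: "(\<integral>\<^sup>+ v. indicator Q (abs_rooted (H, n, [w, v])) \<partial>count_space (verts H)) =
      emeasure (count_space (verts H)) {v \<in> verts H. abs_rooted (H, n, [w, v]) \<in> Q}"
    for H w and n :: "nat set \<Rightarrow> 'm"
  proof -
    let ?S = "{v \<in> verts H. abs_rooted (H, n, [w, v]) \<in> Q}"
    have "(\<integral>\<^sup>+ v. indicator Q (abs_rooted (H, n, [w, v])) \<partial>count_space (verts H)) =
        (\<integral>\<^sup>+ v. indicator ?S v \<partial>count_space (verts H))"
      by (intro nn_integral_cong) (auto simp: indicator_def)
    also have "\<dots> = emeasure (count_space (verts H)) ?S" by (rule nn_integral_indicator) auto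
    finally show ?thesis .
  qed
  have "a < emeasure (count_space (verts G)) S"
    using \<open>abs_rooted (G, m, rs) \<in> _\<close> by (simp add: mass_out_abs[OF G] ind S_def o'_def)
  moreover have "S \<subseteq> verts G" by (auto simp: S_def)
  ultimately have aS: "a < (if finite S then of_nat (card S) else \<infinity>)"
    by (simp add: emeasure_count_space split: if_splits)
  have "\<exists>F. finite F \<and> F \<subseteq> S \<and> a < of_nat (card F)"
  proof (cases "finite S")
    case True
    then show ?thesis using aS by (intro exI[of _ S]) simp
  next
    case False
    then have "a < \<top>" using aS by simp
    then obtain n where "a < of_nat n" using ennreal_Ex_less_of_nat by blast
    moreover obtain F where "finite F" "F \<subseteq> S" "card F = n"
      using infinite_arbitrarily_large[OF False] by blast
    ultimately show ?thesis by blast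
  qed
  then obtain F where F: "finite F" "F \<subseteq> S" "a < of_nat (card F)" by blast
  have rG: "rooted_graph G [o', v]" if "v \<in> F" for v
    using that F(2) oG by (intro rooted_graph_change_roots[OF G]) (auto simp: S_def)
  have "\<exists>r U. (\<forall>e. open (U e)) \<and> (\<forall>e\<in>edges (graph_ball G [o', v] r). m e \<in> U e) \<and>
      local_nbhd G [o', v] r U \<subseteq> Q" if v: "v \<in> F" for v
  proof -
    have "abs_rooted (G, m, [o', v]) \<in> Q" using v F(2) by (auto simp: S_def)
    from open_rooted_local_base[OF assms rG[OF v] this] show ?thesis by metis
  qed
  then obtain r U where rU: "\<And>v e. v \<in> F \<Longrightarrow> open (U v e)"
    "\<And>v e. v \<in> F \<Longrightarrow> e \<in> edges (graph_ball G [o', v] (r v)) \<Longrightarrow> m e \<in> U v e"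
    "\<And>v. v \<in> F \<Longrightarrow> local_nbhd G [o', v] (r v) (U v) \<subseteq> Q"
    by metis
  obtain j where j: "F \<subseteq> ball_verts G rs j"
    using finite_in_ball_verts[OF G F(1)] F(2) by (auto simp: S_def)
  define R where "R = j + Max (insert 0 (r ` F))"
  have R: "j + r v \<le> R" if "v \<in> F" for v using that F(1) by (auto simp: R_def)
  define W where "W e = (\<Inter>v\<in>F. if e \<in> edges (graph_ball G [o', v] (r v)) then U v e else UNIV)" for e
  have root: "o' \<in> ball_verts G rs j" using oG ball_verts_roots by blast
  note sG = rooted_graph_simple[OF G] rooted_graph_roots[OF G]
  have sub: "edges (graph_ball G [o', v] (r v)) \<subseteq> edges (graph_ball G rs R)" if "v \<in> F" for v
    using ball_verts_trans[of "[o', v]" G rs j "r v"] root j that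
      ball_verts_mono[OF R[OF that], of G rs] by (auto simp: edges_graph_ball)
  have "abs_rooted (H, n, map \<phi> rs) \<in> {x. a < mass_out (indicator Q) x}"
    if H: "rooted_graph H (map \<phi> rs)" and \<phi>: "ball_iso \<phi> G rs H R"
      "\<forall>e\<in>edges (graph_ball G rs R). n (\<phi> ` e) \<in> W e" for \<phi> H n
  proof -
    have hd: "hd (map \<phi> rs) = \<phi> o'" using G by (auto simp: o'_def rooted_graph_def hd_map)
    have inj: "inj_on \<phi> F"
      using ball_iso_inj[OF \<phi>(1) sG] j ball_verts_mono[of j R G rs]
      by (auto simp: R_def intro: inj_on_subset)
    have FH: "\<phi> ` F \<subseteq> {v \<in> verts H. abs_rooted (H, n, [\<phi> o', v]) \<in> Q}"
    proof
      fix w assume "w \<in> \<phi> ` F"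
      then obtain v where v: "v \<in> F" "w = \<phi> v" by auto
      have "ball_verts H (map \<phi> rs) j = \<phi> ` ball_verts G rs j"
        by (rule ball_iso_ball_verts_same[OF \<phi>(1) sG]) (simp add: R_def)
      then have wH: "w \<in> verts H" "\<phi> o' \<in> verts H"
        using ball_verts_subset[of H "map \<phi> rs" j] H v j root by (auto simp: rooted_graph_def)
      then have H': "rooted_graph H (map \<phi> [o', v])"
        using v by (intro rooted_graph_change_roots[OF H]) auto
      have "ball_iso \<phi> G [o', v] H (r v)"
        using ball_iso_restrict[OF \<phi>(1) sG, of "[o', v]" j "r v"] root j v R by auto
      moreover have "n (\<phi> ` e) \<in> U v e" if "e \<in> edges (graph_ball G [o', v] (r v))" for e
        using \<phi>(2) sub[OF v(1)] that v(1) by (auto simp: W_def dest!: subsetD)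
      ultimately have "abs_rooted (H, n, map \<phi> [o', v]) \<in> local_nbhd G [o', v] (r v) (U v)"
        unfolding mem_local_nbhd[OF H'] by blast
      then show "w \<in> {v \<in> verts H. abs_rooted (H, n, [\<phi> o', v]) \<in> Q}" using rU(3)[OF v(1)] v wH by auto
    qed
    have "a < of_nat (card (\<phi> ` F))" using F(3) inj by (simp add: card_image)
    also have "\<dots> = emeasure (count_space (verts H)) (\<phi> ` F)"
      using F(1) FH by (subst emeasure_count_space) auto
    also have "\<dots> \<le> emeasure (count_space (verts H)) {v \<in> verts H. abs_rooted (H, n, [\<phi> o', v]) \<in> Q}"
      by (intro emeasure_mono FH) auto
    finally show ?thesis by (simp add: mass_out_abs[OF H] hd ind del: list.map)
  qed
  moreover have "open (W e)" for e unfolding W_def using rU(1) by (intro open_INT F(1)) auto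
  moreover have "m e \<in> W e" for e using rU(2) by (auto simp: W_def)
  ultimately show "abs_rooted (G, m, rs) \<in> interior ({x. a < mass_out (indicator Q) x})"
    by (intro interior_rootedI[OF G, where r = R and U = W]) auto
qed

text \<open>Doubly rooted graphs with roots at distance at most \<open>k\<close>; restricting to them makes the
  transported mass finite.\<close>

definition near_roots :: "nat \<Rightarrow> 'm rooted set" where
  "near_roots k = rooted_set (\<lambda>G m rs. \<exists>u v. rs = [u, v] \<and> v \<in> ball_verts G [u] k)"

lemma iso_invariant_near_roots:
  "iso_invariant (\<lambda>G m rs. \<exists>u v. rs = [u, v] \<and> v \<in> ball_verts G [u] k)"
  unfolding iso_invariant_def
proof (intro allI impI, elim exE conjE)
  fix G m rs H n \<phi> u v
  assume *: "rooted_graph G rs" "graph_iso \<phi> G H" "rs = [u, v]" "v \<in> ball_verts G [u] k"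
  have "ball_verts H (map \<phi> [u]) k = \<phi> ` ball_verts G [u] k"
    using * by (intro graph_iso_ball_verts) (auto simp: rooted_graph_def)
  then show "\<exists>u v. map \<phi> rs = [u, v] \<and> v \<in> ball_verts H [u] k" using * by auto
qed

lemma mem_near_roots:
  assumes "rooted_graph G rs" "v \<in> verts G"
  shows "abs_rooted (G, m, [hd rs, v]) \<in> near_roots k \<longleftrightarrow> v \<in> ball_verts G [hd rs] k"
proof -
  have "rooted_graph G [hd rs, v]"
    using assms hd_root by (intro rooted_graph_change_roots[OF assms(1)]) auto
  then show ?thesis by (simp add: near_roots_def mem_rooted_set[OF iso_invariant_near_roots])
qed

lemma open_near_roots: "open (near_roots k :: 'm::topological_space rooted set)"
proof (rule open_rootedI)
  fix G and m :: "nat set \<Rightarrow> 'm" and rs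
  assume G: "rooted_graph G rs" and "abs_rooted (G, m, rs) \<in> near_roots k"
  then obtain u v where uv: "rs = [u, v]" "v \<in> ball_verts G [u] k"
    by (auto simp: near_roots_def mem_rooted_set[OF iso_invariant_near_roots])
  have "abs_rooted (H, n, map \<phi> rs) \<in> near_roots k"
    if H: "rooted_graph H (map \<phi> rs)" and \<phi>: "ball_iso \<phi> G rs H k" for \<phi> H and n :: "nat set \<Rightarrow> 'm"
  proof -
    have "ball_verts H (map \<phi> [u]) k = \<phi> ` ball_verts G [u] k"
      by (rule ball_iso_ball_verts[OF \<phi>, of _ 0]) (use G uv in \<open>auto simp: rooted_graph_def\<close>)
    then show ?thesis
      using uv unfolding near_roots_def mem_rooted_set[OF iso_invariant_near_roots H] by auto
  qed
  then show "abs_rooted (G, m, rs) \<in> interior (near_roots k)"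
    by (intro interior_rootedI[OF G, where r = k and U = "\<lambda>_. UNIV"]) auto
qed

lemma mass_out_near_roots_finite: "mass_out (indicator (near_roots k)) x < \<infinity>"
proof -
  obtain G m rs where x: "x = abs_rooted (G, m, rs)" and G: "rooted_graph G rs" by (rule rooted_cases)
  let ?B = "ball_verts G [hd rs] k"
  have G': "rooted_graph G [hd rs]" using hd_root[OF G] by (intro rooted_graph_change_roots[OF G]) auto
  have sub: "?B \<subseteq> verts G" using G' by (intro ball_verts_subset) (auto simp: rooted_graph_def)
  have "mass_out (indicator (near_roots k)) x = (\<integral>\<^sup>+ v. indicator ?B v \<partial>count_space (verts G))"
    unfolding x mass_out_abs[OF G]
    by (intro nn_integral_cong) (auto simp: indicator_def mem_near_roots[OF G])
  also have "\<dots> = emeasure (count_space (verts G)) ?B"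
    using sub by (intro nn_integral_indicator) auto
  also have "\<dots> < \<infinity>" using finite_ball_verts[OF G', of k] sub by (simp add: emeasure_count_space of_nat_less_top)
  finally show ?thesis .
qed

lemma borel_measurable_mass_out_open:
  "open Q \<Longrightarrow> mass_out (indicator Q) \<in> borel_measurable borel"
  by (rule borel_measurableI_greater) (auto intro!: borel_open open_mass_out_greater)

text \<open>Borel sets are reached from the open ones by Dynkin's lemma; complements are harmless because
  the total mass sent to nearby vertices is finite.\<close>

lemma borel_measurable_mass_out_near:
  fixes A :: "'m::topological_space rooted set"
  assumes "A \<in> sets borel"
  shows "mass_out (indicator (A \<inter> near_roots k)) \<in> borel_measurable borel"
proof -
  have "Int_stable (Collect open :: 'm rooted set set)" by (auto simp: Int_stable_def)
  moreover have "Collect open \<subseteq> Pow (UNIV :: 'm rooted set)" by auto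
  moreover have "A \<in> sigma_sets UNIV (Collect open)" using assms by (simp add: sets_borel)
  ultimately show ?thesis
  proof (induction rule: sigma_sets_induct_disjoint)
    case (basic A)
    then show ?case by (intro borel_measurable_mass_out_open open_Int open_near_roots) auto
  next
    case empty
    have "mass_out (indicator ({} \<inter> near_roots k)) x = 0" for x :: "'m rooted"
    proof -
      have "indicator ({} \<inter> near_roots k) = (\<lambda>_ :: 'm rooted. 0 :: ennreal)" by (simp add: fun_eq_iff)
      then show ?thesis using mass_out_cmult[of 0 "\<lambda>_. 0" x] by (simp only: mult_zero_left)
    qed
    then have "mass_out (indicator ({} \<inter> near_roots k)) = (\<lambda>_ :: 'm rooted. 0)" by (rule ext)
    then show ?case by (simp only: borel_measurable_const)
  next
    case (compl A)
    have "mass_out (indicator ((UNIV - A) \<inter> near_roots k)) x =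
        mass_out (indicator (near_roots k)) x - mass_out (indicator (A \<inter> near_roots k)) x" for x
    proof -
      have "indicator (near_roots k) = (\<lambda>x. indicator (A \<inter> near_roots k) x +
          indicator ((UNIV - A) \<inter> near_roots k) x :: ennreal)"
        by (auto simp: indicator_def fun_eq_iff)
      then have sum: "mass_out (indicator (near_roots k)) x = mass_out (indicator (A \<inter> near_roots k)) x +
          mass_out (indicator ((UNIV - A) \<inter> near_roots k)) x"
        by (simp add: mass_out_add)
      then have "mass_out (indicator (A \<inter> near_roots k)) x \<noteq> \<infinity>"
        using mass_out_near_roots_finite[of k x] by auto
      then show ?thesis unfolding sum by (simp add: ennreal_add_diff_cancel_left)
    qed
    then have "mass_out (indicator ((UNIV - A) \<inter> near_roots k)) = (\<lambda>x.
        mass_out (indicator (near_roots k)) x - mass_out (indicator (A \<inter> near_roots k)) x)"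
      by (rule ext)
    moreover have "mass_out (indicator (near_roots k :: 'm rooted set)) \<in> borel_measurable borel"
      by (rule borel_measurable_mass_out_open[OF open_near_roots])
    ultimately show ?case using compl by (simp only: borel_measurable_minus_ennreal)
  next
    case (union A)
    have "indicator (\<Union>(range A) \<inter> near_roots k) = (\<lambda>x. \<Sum>i. indicator (A i \<inter> near_roots k) x :: ennreal)"
    proof
      fix x
      have "disjoint_family (\<lambda>i. A i \<inter> near_roots k)"
        using union(1) by (auto simp: disjoint_family_on_def)
      moreover have eq: "\<Union>(range A) \<inter> near_roots k = (\<Union>i. A i \<inter> near_roots k)" by blast
      ultimately have "(\<Sum>i. indicator (A i \<inter> near_roots k) x :: ennreal) =
          indicator (\<Union>i. A i \<inter> near_roots k) x" by (intro suminf_indicator)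
      then
      show "indicator (\<Union>(range A) \<inter> near_roots k) x = (\<Sum>i. indicator (A i \<inter> near_roots k) x :: ennreal)"
        unfolding eq by simp
    qed
    then have "mass_out (indicator (\<Union>(range A) \<inter> near_roots k)) =
        (\<lambda>x. \<Sum>i. mass_out (indicator (A i \<inter> near_roots k)) x)"
      by (simp only: mass_out_suminf[abs_def])
    then show ?case using union by simp
  qed
qed

lemma mass_out_indicator_SUP:
  "mass_out (indicator A) x = (SUP k. mass_out (indicator (A \<inter> near_roots k)) x)"
proof -
  obtain G m rs where x: "x = abs_rooted (G, m, rs)" and G: "rooted_graph G rs" by (rule rooted_cases)
  have G': "rooted_graph G [hd rs]" using hd_root[OF G] by (intro rooted_graph_change_roots[OF G]) auto
  have mono: "ball_verts G [hd rs] i \<subseteq> ball_verts G [hd rs] j" if "i \<le> j" for i j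
    by (rule ball_verts_mono[OF that])
  have "indicator A (abs_rooted (G, m, [hd rs, v])) =
      (SUP k. indicator (A \<inter> near_roots k) (abs_rooted (G, m, [hd rs, v])) :: ennreal)"
    if v: "v \<in> verts G" for v
  proof -
    obtain k where "v \<in> ball_verts G [hd rs] k" using in_ball_verts[OF G' v] by auto
    then have "abs_rooted (G, m, [hd rs, v]) \<in> near_roots k" by (simp add: mem_near_roots[OF G v])
    then show ?thesis
      by (intro antisym SUP_upper2[of k] SUP_least) (auto simp: indicator_def)
  qed
  then have "mass_out (indicator A) x = (\<integral>\<^sup>+ v. (SUP k. indicator (A \<inter> near_roots k)
      (abs_rooted (G, m, [hd rs, v]))) \<partial>count_space (verts G))"
    unfolding x mass_out_abs[OF G] by (intro nn_integral_cong) auto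
  also have "\<dots> = (SUP k. \<integral>\<^sup>+ v. indicator (A \<inter> near_roots k)
      (abs_rooted (G, m, [hd rs, v])) \<partial>count_space (verts G))"
    by (subst nn_integral_monotone_convergence_SUP_AE)
       (use subsetD[OF mono[OF le_SucI[OF order_refl]]] in \<open>auto simp: AE_count_space mem_near_roots[OF G] indicator_def\<close>)
  also have "\<dots> = (SUP k. mass_out (indicator (A \<inter> near_roots k)) x)"
    by (simp add: x mass_out_abs[OF G])
  finally show ?thesis .
qed

lemma borel_measurable_mass_out:
  fixes f :: "'m::topological_space rooted \<Rightarrow> ennreal"
  assumes "f \<in> borel_measurable borel" shows "mass_out f \<in> borel_measurable borel"
  using assms
proof (induction rule: borel_measurable_induct)
  case (cong f g)
  then have "f = g" by auto
  then show ?case using cong by simp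
next
  case (set A)
  have "mass_out (indicator A) = (\<lambda>x. SUP k. mass_out (indicator (A \<inter> near_roots k)) x)"
    using mass_out_indicator_SUP by blast
  then show ?case using borel_measurable_mass_out_near[OF set] by simp
next
  case (mult u c)
  then have "(\<lambda>x. c * mass_out u x) \<in> borel_measurable borel" by simp
  then show ?case by (simp add: mass_out_cmult[abs_def])
next
  case (add u v)
  then have "(\<lambda>x. mass_out v x + mass_out u x) \<in> borel_measurable borel" by simp
  then show ?case by (simp add: mass_out_add[abs_def])
next
  case (seq U)
  then have "(\<lambda>x. SUP i. mass_out (U i) x) \<in> borel_measurable borel" by simp
  moreover have "mass_out (SUP i. U i) = (\<lambda>x. SUP i. mass_out (U i) x)"
    by (intro ext mass_out_SUP seq)
  ultimately show ?case by metis
qed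

lemma mass_in_conv_mass_out: "mass_in f x = mass_out (\<lambda>y. f (rev_roots y)) x"
proof -
  obtain G m rs where x: "x = abs_rooted (G, m, rs)" and G: "rooted_graph G rs" by (rule rooted_cases)
  have "rev_roots (abs_rooted (G, m, [hd rs, v])) = abs_rooted (G, m, [v, hd rs])" if "v \<in> verts G" for v
    using that hd_root[OF G]
    by (subst rev_roots_abs) (auto intro: rooted_graph_change_roots[OF G])
  then show ?thesis unfolding x mass_in_abs[OF G] mass_out_abs[OF G] by (intro nn_integral_cong) auto
qed

lemma borel_measurable_mass_in:
  fixes f :: "'m::topological_space rooted \<Rightarrow> ennreal"
  assumes "f \<in> borel_measurable borel" shows "mass_in f \<in> borel_measurable borel"
proof -
  have "(\<lambda>y. f (rev_roots y)) \<in> borel_measurable borel"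
    by (rule measurable_compose[OF borel_measurable_continuous_onI[OF continuous_rev_roots] assms])
  from borel_measurable_mass_out[OF this] show ?thesis
    by (simp add: mass_in_conv_mass_out[abs_def])
qed

section \<open>Spiders\<close>

text \<open>The component of \<open>c\<close> is the tree in which \<open>c\<close> and its neighbours have degree \<open>d\<close> and all
  other vertices are leaves.  This is expressed by neighbourhoods, so that it is visibly a property
  of the ball of radius three.\<close>

definition spider :: "nat \<Rightarrow> graph \<Rightarrow> nat \<Rightarrow> bool" where
  "spider d G c \<longleftrightarrow> card (neighbours G c) = d \<and> (\<forall>b\<in>neighbours G c. card (neighbours G b) = d \<and>
     (\<forall>l\<in>neighbours G b - {c}. neighbours G l = {b}))"

lemma spider_leaf:
  "spider d G c \<Longrightarrow> b \<in> neighbours G c \<Longrightarrow> l \<in> neighbours G b \<Longrightarrow> l \<noteq> c \<Longrightarrow> neighbours G l = {b}"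
  unfolding spider_def by blast

lemma spider_card: "spider d G c \<Longrightarrow> card (neighbours G c) = d"
  and spider_card_neighbour:
    "spider d G c \<Longrightarrow> b \<in> neighbours G c \<Longrightarrow> card (neighbours G b) = d"
  unfolding spider_def by blast+

text \<open>For a spider with centre \<open>c\<close> these are all vertices of its component.\<close>

definition within_two :: "graph \<Rightarrow> nat \<Rightarrow> nat set" where
  "within_two G c = insert c (neighbours G c \<union> (\<Union>b\<in>neighbours G c. neighbours G b))"

lemma spider_transport:
  assumes bij: "\<And>v. v \<in> within_two G c \<Longrightarrow> bij_betw \<phi> (neighbours G v) (neighbours H (\<phi> v))"
    and inj: "inj_on \<phi> (within_two G c \<union> (\<Union>v\<in>within_two G c. neighbours G v))"
  shows "spider d H (\<phi> c) \<longleftrightarrow> spider d G c"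
proof -
  have N: "neighbours H (\<phi> v) = \<phi> ` neighbours G v"
    "card (neighbours H (\<phi> v)) = card (neighbours G v)" if "v \<in> within_two G c" for v
    using bij[OF that] bij_betw_same_card[OF bij[OF that]] by (auto simp: bij_betw_def)
  have c: "c \<in> within_two G c" and b: "\<And>b. b \<in> neighbours G c \<Longrightarrow> b \<in> within_two G c"
    and l: "\<And>b l. b \<in> neighbours G c \<Longrightarrow> l \<in> neighbours G b \<Longrightarrow> l \<in> within_two G c"
    by (auto simp: within_two_def)
  have leaf: "neighbours H (\<phi> l') = {\<phi> b'} \<longleftrightarrow> neighbours G l' = {b'}"
    if "b' \<in> neighbours G c" "l' \<in> neighbours G b'" for b' l'
  proof -
    have "b' \<in> neighbours G l'" using that(2) neighbours_sym by blast
    moreover have "\<phi> x = \<phi> b' \<Longrightarrow> x = b'" if "x \<in> neighbours G l'" for x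
      using inj l[OF \<open>b' \<in> neighbours G c\<close> \<open>l' \<in> neighbours G b'\<close>] b[OF \<open>b' \<in> neighbours G c\<close>] that
      by (auto dest: inj_onD)
    ultimately show ?thesis
      unfolding N(1)[OF l[OF that]] by auto
  qed
  have eq: "\<phi> l' = \<phi> c \<longleftrightarrow> l' = c" if "b' \<in> neighbours G c" "l' \<in> neighbours G b'" for b' l'
    using inj c l[OF that] by (auto dest: inj_onD)
  have "(\<forall>l\<in>neighbours H (\<phi> b') - {\<phi> c}. neighbours H l = {\<phi> b'}) \<longleftrightarrow>
      (\<forall>l\<in>neighbours G b' - {c}. neighbours G l = {b'})" if "b' \<in> neighbours G c" for b'
    using leaf[OF that] eq[OF that] unfolding N(1)[OF b[OF that]] by blast
  note leaves = this
  have "spider d H (\<phi> c) \<longleftrightarrow> card (neighbours G c) = d \<and> (\<forall>b\<in>neighbours G c.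
      card (neighbours H (\<phi> b)) = d \<and> (\<forall>l\<in>neighbours H (\<phi> b) - {\<phi> c}. neighbours H l = {\<phi> b}))"
    using N(2)[OF c] unfolding spider_def N(1)[OF c]
    by (simp only: Ball_def image_iff Bex_def) blast
  also have "\<dots> \<longleftrightarrow> spider d G c"
    unfolding spider_def by (intro conj_cong ball_cong refl leaves) (simp_all only: N(2)[OF b])
  finally show ?thesis .
qed

lemma within_two_ball_verts: "within_two G c \<subseteq> ball_verts G [c] 2"
proof -
  have "ball_verts G [c] 2 = ball_verts G [c] (Suc (Suc 0))" by (simp add: numeral_2_eq_2)
  then show ?thesis by (auto simp: within_two_def ball_verts_Suc)
qed

lemma spider_ball_iso:
  assumes "ball_iso \<phi> G rs H 3" "rooted_graph G rs" "c \<in> set rs"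
  shows "spider d H (\<phi> c) \<longleftrightarrow> spider d G c"
proof (rule spider_transport)
  note sG = rooted_graph_simple[OF assms(2)] rooted_graph_roots[OF assms(2)]
  have W: "within_two G c \<subseteq> ball_verts G rs 2"
    using within_two_ball_verts[of G c] ball_verts_trans[of "[c]" G rs 0 2, unfolded add_0] assms(3)
    by auto
  show "bij_betw \<phi> (neighbours G v) (neighbours H (\<phi> v))" if "v \<in> within_two G c" for v
    using ball_iso_neighbours[OF assms(1) sG, of 2 v] W that by auto
  have "(\<Union>v\<in>within_two G c. neighbours G v) \<subseteq> ball_verts G rs 3"
    using W neighbours_ball_verts[of _ G rs 2 3] by auto
  moreover have "within_two G c \<subseteq> ball_verts G rs 3" using W ball_verts_mono[of 2 3 G rs] by auto
  ultimately show "inj_on \<phi> (within_two G c \<union> (\<Union>v\<in>within_two G c. neighbours G v))"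
    using ball_iso_inj[OF assms(1) sG] by (auto intro: inj_on_subset)
qed

lemma spider_iso:
  assumes "graph_iso \<phi> G H" "rooted_graph G rs" "c \<in> verts G"
  shows "spider d H (\<phi> c) \<longleftrightarrow> spider d G c"
proof -
  have G: "rooted_graph G [c]" using assms by (intro rooted_graph_change_roots[OF assms(2)]) auto
  have "ball_iso \<phi> G [c] H 3"
    using G by (intro graph_iso_imp_ball_iso assms) (auto simp: rooted_graph_def)
  from spider_ball_iso[OF this G] show ?thesis by simp
qed

lemma connected_subset:
  assumes "connected_graph G" "c \<in> verts G" "c \<in> S" "\<And>v. v \<in> S \<Longrightarrow> neighbours G v \<subseteq> S"
  shows "verts G \<subseteq> S"
proof
  fix v assume "v \<in> verts G"
  then have "(c, v) \<in> (adj_rel G)\<^sup>*" using assms by (auto simp: connected_graph_def)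
  then show "v \<in> S"
    by (induction rule: rtrancl_induct) (use assms in \<open>auto simp: adj_rel_def neighbours_def\<close>)
qed

lemma spider_verts:
  assumes "spider d G c" "connected_graph G" "c \<in> verts G"
  shows "verts G \<subseteq> within_two G c"
proof (rule connected_subset[OF assms(2,3)])
  fix v assume "v \<in> within_two G c"
  then consider "v = c" | "v \<in> neighbours G c"
    | b where "b \<in> neighbours G c" "v \<in> neighbours G b" "v \<noteq> c" by (auto simp: within_two_def)
  then show "neighbours G v \<subseteq> within_two G c"
  proof cases
    case 3
    then have "neighbours G v = {b}" using spider_leaf[OF assms(1)] by blast
    then show ?thesis using 3 by (auto simp: within_two_def)
  qed (auto simp: within_two_def)
qed (simp add: within_two_def)

lemma spider_finite:
  assumes "spider d G c" "2 \<le> d" "connected_graph G" "c \<in> verts G"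
  shows "finite (verts G)"
proof -
  have "card (neighbours G c) > 0" "\<And>b. b \<in> neighbours G c \<Longrightarrow> card (neighbours G b) > 0"
    using assms(2) spider_card[OF assms(1)] spider_card_neighbour[OF assms(1)] by simp_all
  then have "finite (within_two G c)" by (auto simp: within_two_def card_gt_0_iff)
  then show ?thesis using spider_verts[OF assms(1,3,4)] finite_subset by blast
qed

lemma card_ge2_other: "2 \<le> card A \<Longrightarrow> \<exists>x\<in>A. x \<noteq> a"
proof (rule ccontr)
  assume "2 \<le> card A" "\<not> (\<exists>x\<in>A. x \<noteq> a)"
  then have "A \<subseteq> {a}" by auto
  from card_mono[OF _ this] \<open>2 \<le> card A\<close> show False by simp
qed

lemma spider_centre_unique:
  assumes "spider d G c" "spider d G c'" "2 \<le> d" "connected_graph G" "c \<in> verts G" "c' \<in> verts G"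
  shows "c' = c"
proof (rule ccontr)
  assume "c' \<noteq> c"
  have "c' \<in> within_two G c" using spider_verts[OF assms(1,4,5)] assms(6) by auto
  then consider "c' \<in> neighbours G c" | b where "b \<in> neighbours G c" "c' \<in> neighbours G b"
    using \<open>c' \<noteq> c\<close> by (auto simp: within_two_def)
  then show False
  proof cases
    case 1
    \<comment> \<open>Seen from \<open>c'\<close>, any further neighbour of \<open>c\<close> would have to be a leaf.\<close>
    obtain b where b: "b \<in> neighbours G c" "b \<noteq> c'"
      using card_ge2_other[of "neighbours G c" c'] assms(3) spider_card[OF assms(1)] by auto
    have "c \<in> neighbours G c'" using 1 neighbours_sym by blast
    then have "neighbours G b = {c}" using spider_leaf[OF assms(2)] b by blast
    moreover have "card (neighbours G b) = d" using spider_card_neighbour[OF assms(1)] b by blast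
    ultimately show False using assms(3) by simp
  next
    case 2
    then have "neighbours G c' = {b}" using spider_leaf[OF assms(1)] \<open>c' \<noteq> c\<close> by blast
    then show False using spider_card[OF assms(2)] assms(3) by simp
  qed
qed

text \<open>For discrete marks, properties of the marked ball define sets that are open and closed, so that
  their probabilities are continuous under convergence in law.\<close>

definition ball_determined ::
  "nat \<Rightarrow> (graph \<Rightarrow> (nat set \<Rightarrow> 'm) \<Rightarrow> nat list \<Rightarrow> bool) \<Rightarrow> bool" where
  "ball_determined r P \<longleftrightarrow> (\<forall>G m rs H n \<phi>. rooted_graph G rs \<longrightarrow> rooted_graph H (map \<phi> rs) \<longrightarrow>
     ball_iso \<phi> G rs H r \<longrightarrow> (\<forall>e\<in>edges (graph_ball G rs r). n (\<phi> ` e) = m e) \<longrightarrow>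
     (P H n (map \<phi> rs) \<longleftrightarrow> P G m rs))"

lemma ball_determined_iso_invariant:
  assumes "ball_determined r P" shows "iso_invariant P"
  unfolding iso_invariant_def
proof (intro allI impI)
  fix G m rs H n \<phi>
  assume *: "rooted_graph G rs" "rooted_graph H (map \<phi> rs)" "graph_iso \<phi> G H"
    "\<forall>e\<in>edges G. n (\<phi> ` e) = m e" "P G m rs"
  have "ball_iso \<phi> G rs H r"
    using * by (intro graph_iso_imp_ball_iso) (auto simp: rooted_graph_def)
  moreover have "\<forall>e\<in>edges (graph_ball G rs r). n (\<phi> ` e) = m e" using * by (simp add: edges_graph_ball)
  ultimately show "P H n (map \<phi> rs)" using assms * unfolding ball_determined_def by blast
qed

lemma ball_determined_open:
  fixes P :: "graph \<Rightarrow> (nat set \<Rightarrow> 'm::topological_space) \<Rightarrow> nat list \<Rightarrow> bool"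
  assumes P: "ball_determined r P" and disc: "\<And>S :: 'm set. open S"
  shows "open (rooted_set P)"
proof (rule open_rootedI)
  fix G m rs assume G: "rooted_graph G rs" and "abs_rooted (G, m, rs) \<in> rooted_set P"
  then have "P G m rs" by (simp add: mem_rooted_set[OF ball_determined_iso_invariant[OF P]])
  then have "abs_rooted (H, n, map \<phi> rs) \<in> rooted_set P"
    if "rooted_graph H (map \<phi> rs)" "ball_iso \<phi> G rs H r"
      "\<forall>e\<in>edges (graph_ball G rs r). n (\<phi> ` e) = m e" for \<phi> H n
    using P G that unfolding ball_determined_def rooted_set_def by blast
  then show "abs_rooted (G, m, rs) \<in> interior (rooted_set P)"
    using disc by (intro interior_rootedI[OF G, where r = r and U = "\<lambda>e. {m e}"]) auto
qed

lemma ball_determined_closed: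
  fixes P :: "graph \<Rightarrow> (nat set \<Rightarrow> 'm::topological_space) \<Rightarrow> nat list \<Rightarrow> bool"
  assumes P: "ball_determined r P" and disc: "\<And>S :: 'm set. open S"
  shows "closed (rooted_set P)"
proof -
  have nP: "ball_determined r (\<lambda>G m rs. \<not> P G m rs)"
    using P unfolding ball_determined_def by simp
  have "rooted_set (\<lambda>G m rs. \<not> P G m rs) = - rooted_set P"
  proof (rule set_eqI)
    fix x :: "'m rooted"
    obtain G m rs where "x = abs_rooted (G, m, rs)" "rooted_graph G rs" by (rule rooted_cases)
    then show "x \<in> rooted_set (\<lambda>G m rs. \<not> P G m rs) \<longleftrightarrow> x \<in> - rooted_set P"
      by (simp add: mem_rooted_set ball_determined_iso_invariant[OF P] ball_determined_iso_invariant[OF nP])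
  qed
  then show ?thesis using ball_determined_open[OF nP disc] by (simp add: closed_def)
qed

definition spider_roots :: "nat \<Rightarrow> 'm rooted set" where
  "spider_roots d = rooted_set (\<lambda>G m rs. spider d G (hd rs))"

text \<open>The event on which the laws in the two hulls are told apart.\<close>

definition unmatched_centre :: "nat \<Rightarrow> graph \<Rightarrow> (nat set \<Rightarrow> bool) \<Rightarrow> nat \<Rightarrow> bool" where
  "unmatched_centre d G m c \<longleftrightarrow> spider d G c \<and>
     (\<forall>b\<in>neighbours G c. \<not> m {c, b} \<and> (\<exists>l\<in>neighbours G b. m {b, l}))"

definition unmatched_centre_roots :: "nat \<Rightarrow> bool rooted set" where
  "unmatched_centre_roots d = rooted_set (\<lambda>G m rs. unmatched_centre d G m (hd rs))"

lemma hd_map_root: "rooted_graph G rs \<Longrightarrow> hd (map \<phi> rs) = \<phi> (hd rs)"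
  by (auto simp: rooted_graph_def hd_map)

lemma root_in_set: "rooted_graph G rs \<Longrightarrow> hd rs \<in> set rs"
  by (auto simp: rooted_graph_def)

lemma iso_invariant_spider: "iso_invariant (\<lambda>G m rs. spider d G (hd rs))"
  unfolding iso_invariant_def by (simp add: hd_map_root spider_iso hd_root)

lemma clopen_spider_roots:
  "open (spider_roots d :: unit rooted set)" "closed (spider_roots d :: unit rooted set)"
proof -
  have "ball_determined 3 (\<lambda>G (m :: nat set \<Rightarrow> unit) rs. spider d G (hd rs))"
    by (simp add: ball_determined_def hd_map_root spider_ball_iso root_in_set)
  then show "open (spider_roots d :: unit rooted set)" "closed (spider_roots d :: unit rooted set)"
    unfolding spider_roots_def by (auto intro!: ball_determined_open ball_determined_closed simp: open_unit_def)
qed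

lemma unmatched_centre_local:
  assumes G: "rooted_graph G rs" and \<phi>: "ball_iso \<phi> G rs H 3"
    and m: "\<And>e. e \<in> edges (graph_ball G rs 3) \<Longrightarrow> n (\<phi> ` e) = m e"
  shows "unmatched_centre d H n (\<phi> (hd rs)) \<longleftrightarrow> unmatched_centre d G m (hd rs)"
proof -
  let ?c = "hd rs"
  note sG = rooted_graph_simple[OF G] rooted_graph_roots[OF G]
  have N: "neighbours H (\<phi> v) = \<phi> ` neighbours G v" if "v \<in> ball_verts G rs 2" for v
    using ball_iso_neighbours[OF \<phi> sG, of 2 v] that by (auto simp: bij_betw_def)
  have mark: "n {\<phi> u, \<phi> v} = m {u, v}" if "u \<in> ball_verts G rs 2" "v \<in> neighbours G u" for u v
  proof -
    have "{u, v} \<in> edges (graph_ball G rs 3)"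
      using that neighbours_ball_verts[of u G rs 2 3] ball_verts_mono[of 2 3 G rs] edge_neighbour
      by (auto simp: edges_graph_ball)
    from m[OF this] show ?thesis by simp
  qed
  have c: "?c \<in> ball_verts G rs 0" using G by (auto simp: rooted_graph_def)
  have c2: "?c \<in> ball_verts G rs 2" using c ball_verts_mono[of 0 2 G rs] by auto
  have b2: "b \<in> ball_verts G rs 2" if "b \<in> neighbours G ?c" for b
    using neighbours_ball_verts[OF c, of 2] that by auto
  show ?thesis
    unfolding unmatched_centre_def spider_ball_iso[OF \<phi> G root_in_set[OF G]] N[OF c2]
    by (auto simp: mark[OF c2] N[OF b2] mark[OF b2])
qed

lemma clopen_unmatched_centre_roots:
  "iso_invariant (\<lambda>G m rs. unmatched_centre d G m (hd rs))"
  "open (unmatched_centre_roots d)" "closed (unmatched_centre_roots d)"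
proof -
  have *: "ball_determined 3 (\<lambda>G m rs. unmatched_centre d G m (hd rs))"
    by (simp add: ball_determined_def hd_map_root unmatched_centre_local)
  show "iso_invariant (\<lambda>G m rs. unmatched_centre d G m (hd rs))"
    "open (unmatched_centre_roots d)" "closed (unmatched_centre_roots d)"
    unfolding unmatched_centre_roots_def
    by (intro ball_determined_iso_invariant[OF *] ball_determined_open[OF *] ball_determined_closed[OF *]
      Topological_Spaces.open_discrete)+
qed

section \<open>Improving a matching on spiders\<close>

text \<open>In the spider with centre \<open>c\<close> the matched edge \<open>{b, l}\<close> may be exchanged for \<open>{c, b}\<close>, because
  the threshold \<open>q\<close> separates their weights.  The last clause says that \<open>q\<close> does not do so for any
  other neighbour \<open>b'\<close> of the centre; this makes the exchange unique and thus a well-defined operation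
  on isomorphism classes.  All inequalities are strict, so that the condition is open in the marks.\<close>

definition swappable ::
  "real \<Rightarrow> nat \<Rightarrow> graph \<Rightarrow> (nat set \<Rightarrow> real \<times> bool) \<Rightarrow> nat \<Rightarrow> nat \<Rightarrow> nat \<Rightarrow> bool" where
  "swappable q d G m c b l \<longleftrightarrow> spider d G c \<and> (\<forall>v\<in>neighbours G c. \<not> snd (m {c, v})) \<and>
     b \<in> neighbours G c \<and> l \<in> neighbours G b \<and> l \<noteq> c \<and> snd (m {b, l}) \<and>
     (\<forall>l'\<in>neighbours G b. l' \<noteq> l \<longrightarrow> \<not> snd (m {b, l'})) \<and>
     fst (m {b, l}) < q \<and> q < fst (m {c, b}) \<and>
     (\<forall>b'\<in>neighbours G c. b' \<noteq> b \<longrightarrow> fst (m {c, b'}) < q \<or>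
       (\<forall>l'\<in>neighbours G b'. \<not> snd (m {b', l'}) \<or> q < fst (m {b', l'})))"

definition swapped ::
  "nat \<Rightarrow> nat \<Rightarrow> nat \<Rightarrow> (nat set \<Rightarrow> real \<times> bool) \<Rightarrow> nat set \<Rightarrow> real \<times> bool" where
  "swapped c b l m e = (fst (m e), if e = {c, b} then True else if e = {b, l} then False else snd (m e))"

text \<open>The exchange does not single out a triple, which makes its equivariance under isomorphisms
  immediate; in a connected graph and for \<open>d \<ge> 2\<close> there is at most one triple to which it applies.\<close>

definition swap_fun ::
  "real \<Rightarrow> nat \<Rightarrow> graph \<Rightarrow> (nat set \<Rightarrow> real \<times> bool) \<Rightarrow> nat set \<Rightarrow> real \<times> bool" where
  "swap_fun q d G m e = (fst (m e),
     if \<exists>c b l. swappable q d G m c b l \<and> e = {c, b} then True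
     else if \<exists>c b l. swappable q d G m c b l \<and> e = {b, l} then False else snd (m e))"

lemma swappable_unique:
  assumes "swappable q d G m c b l" "swappable q d G m c' b' l'" "2 \<le> d" "rooted_graph G rs"
  shows "c' = c \<and> b' = b \<and> l' = l"
proof -
  have s: "simple_graph G" "connected_graph G" using assms(4) by (auto simp: rooted_graph_def)
  have "c \<in> verts G" "c' \<in> verts G"
    using assms(1,2) neighbours_subset_verts[OF s(1)] neighbours_sym unfolding swappable_def by blast+
  then have c: "c' = c"
    using spider_centre_unique[of d G c c'] s assms(1-3) by (auto simp: swappable_def)
  have b: "b' = b"
  proof (rule ccontr)
    assume "b' \<noteq> b"
    then have "fst (m {c, b'}) < q \<or> (\<forall>l'\<in>neighbours G b'. \<not> snd (m {b', l'}) \<or> q < fst (m {b', l'}))"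
      using assms(1,2) c by (auto simp: swappable_def)
    moreover have "l' \<in> neighbours G b'" "snd (m {b', l'})" "fst (m {b', l'}) < q" "q < fst (m {c, b'})"
      using assms(2) c by (auto simp: swappable_def)
    ultimately show False by force
  qed
  moreover have "l' = l" using assms(1,2) b unfolding swappable_def by blast
  ultimately show ?thesis using c by simp
qed

lemma swap_fun_swapped:
  assumes "swappable q d G m c b l" "2 \<le> d" "rooted_graph G rs"
  shows "swap_fun q d G m = swapped c b l m"
proof -
  have "swappable q d G m c' b' l' \<longleftrightarrow> c' = c \<and> b' = b \<and> l' = l" for c' b' l'
    using swappable_unique[OF assms(1) _ assms(2,3)] assms(1) by blast
  then show ?thesis by (auto simp: swap_fun_def swapped_def fun_eq_iff)
qed

lemma swap_fun_id: "\<nexists>c b l. swappable q d G m c b l \<Longrightarrow> swap_fun q d G m = m"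
  by (auto simp: swap_fun_def fun_eq_iff)

lemma fst_swap_fun: "fst (swap_fun q d G m e) = fst (m e)"
  by (simp add: swap_fun_def)

lemma swappable_verts:
  assumes "swappable q d G m c b l" "simple_graph G"
  shows "c \<in> verts G" "b \<in> verts G" "l \<in> verts G"
  using assms neighbours_subset_verts[OF assms(2)] neighbours_sym unfolding swappable_def by blast+

lemma swappable_iso:
  assumes G: "rooted_graph G rs" and \<phi>: "graph_iso \<phi> G H"
    and m: "\<And>e. e \<in> edges G \<Longrightarrow> n (\<phi> ` e) = m e"
    and v: "c \<in> verts G" "b \<in> verts G" "l \<in> verts G"
  shows "swappable q d H n (\<phi> c) (\<phi> b) (\<phi> l) \<longleftrightarrow> swappable q d G m c b l"
proof -
  note s = rooted_graph_simple[OF G]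
  have inj: "inj_on \<phi> (verts G)" using \<phi> by (auto simp: graph_iso_def bij_betw_def)
  have N: "neighbours H (\<phi> u) = \<phi> ` neighbours G u" if "u \<in> verts G" for u
    using rooted_iso_neighbours[OF s \<phi> that] by (auto simp: bij_betw_def)
  have mark: "n {\<phi> u, \<phi> w} = m {u, w}" if "w \<in> neighbours G u" for u w
    using m[of "{u, w}"] that by (simp add: neighbours_def)
  have sub: "neighbours G u \<subseteq> verts G" for u by (rule neighbours_subset_verts[OF s])
  have mem: "\<phi> w \<in> \<phi> ` neighbours G u \<longleftrightarrow> w \<in> neighbours G u" if "w \<in> verts G" for u w
    using inj_on_image_mem_iff[OF inj that sub] .
  have eq: "\<phi> u = \<phi> w \<longleftrightarrow> u = w" if "u \<in> verts G" "w \<in> verts G" for u w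
    using inj that by (auto dest: inj_onD)
  have img: "(\<forall>x\<in>\<phi> ` A. Q x) \<longleftrightarrow> (\<forall>x\<in>A. Q (\<phi> x))" for A Q by auto
  have b'v: "b' \<in> verts G" if "b' \<in> neighbours G u" for b' u using that sub by blast
  show ?thesis
    unfolding swappable_def spider_iso[OF \<phi> G v(1)] N[OF v(1)] N[OF v(2)] img mem[OF v(2)] mem[OF v(3)]
  proof (intro conj_cong refl ball_cong)
    assume b: "b \<in> neighbours G c" and l: "l \<in> neighbours G b"
    show "(\<phi> l \<noteq> \<phi> c) = (l \<noteq> c)" using eq v by simp
    show "snd (n {\<phi> b, \<phi> l}) = snd (m {b, l})" "(fst (n {\<phi> b, \<phi> l}) < q) = (fst (m {b, l}) < q)"
      using mark[OF l] by simp_all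
    show "(q < fst (n {\<phi> c, \<phi> b})) = (q < fst (m {c, b}))" using mark[OF b] by simp
    show "(\<phi> x \<noteq> \<phi> l \<longrightarrow> \<not> snd (n {\<phi> b, \<phi> x})) = (x \<noteq> l \<longrightarrow> \<not> snd (m {b, x}))"
      if "x \<in> neighbours G b" for x
      using mark[OF that] eq[OF b'v[OF that] v(3)] by simp
    show "(\<phi> x \<noteq> \<phi> b \<longrightarrow> fst (n {\<phi> c, \<phi> x}) < q \<or>
        (\<forall>l'\<in>neighbours H (\<phi> x). \<not> snd (n {\<phi> x, l'}) \<or> q < fst (n {\<phi> x, l'}))) =
      (x \<noteq> b \<longrightarrow> fst (m {c, x}) < q \<or>
        (\<forall>l'\<in>neighbours G x. \<not> snd (m {x, l'}) \<or> q < fst (m {x, l'})))"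
      if x: "x \<in> neighbours G c" for x
      unfolding N[OF b'v[OF x]] img mark[OF x] eq[OF b'v[OF x] v(2)]
      using mark by (intro imp_cong disj_cong refl ball_cong) simp_all
  next
    show "(\<not> snd (n {\<phi> c, \<phi> x})) = (\<not> snd (m {c, x}))" if "x \<in> neighbours G c" for x
      using mark[OF that] by simp
  qed
qed

lemma swap_fun_iso:
  assumes G: "rooted_graph G rs" and H: "simple_graph H" and \<phi>: "graph_iso \<phi> G H"
    and m: "\<And>e. e \<in> edges G \<Longrightarrow> n (\<phi> ` e) = m e" and e: "e \<in> edges G"
  shows "swap_fun q d H n (\<phi> ` e) = swap_fun q d G m e"
proof -
  note s = rooted_graph_simple[OF G]
  have inj: "inj_on \<phi> (verts G)" and V: "verts H = \<phi> ` verts G"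
    using \<phi> by (auto simp: graph_iso_def bij_betw_def)
  have eqs: "\<phi> ` e = {\<phi> u, \<phi> w} \<longleftrightarrow> e = {u, w}" if "u \<in> verts G" "w \<in> verts G" for u w
    using inj_on_image_eq_iff[OF inj edge_subset_verts[OF s e], of "{u, w}"] that by simp
  have sw: "swappable q d H n (\<phi> c) (\<phi> b) (\<phi> l) \<longleftrightarrow> swappable q d G m c b l"
    if "c \<in> verts G" "b \<in> verts G" "l \<in> verts G" for c b l
    using that by (intro swappable_iso[OF G \<phi>] m) auto
  have ex: "(\<exists>c b l. swappable q d H n c b l \<and> Q c b l) \<longleftrightarrow>
      (\<exists>c b l. swappable q d G m c b l \<and> Q (\<phi> c) (\<phi> b) (\<phi> l))" (is "?L \<longleftrightarrow> ?R") for Q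
  proof
    assume ?L
    then obtain c b l where 1: "swappable q d H n c b l" "Q c b l" by blast
    then obtain c' b' l' where 2: "c = \<phi> c'" "b = \<phi> b'" "l = \<phi> l'"
      "c' \<in> verts G" "b' \<in> verts G" "l' \<in> verts G"
      using swappable_verts[OF 1(1) H] unfolding V by blast
    then show ?R using 1 sw[OF 2(4-6)] by blast
  next
    assume ?R
    then obtain c b l where 1: "swappable q d G m c b l" "Q (\<phi> c) (\<phi> b) (\<phi> l)" by blast
    then show ?L using sw[OF swappable_verts[OF 1(1) s]] by blast
  qed
  have "(\<exists>c b l. swappable q d H n c b l \<and> \<phi> ` e = {c, b}) \<longleftrightarrow>
      (\<exists>c b l. swappable q d G m c b l \<and> e = {c, b})"
    unfolding ex by (metis eqs swappable_verts s)
  moreover have "(\<exists>c b l. swappable q d H n c b l \<and> \<phi> ` e = {b, l}) \<longleftrightarrow>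
      (\<exists>c b l. swappable q d G m c b l \<and> e = {b, l})"
    unfolding ex by (metis eqs swappable_verts s)
  ultimately show ?thesis unfolding swap_fun_def m[OF e] by (simp only:)
qed

lift_definition swap :: "real \<Rightarrow> nat \<Rightarrow> (real \<times> bool) rooted \<Rightarrow> (real \<times> bool) rooted" is
  "\<lambda>q d (G, m, rs). (G, swap_fun q d G m, rs)"
proof (clarsimp, goal_cases)
  case (1 q d G m rs H n \<phi>)
  then show ?case
    by (intro exI[of _ \<phi>]) (auto intro!: swap_fun_iso[of G rs H \<phi> n m] dest: rooted_graph_simple)
qed

lemma swap_abs:
  "rooted_graph G rs \<Longrightarrow> swap q d (abs_rooted (G, m, rs)) = abs_rooted (G, swap_fun q d G m, rs)"
  using swap.abs_eq[OF rooted_iso_refl, of G rs q d m] by simp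

lemma map_marks_fst_swap: "map_marks fst (swap q d x) = map_marks fst x"
proof -
  obtain G m rs where x: "x = abs_rooted (G, m, rs)" and G: "rooted_graph G rs" by (rule rooted_cases)
  have "fst \<circ> swap_fun q d G m = fst \<circ> m" by (auto simp: fst_swap_fun)
  then show ?thesis by (simp add: x swap_abs[OF G] map_marks_abs[OF G])
qed

text \<open>No edge at the centre is matched, and after the removal of \<open>{b, l}\<close> no edge at \<open>b\<close> is matched
  either, so that \<open>{c, b}\<close> may be added.\<close>

lemma matched_swap:
  assumes "2 \<le> d" "matched_graph (map_marks snd x)" shows "matched_graph (map_marks snd (swap q d x))"
proof -
  obtain G m rs where x: "x = abs_rooted (G, m, rs)" and G: "rooted_graph G rs" by (rule rooted_cases)
  note s = rooted_graph_simple[OF G]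
  show ?thesis
  proof (cases "\<exists>c b l. swappable q d G m c b l")
    case False
    then show ?thesis using assms swap_fun_id[OF False] by (simp add: x swap_abs[OF G])
  next
    case True
    then obtain c b l where sw: "swappable q d G m c b l" by blast
    have M: "pairwise disjnt {e \<in> edges G. snd (m e)}"
      using assms(2) by (simp add: x map_marks_abs[OF G] matched_graph_abs[OF G] is_matching_def)
    have old: "disjnt e {c, b}" if e: "e \<in> edges G" "snd (m e)" "e \<noteq> {b, l}" for e
    proof -
      obtain u v where uv: "e = {u, v}" "v \<in> neighbours G u" by (rule edgeE[OF s e(1)])
      have "c \<notin> e"
        using uv e(2) sw neighbours_sym[of v G u] by (auto simp: swappable_def insert_commute)
      moreover have "b \<notin> e"
      proof
        assume "b \<in> e"
        then obtain w where w: "e = {b, w}" "w \<in> neighbours G b"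
          using uv neighbours_sym[of v G u] by (auto simp: insert_commute)
        then have "w \<noteq> l" "snd (m {b, w})" using e(2,3) by auto
        then show False using sw w(2) unfolding swappable_def by blast
      qed
      ultimately show ?thesis by (auto simp: disjnt_def)
    qed
    have "pairwise disjnt {e \<in> edges G. snd (swapped c b l m e)}"
      unfolding pairwise_def
    proof (intro ballI impI)
      fix e e' assume e: "e \<in> {e \<in> edges G. snd (swapped c b l m e)}"
        "e' \<in> {e \<in> edges G. snd (swapped c b l m e)}" "e \<noteq> e'"
      then have *: "e = {c, b} \<or> e \<noteq> {b, l} \<and> snd (m e)" "e' = {c, b} \<or> e' \<noteq> {b, l} \<and> snd (m e')"
        by (auto simp: swapped_def split: if_splits)
      show "disjnt e e'"
      proof (cases "e = {c, b} \<or> e' = {c, b}")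
        case True
        then show ?thesis using * e old disjnt_sym by blast
      next
        case False
        then show ?thesis using * e M by (auto simp: pairwise_def)
      qed
    qed
    then show ?thesis
      by (simp add: x swap_abs[OF G] map_marks_abs[OF G] matched_graph_abs[OF G] is_matching_def
        swap_fun_swapped[OF sw assms(1) G])
  qed
qed

lemma open_Collect_ball:
  "finite A \<Longrightarrow> (\<And>x. x \<in> A \<Longrightarrow> open {m. P m x}) \<Longrightarrow> open {m. \<forall>x\<in>A. P m x}"
  using open_INT[of A "\<lambda>x. {m. P m x}"] by (simp add: Collect_ball_eq)

lemma open_mark_conditions:
  fixes e :: "nat set"
  shows "open {m :: nat set \<Rightarrow> real \<times> bool. snd (m e)}" "open {m :: nat set \<Rightarrow> real \<times> bool. \<not> snd (m e)}"
    "open {m :: nat set \<Rightarrow> real \<times> bool. fst (m e) < q}" "open {m :: nat set \<Rightarrow> real \<times> bool. q < fst (m e)}"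
proof -
  have c: "continuous_on UNIV (\<lambda>m :: nat set \<Rightarrow> real \<times> bool. fst (m e))"
    "continuous_on UNIV (\<lambda>m :: nat set \<Rightarrow> real \<times> bool. snd (m e))"
    by (intro continuous_on_fst continuous_on_snd continuous_on_product_coordinates)+
  show "open {m :: nat set \<Rightarrow> real \<times> bool. fst (m e) < q}" "open {m :: nat set \<Rightarrow> real \<times> bool. q < fst (m e)}"
    by (intro open_Collect_less c continuous_on_const)+
  show "open {m :: nat set \<Rightarrow> real \<times> bool. snd (m e)}" "open {m :: nat set \<Rightarrow> real \<times> bool. \<not> snd (m e)}"
    using open_vimage[OF Topological_Spaces.open_discrete c(2), of "{True}"]
      open_vimage[OF Topological_Spaces.open_discrete c(2), of "{False}"]
    by (simp_all add: vimage_def)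
qed

lemma open_swappable:
  assumes "rooted_graph G rs" shows "open {m. swappable q d G m c b l}"
proof (cases "c \<in> verts G")
  case True
  have fin: "finite (neighbours G v)" if "v \<in> verts G" for v
    using assms that by (auto simp: rooted_graph_def locally_finite_graph_def)
  have v: "v \<in> verts G" if "v \<in> neighbours G u" for u v
    using neighbours_subset_verts[OF rooted_graph_simple[OF assms]] that by blast
  show ?thesis
  proof (cases "spider d G c \<and> b \<in> neighbours G c \<and> l \<in> neighbours G b \<and> l \<noteq> c")
    case b: True
    have "open {m. (\<forall>v\<in>neighbours G c. \<not> snd (m {c, v})) \<and> snd (m {b, l}) \<and>
     (\<forall>l'\<in>neighbours G b. l' = l \<or> \<not> snd (m {b, l'})) \<and>
     fst (m {b, l}) < q \<and> q < fst (m {c, b}) \<and>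
     (\<forall>b'\<in>neighbours G c. b' = b \<or> (fst (m {c, b'}) < q \<or>
       (\<forall>l'\<in>neighbours G b'. \<not> snd (m {b', l'}) \<or> q < fst (m {b', l'}))))}"
      using b v True by (intro open_Collect_conj open_Collect_disj open_Collect_ball open_Collect_const
        open_mark_conditions fin) auto
    then show ?thesis
      by (rule back_subst[where P = "open"]) (use b in \<open>auto simp: swappable_def\<close>)
  next
    case False
    then have "{m. swappable q d G m c b l} = {}" by (auto simp: swappable_def)
    then show ?thesis by simp
  qed
next
  case False
  then have "{m. swappable q d G m c b l} = {}"
    using swappable_verts[OF _ rooted_graph_simple[OF assms]] by blast
  then show ?thesis by simp
qed

lemma continuous_swapped: "continuous_on S (swapped c b l)"
proof -
  have c: "continuous_on S (\<lambda>m :: nat set \<Rightarrow> real \<times> bool. m e)" for e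
    by (rule continuous_on_subset[OF continuous_on_product_coordinates]) simp
  have "continuous_on S (\<lambda>m. swapped c b l m e)" for e
    unfolding swapped_def
    by (cases "e = {c, b}"; cases "e = {b, l}")
       (auto intro!: continuous_on_Pair continuous_on_fst continuous_on_snd c continuous_on_const)
  then show ?thesis by (rule continuous_on_coordinatewise_then_product)
qed

section \<open>The exchange as a measurable map\<close>

text \<open>The relation \<open>R\<close> records where the centre and the leaf lie relative to the roots.\<close>

definition swap_set ::
  "real \<Rightarrow> nat \<Rightarrow> (nat \<Rightarrow> nat \<Rightarrow> nat list \<Rightarrow> bool) \<Rightarrow> (real \<times> bool) rooted set" where
  "swap_set q d R = rooted_set (\<lambda>G m rs. \<exists>c b l. swappable q d G m c b l \<and> R c l rs)"

definition equivariant :: "(nat \<Rightarrow> nat \<Rightarrow> nat list \<Rightarrow> bool) \<Rightarrow> bool" where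
  "equivariant R \<longleftrightarrow> (\<forall>\<phi> c l rs. rs \<noteq> [] \<longrightarrow> R c l rs \<longrightarrow> R (\<phi> c) (\<phi> l) (map \<phi> rs))"

lemma equivariant_relations:
  "equivariant (\<lambda>c l rs. True)" "equivariant (\<lambda>c l rs. hd rs = c)"
  "equivariant (\<lambda>c l rs. hd rs = l)" "equivariant (\<lambda>c l rs. rs = [c, l])"
  by (auto simp: equivariant_def hd_map)

lemma iso_invariant_swap_set:
  assumes "equivariant R"
  shows "iso_invariant (\<lambda>G m rs. \<exists>c b l. swappable q d G m c b l \<and> R c l rs)"
  unfolding iso_invariant_def
proof (intro allI impI, elim exE conjE)
  fix G m rs H n \<phi> c b l
  assume *: "rooted_graph G rs" "graph_iso \<phi> G H" "\<forall>e\<in>edges G. n (\<phi> ` e) = m e"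
    "swappable q d G m c b l" "R c l rs"
  have "swappable q d H n (\<phi> c) (\<phi> b) (\<phi> l)"
    using * swappable_verts[OF *(4) rooted_graph_simple[OF *(1)]]
    by (subst swappable_iso[OF *(1,2), of n m]) auto
  moreover have "R (\<phi> c) (\<phi> l) (map \<phi> rs)" using * assms by (auto simp: rooted_graph_def equivariant_def)
  ultimately show "\<exists>c b l. swappable q d H n c b l \<and> R c l (map \<phi> rs)" by blast
qed

lemma mem_swap_set:
  assumes "equivariant R" "rooted_graph G rs"
  shows "abs_rooted (G, m, rs) \<in> swap_set q d R \<longleftrightarrow> (\<exists>c b l. swappable q d G m c b l \<and> R c l rs)"
  unfolding swap_set_def using mem_rooted_set[OF iso_invariant_swap_set[OF assms(1)] assms(2)] .

lemma swappable_finite: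
  assumes "swappable q d G m c b l" "2 \<le> d" "rooted_graph G rs" shows "finite (verts G)"
  using assms swappable_verts[OF assms(1) rooted_graph_simple[OF assms(3)]] spider_finite[of d G c]
  by (auto simp: swappable_def rooted_graph_def)

lemma open_swap_set:
  assumes "2 \<le> d" "equivariant R"
  shows "open (swap_set q d R)"
  unfolding swap_set_def
proof (rule open_rooted_set_finite[OF iso_invariant_swap_set[OF assms(2)]])
  show "finite (verts G)"
    if "rooted_graph G rs" "\<exists>c b l. swappable q d G m c b l \<and> R c l rs" for G m rs
    using that swappable_finite[OF _ assms(1)] by blast
  show "open {m. \<exists>c b l. swappable q d G m c b l \<and> R c l rs}" if "rooted_graph G rs" for G rs
    by (intro open_Collect_ex open_Collect_conj open_swappable[OF that] open_Collect_const)
qed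

definition swap_dom :: "real \<Rightarrow> nat \<Rightarrow> (real \<times> bool) rooted set" where
  "swap_dom q d = swap_set q d (\<lambda>c l rs. True)"
definition swap_centre :: "real \<Rightarrow> nat \<Rightarrow> (real \<times> bool) rooted set" where
  "swap_centre q d = swap_set q d (\<lambda>c l rs. hd rs = c)"
definition swap_leaf :: "real \<Rightarrow> nat \<Rightarrow> (real \<times> bool) rooted set" where
  "swap_leaf q d = swap_set q d (\<lambda>c l rs. hd rs = l)"
definition swap_transport :: "real \<Rightarrow> nat \<Rightarrow> (real \<times> bool) rooted set" where
  "swap_transport q d = swap_set q d (\<lambda>c l rs. rs = [c, l])"

lemma mem_swap_sets:
  assumes "rooted_graph G rs"
  shows "abs_rooted (G, m, rs) \<in> swap_dom q d \<longleftrightarrow> (\<exists>c b l. swappable q d G m c b l)"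
    "abs_rooted (G, m, rs) \<in> swap_centre q d \<longleftrightarrow> (\<exists>b l. swappable q d G m (hd rs) b l)"
    "abs_rooted (G, m, rs) \<in> swap_leaf q d \<longleftrightarrow> (\<exists>c b. swappable q d G m c b (hd rs))"
    "abs_rooted (G, m, rs) \<in> swap_transport q d \<longleftrightarrow> (\<exists>c b l. swappable q d G m c b l \<and> rs = [c, l])"
  unfolding swap_dom_def swap_centre_def swap_leaf_def swap_transport_def
  by (simp_all add: mem_swap_set[OF _ assms] equivariant_relations)

lemma open_swap_sets:
  assumes "2 \<le> d"
  shows "open (swap_dom q d)" "open (swap_centre q d)" "open (swap_leaf q d)"
    "open (swap_transport q d)"
  unfolding swap_dom_def swap_centre_def swap_leaf_def swap_transport_def
  by (intro open_swap_set assms equivariant_relations)+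

text \<open>The map is the identity outside an open set.  On this set the graphs are finite, so that
  continuity can be checked on the marks, where the exchange is locally given by one formula.\<close>

lemma measurable_swap:
  assumes d: "2 \<le> d" shows "swap q d \<in> borel \<rightarrow>\<^sub>M borel"
proof (rule borel_measurableI)
  fix Q :: "(real \<times> bool) rooted set" assume Q: "open Q"
  let ?P = "\<lambda>G m rs. (\<exists>c b l. swappable q d G m c b l) \<and> abs_rooted (G, swap_fun q d G m, rs) \<in> Q"
  have inv: "iso_invariant ?P"
    unfolding iso_invariant_def
  proof (intro allI impI)
    fix G m rs H n \<phi>
    assume *: "rooted_graph G rs" "rooted_graph H (map \<phi> rs)" "graph_iso \<phi> G H"
      "\<forall>e\<in>edges G. n (\<phi> ` e) = m e" "?P G m rs"
    have "abs_rooted (G, swap_fun q d G m, rs) = abs_rooted (H, swap_fun q d H n, map \<phi> rs)"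
      using * by (intro abs_rooted_eqI ballI swap_fun_iso[OF *(1)]) (auto simp: rooted_graph_def)
    moreover have "\<exists>c b l. swappable q d H n c b l"
      using iso_invariantD[OF iso_invariant_swap_set[OF equivariant_relations(1), of q d] *(1-3), of n m] * by auto
    ultimately show "?P H n (map \<phi> rs)" using * by simp
  qed
  have eq: "swap q d -` Q = rooted_set ?P \<union> (Q - swap_dom q d)"
  proof (rule set_eqI)
    fix x :: "(real \<times> bool) rooted"
    obtain G m rs where x: "x = abs_rooted (G, m, rs)" and G: "rooted_graph G rs" by (rule rooted_cases)
    show "x \<in> swap q d -` Q \<longleftrightarrow> x \<in> rooted_set ?P \<union> (Q - swap_dom q d)"
      using swap_fun_id[of q d G m]
      by (cases "\<exists>c b l. swappable q d G m c b l")
         (simp_all add: x mem_rooted_set[OF inv G] mem_swap_sets[OF G] swap_abs[OF G])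
  qed
  have "open (rooted_set ?P)"
  proof (rule open_rooted_set_finite[OF inv])
    show "finite (verts G)" if "rooted_graph G rs" "?P G m rs" for G m rs
      using that swappable_finite[OF _ d] by blast
    fix G rs assume G: "rooted_graph G rs"
    have "{m. ?P G m rs} = (\<Union>c. \<Union>b. \<Union>l. {m. swappable q d G m c b l} \<inter>
        swapped c b l -` {m. abs_rooted (G, m, rs) \<in> Q})"
      using swap_fun_swapped[OF _ d G] by force
    moreover have "open ({m. swappable q d G m c b l} \<inter> swapped c b l -` {m. abs_rooted (G, m, rs) \<in> Q})"
      for c b l
      by (intro open_Int open_swappable[OF G] open_vimage open_marks_vimage Q G continuous_swapped)
    ultimately show "open {m. ?P G m rs}" by (simp add: open_UN)
  qed
  then show "swap q d -` Q \<inter> space borel \<in> sets borel"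
    using Q open_swap_sets[OF d] by (simp add: eq)
qed

text \<open>The exchange ignores the roots, so it commutes with adding a second root.\<close>

lemma mass_out_swap: "mass_out f (swap q d x) = mass_out (\<lambda>y. f (swap q d y)) x"
  and mass_in_swap: "mass_in f (swap q d x) = mass_in (\<lambda>y. f (swap q d y)) x"
proof -
  obtain G m rs where x: "x = abs_rooted (G, m, rs)" and G: "rooted_graph G rs" by (rule rooted_cases)
  have "rooted_graph G [hd rs, v]" "rooted_graph G [v, hd rs]" if "v \<in> verts G" for v
    using that hd_root[OF G] by (auto intro: rooted_graph_change_roots[OF G])
  then show "mass_out f (swap q d x) = mass_out (\<lambda>y. f (swap q d y)) x"
    "mass_in f (swap q d x) = mass_in (\<lambda>y. f (swap q d y)) x"
    unfolding x swap_abs[OF G] mass_out_abs[OF G] mass_in_abs[OF G]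
    by (auto intro!: nn_integral_cong simp: swap_abs)
qed

text \<open>Each centre with a swappable triple sends unit mass to the leaf whose place in the
  matching it takes.\<close>

lemma mass_swap_transport:
  assumes d: "2 \<le> d"
  shows "mass_out (indicator (swap_transport q d)) x = indicator (swap_centre q d) x"
    and "mass_in (indicator (swap_transport q d)) x = indicator (swap_leaf q d) x"
proof -
  obtain G m rs where x: "x = abs_rooted (G, m, rs)" and G: "rooted_graph G rs" by (rule rooted_cases)
  have r: "rooted_graph G [hd rs, v]" "rooted_graph G [v, hd rs]" if "v \<in> verts G" for v
    using that hd_root[OF G] by (auto intro: rooted_graph_change_roots[OF G])
  have one: "(\<integral>\<^sup>+ v. indicator A v \<partial>count_space (verts G)) = (1 :: ennreal)"
    if "A = {a}" "a \<in> verts G" for A a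
    using that by (subst nn_integral_indicator) auto
  have uniq: "swappable q d G m c' b' l' \<longleftrightarrow> c' = c \<and> b' = b \<and> l' = l"
    if "swappable q d G m c b l" for c b l c' b' l'
    using that swappable_unique[OF that _ d G] by blast
  note vs = swappable_verts[OF _ rooted_graph_simple[OF G], of q d m]
  show "mass_out (indicator (swap_transport q d)) x = indicator (swap_centre q d) x"
  proof (cases "\<exists>b l. swappable q d G m (hd rs) b l")
    case True
    then obtain b l where sw: "swappable q d G m (hd rs) b l" by blast
    have "mass_out (indicator (swap_transport q d)) x = (\<integral>\<^sup>+ v. indicator {l} v \<partial>count_space (verts G))"
      unfolding x mass_out_abs[OF G]
      by (intro nn_integral_cong) (auto simp: indicator_def mem_swap_sets[OF r(1)] uniq[OF sw])
    then show ?thesis using one[of "{l}" l] vs[OF sw] True by (simp add: x mem_swap_sets[OF G])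
  next
    case False
    then have "mass_out (indicator (swap_transport q d)) x = (\<integral>\<^sup>+ v. 0 \<partial>count_space (verts G))"
      unfolding x mass_out_abs[OF G]
      by (intro nn_integral_cong) (auto simp: indicator_def mem_swap_sets[OF r(1)])
    then show ?thesis using False by (simp add: x mem_swap_sets[OF G])
  qed
  show "mass_in (indicator (swap_transport q d)) x = indicator (swap_leaf q d) x"
  proof (cases "\<exists>c b. swappable q d G m c b (hd rs)")
    case True
    then obtain c b where sw: "swappable q d G m c b (hd rs)" by blast
    have "mass_in (indicator (swap_transport q d)) x = (\<integral>\<^sup>+ v. indicator {c} v \<partial>count_space (verts G))"
      unfolding x mass_in_abs[OF G]
      by (intro nn_integral_cong) (auto simp: indicator_def mem_swap_sets[OF r(2)] uniq[OF sw])
    then show ?thesis using one[of "{c}" c] vs[OF sw] True by (simp add: x mem_swap_sets[OF G])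
  next
    case False
    then have "mass_in (indicator (swap_transport q d)) x = (\<integral>\<^sup>+ v. 0 \<partial>count_space (verts G))"
      unfolding x mass_in_abs[OF G]
      by (intro nn_integral_cong) (auto simp: indicator_def mem_swap_sets[OF r(2)])
    then show ?thesis using False by (simp add: x mem_swap_sets[OF G])
  qed
qed

definition matched_excess :: "real \<Rightarrow> real \<times> bool \<Rightarrow> real" where
  "matched_excess q z = (if snd z then fst z - q else 0)"

text \<open>With weights reduced by the threshold, the removed edge has negative and the added edge has
  positive weight, so a swap improves the root weight whichever vertex is the root.\<close>

lemma edge_sum_swap:
  assumes d: "2 \<le> d"
  shows "edge_sum (matched_excess q) x \<le> edge_sum (matched_excess q) (swap q d x)"
    and "x \<in> swap_centre q d \<Longrightarrow> edge_sum (matched_excess q) x < edge_sum (matched_excess q) (swap q d x)"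
proof -
  obtain G m rs where x: "x = abs_rooted (G, m, rs)" and G: "rooted_graph G rs" by (rule rooted_cases)
  have fin: "finite (neighbours G (hd rs))"
    using G hd_root[OF G] by (auto simp: rooted_graph_def locally_finite_graph_def)
  have le: "matched_excess q (m e) \<le> matched_excess q (swapped c b l m e)"
    and less: "e = {c, b} \<Longrightarrow> matched_excess q (m e) < matched_excess q (swapped c b l m e)"
    if sw: "swappable q d G m c b l" for c b l e
  proof -
    have "\<not> snd (m {c, b})" "q < fst (m {c, b})" "snd (m {b, l})" "fst (m {b, l}) < q"
      using sw by (auto simp: swappable_def)
    then show "matched_excess q (m e) \<le> matched_excess q (swapped c b l m e)"
      "e = {c, b} \<Longrightarrow> matched_excess q (m e) < matched_excess q (swapped c b l m e)"
      by (auto simp: matched_excess_def swapped_def)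
  qed
  show "edge_sum (matched_excess q) x \<le> edge_sum (matched_excess q) (swap q d x)"
  proof (cases "\<exists>c b l. swappable q d G m c b l")
    case True
    then obtain c b l where sw: "swappable q d G m c b l" by blast
    then show ?thesis
      unfolding x swap_abs[OF G] edge_sum_abs[OF G] swap_fun_swapped[OF sw d G]
      by (intro sum_mono le)
  next
    case False
    then show ?thesis by (simp add: x swap_abs[OF G] swap_fun_id)
  qed
  show "edge_sum (matched_excess q) x < edge_sum (matched_excess q) (swap q d x)"
    if "x \<in> swap_centre q d"
  proof -
    from that obtain b l where sw: "swappable q d G m (hd rs) b l" by (auto simp: x mem_swap_sets[OF G])
    have "b \<in> neighbours G (hd rs)" using sw by (simp add: swappable_def)
    then show ?thesis
      unfolding x swap_abs[OF G] edge_sum_abs[OF G] swap_fun_swapped[OF sw d G]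
      using le[OF sw] less[OF sw] fin by (intro sum_strict_mono_ex1) auto
  qed
qed

text \<open>Together with the balance of mass between centres and leaves, these facts show that an exchange
  does not decrease the matching size.\<close>

lemma root_matched_swap:
  assumes d: "2 \<le> d"
  shows "root_matched (map_marks snd x) \<Longrightarrow> x \<notin> swap_leaf q d \<Longrightarrow> root_matched (map_marks snd (swap q d x))"
    and "x \<in> swap_centre q d \<Longrightarrow> root_matched (map_marks snd (swap q d x))"
    and "x \<in> swap_centre q d \<Longrightarrow> \<not> root_matched (map_marks snd x)"
proof -
  obtain G m rs where x: "x = abs_rooted (G, m, rs)" and G: "rooted_graph G rs" by (rule rooted_cases)
  note eqs = x swap_abs[OF G] map_marks_abs[OF G] root_matched_abs[OF G]
  show "\<not> root_matched (map_marks snd x)" if "x \<in> swap_centre q d"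
    using that by (auto simp: eqs mem_swap_sets[OF G] swappable_def)
  show "root_matched (map_marks snd (swap q d x))" if "x \<in> swap_centre q d"
  proof -
    from that obtain b l where sw: "swappable q d G m (hd rs) b l" by (auto simp: x mem_swap_sets[OF G])
    have "b \<in> neighbours G (hd rs)" using sw by (simp add: swappable_def)
    then show ?thesis
      by (auto simp: eqs swap_fun_swapped[OF sw d G] swapped_def intro!: bexI[of _ b])
  qed
  show "root_matched (map_marks snd (swap q d x))"
    if m: "root_matched (map_marks snd x)" and nl: "x \<notin> swap_leaf q d"
  proof (cases "\<exists>c b l. swappable q d G m c b l")
    case True
    then obtain c b l where sw: "swappable q d G m c b l" by blast
    obtain v where v: "v \<in> neighbours G (hd rs)" "snd (m {hd rs, v})" using m by (auto simp: eqs)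
    have "hd rs \<noteq> l" using nl sw by (auto simp: x mem_swap_sets[OF G])
    show ?thesis
    proof (cases "{hd rs, v} = {b, l}")
      case True
      then have b: "hd rs = b" using \<open>hd rs \<noteq> l\<close> by (auto simp: doubleton_eq_iff)
      have "c \<in> neighbours G b" using sw neighbours_sym[of c G b] by (auto simp: swappable_def)
      then show ?thesis
        by (auto simp: eqs swap_fun_swapped[OF sw d G] swapped_def b insert_commute intro!: bexI[of _ c])
    next
      case False
      then show ?thesis
        using v by (auto simp: eqs swap_fun_swapped[OF sw d G] swapped_def intro!: bexI[of _ v])
    qed
  next
    case False
    then show ?thesis using m by (simp add: eqs swap_fun_id)
  qed
qed

section \<open>Optimal matchings admit no improvement\<close>

lemma continuous_matched_excess: "continuous_on UNIV (matched_excess q)"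
proof -
  have "continuous_on UNIV (\<lambda>z :: real \<times> bool. of_bool (snd z) :: real)"
    by (rule continuous_on_compose2[OF Topological_Spaces.continuous_on_discrete[of UNIV of_bool]])
       (auto intro!: continuous_intros)
  then have "continuous_on UNIV (\<lambda>z :: real \<times> bool. of_bool (snd z) * (fst z - q))"
    by (intro continuous_intros)
  then show ?thesis
    by (rule continuous_on_cong[THEN iffD1, rotated -1]) (auto simp: matched_excess_def)
qed

lemma root_matched_weight_edge_sum: "root_matched_weight = edge_sum (matched_excess 0)"
proof
  fix x :: "(real \<times> bool) rooted"
  obtain G m rs where x: "x = abs_rooted (G, m, rs)" and G: "rooted_graph G rs" by (rule rooted_cases)
  show "root_matched_weight x = edge_sum (matched_excess 0) x"
    unfolding x root_matched_weight_abs[OF G] edge_sum_abs[OF G]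
    by (intro sum.cong) (auto simp: matched_excess_def)
qed

lemma borel_measurable_matched_excess: "edge_sum (matched_excess q) \<in> borel_measurable borel"
  by (intro borel_measurable_continuous_onI continuous_edge_sum continuous_matched_excess)

lemma edge_sum_root_matched:
  assumes "matched_graph (map_marks snd x)"
  shows "edge_sum (matched_excess q) x =
    root_matched_weight x - q * indicator {x. root_matched (map_marks snd x)} x"
proof -
  obtain G m rs where x: "x = abs_rooted (G, m, rs)" and G: "rooted_graph G rs" by (rule rooted_cases)
  let ?o = "hd rs"
  have fin: "finite (neighbours G ?o)"
    using G hd_root[OF G] by (auto simp: rooted_graph_def locally_finite_graph_def)
  have M: "pairwise disjnt {e \<in> edges G. snd (m e)}"
    using assms by (simp add: x map_marks_abs[OF G] matched_graph_abs[OF G] is_matching_def)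
  show ?thesis
  proof (cases "\<exists>v\<in>neighbours G ?o. snd (m {?o, v})")
    case True
    then obtain v where v: "v \<in> neighbours G ?o" "snd (m {?o, v})" by blast
    have other: "\<not> snd (m {?o, u})" if u: "u \<in> neighbours G ?o - {v}" for u
    proof
      assume "snd (m {?o, u})"
      then have "disjnt {?o, u} {?o, v}"
        using u v by (intro pairwiseD(1)[OF M]) (auto simp: neighbours_def doubleton_eq_iff)
      then show False by (simp add: disjnt_def)
    qed
    have s: "edge_sum (matched_excess p) x = fst (m {?o, v}) - p" for p
    proof -
      have "(\<Sum>u\<in>neighbours G ?o - {v}. matched_excess p (m {?o, u})) = 0"
        using other by (intro sum.neutral ballI) (simp add: matched_excess_def)
      then show ?thesis
        unfolding x edge_sum_abs[OF G] sum.remove[OF fin v(1)]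
        using v(2) by (simp add: matched_excess_def)
    qed
    have "root_matched (map_marks snd x)" using True by (simp add: x map_marks_abs[OF G] root_matched_abs[OF G])
    then show ?thesis by (simp add: root_matched_weight_edge_sum s)
  next
    case False
    then have s: "edge_sum (matched_excess p) x = 0" for p
      unfolding x edge_sum_abs[OF G] by (intro sum.neutral ballI) (simp add: matched_excess_def)
    have "\<not> root_matched (map_marks snd x)" using False by (simp add: x map_marks_abs[OF G] root_matched_abs[OF G])
    then show ?thesis by (simp add: root_matched_weight_edge_sum s)
  qed
qed

lemma sets_root_matched: "{x :: (real \<times> bool) rooted. root_matched (map_marks snd x)} \<in> sets borel"
proof -
  have "continuous_on UNIV (\<lambda>z :: real \<times> bool. of_bool (snd z) :: real)"
    by (rule continuous_on_compose2[OF Topological_Spaces.continuous_on_discrete[of UNIV of_bool]])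
       (auto intro!: continuous_intros)
  then have "edge_sum (\<lambda>z :: real \<times> bool. of_bool (snd z)) \<in> borel_measurable borel"
    by (intro borel_measurable_continuous_onI continuous_edge_sum)
  then have "{x \<in> space borel. 0 < edge_sum (\<lambda>z :: real \<times> bool. of_bool (snd z)) x} \<in> sets borel"
    by (rule borel_measurable_less[OF borel_measurable_const, simplified])
  moreover have "root_matched (map_marks snd x) \<longleftrightarrow> 0 < edge_sum (\<lambda>z. of_bool (snd z)) x"
    for x :: "(real \<times> bool) rooted"
  proof -
    obtain G m rs where x: "x = abs_rooted (G, m, rs)" and G: "rooted_graph G rs" by (rule rooted_cases)
    have fin: "finite (neighbours G (hd rs))"
      using G hd_root[OF G] by (auto simp: rooted_graph_def locally_finite_graph_def)
    have "0 < (\<Sum>v\<in>neighbours G (hd rs). of_bool (snd (m {hd rs, v})) :: real) \<longleftrightarrow>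
        (\<Sum>v\<in>neighbours G (hd rs). of_bool (snd (m {hd rs, v})) :: real) \<noteq> 0"
      by (simp add: less_le sum_nonneg)
    also have "\<dots> \<longleftrightarrow> (\<exists>v\<in>neighbours G (hd rs). snd (m {hd rs, v}))"
      by (subst sum_nonneg_eq_0_iff[OF fin]) auto
    finally show ?thesis
      by (simp add: x map_marks_abs[OF G] root_matched_abs[OF G] edge_sum_abs[OF G])
  qed
  ultimately show ?thesis by simp
qed

lemma measurable_map_marks:
  "continuous_on UNIV f \<Longrightarrow> map_marks f \<in> borel \<rightarrow>\<^sub>M borel"
  by (intro borel_measurable_continuous_onI continuous_map_marks)

lemma sets_matched: "{x :: (real \<times> bool) rooted. matched_graph (map_marks snd x)} \<in> sets borel"
proof -
  have "open (map_marks snd -` {x. \<not> matched_graph x} :: (real \<times> bool) rooted set)"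
    by (intro open_vimage open_not_matched continuous_map_marks continuous_on_snd continuous_on_id)
  then have "- (map_marks snd -` {x. \<not> matched_graph x} :: (real \<times> bool) rooted set) \<in> sets borel"
    by (intro borel_comp borel_open)
  then show ?thesis by (simp add: vimage_def Collect_neg_eq[symmetric])
qed

text \<open>Mass transport for the image law is mass transport for the original law and a transport function
  composed with the exchange; the weights are not touched.\<close>

lemma unimodular_matching_swap:
  assumes d: "2 \<le> d" and \<mu>: "unimodular_matching \<pi> \<omega> \<mu>"
  shows "unimodular_matching \<pi> \<omega> (distr \<mu> borel (swap q d))"
proof -
  have bl: "borel_law \<mu>" and uni: "unimodular \<mu>"
    and m: "AE x in \<mu>. matched_graph (map_marks snd x)"
    and w: "distr \<mu> borel (map_marks fst) = weighted_ubgw_law \<pi> \<omega>"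
    using \<mu> by (auto simp: unimodular_matching_def)
  have sets [measurable_cong]: "sets \<mu> = sets borel" using bl by (simp add: borel_law_def)
  interpret prob_space \<mu> using bl by (simp add: borel_law_def)
  have S [measurable]: "swap q d \<in> borel \<rightarrow>\<^sub>M borel" by (rule measurable_swap[OF d])
  have "borel_law (distr \<mu> borel (swap q d))"
    unfolding borel_law_def by (auto intro!: prob_space_distr)
  moreover have "unimodular (distr \<mu> borel (swap q d))"
    unfolding unimodular_def
  proof
    fix f :: "(real \<times> bool) rooted \<Rightarrow> ennreal" assume f [measurable]: "f \<in> borel_measurable borel"
    have [measurable]: "mass_out f \<in> borel_measurable borel" "mass_in f \<in> borel_measurable borel"
      by (rule borel_measurable_mass_out[OF f] borel_measurable_mass_in[OF f])+
    have "(\<lambda>y. f (swap q d y)) \<in> borel_measurable borel" by measurable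
    then have "(\<integral>\<^sup>+ x. mass_out (\<lambda>y. f (swap q d y)) x \<partial>\<mu>) = (\<integral>\<^sup>+ x. mass_in (\<lambda>y. f (swap q d y)) x \<partial>\<mu>)"
      using uni unfolding unimodular_def by blast
    then show "(\<integral>\<^sup>+ x. mass_out f x \<partial>distr \<mu> borel (swap q d)) = (\<integral>\<^sup>+ x. mass_in f x \<partial>distr \<mu> borel (swap q d))"
      by (simp add: nn_integral_distr mass_out_swap mass_in_swap)
  qed
  moreover have "AE x in distr \<mu> borel (swap q d). matched_graph (map_marks snd x)"
  proof (subst AE_distr_iff)
    show "{x \<in> space borel. matched_graph (map_marks snd x)} \<in> sets (borel :: (real \<times> bool) rooted measure)"
      using sets_matched by simp
    show "AE x in \<mu>. matched_graph (map_marks snd (swap q d x))"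
      using m by eventually_elim (rule matched_swap[OF d])
  qed measurable
  moreover have "distr (distr \<mu> borel (swap q d)) borel (map_marks fst) = weighted_ubgw_law \<pi> \<omega>"
  proof (subst distr_distr)
    show "map_marks fst \<in> borel \<rightarrow>\<^sub>M (borel :: real rooted measure)"
      by (intro measurable_map_marks continuous_on_fst continuous_on_id)
    show "distr \<mu> borel (map_marks fst \<circ> swap q d) = weighted_ubgw_law \<pi> \<omega>"
      unfolding w[symmetric] by (simp add: comp_def map_marks_fst_swap)
  qed measurable
  ultimately show ?thesis by (simp add: unimodular_matching_def)
qed

text \<open>The exchange does not change the matching size, so by optimality it cannot increase the weight.
  Since the sizes agree, all weights may be reduced by the threshold; then the exchange improves the
  contribution of the root in every case, and strictly so at a centre.\<close>

lemma optimal_swap_centre_null: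
  assumes d: "2 \<le> d" and opt: "optimal_matching \<pi> \<omega> \<mu>"
    and int: "\<And>\<nu>. unimodular_matching \<pi> \<omega> \<nu> \<Longrightarrow> integrable \<nu> root_matched_weight"
  shows "AE x in \<mu>. x \<notin> swap_centre q d"
proof -
  let ?R = "{x :: (real \<times> bool) rooted. root_matched (map_marks snd x)}"
  let ?g = "edge_sum (matched_excess q)"
  define \<nu> where "\<nu> = distr \<mu> borel (swap q d)"
  have um: "unimodular_matching \<pi> \<omega> \<mu>" using opt by (simp add: optimal_matching_def)
  have un: "unimodular_matching \<pi> \<omega> \<nu>" unfolding \<nu>_def by (rule unimodular_matching_swap[OF d um])
  have bl: "borel_law \<mu>" and uni: "unimodular \<mu>" using um by (auto simp: unimodular_matching_def)
  have sets [measurable_cong]: "sets \<mu> = sets borel" using bl by (simp add: borel_law_def)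
  have space: "space \<mu> = UNIV" using sets_eq_imp_space_eq[OF sets] by simp
  interpret prob_space \<mu> using bl by (simp add: borel_law_def)
  have S [measurable]: "swap q d \<in> borel \<rightarrow>\<^sub>M borel" by (rule measurable_swap[OF d])
  have R [measurable]: "?R \<in> sets borel" by (rule sets_root_matched)
  have C [measurable]: "swap_centre q d \<in> sets borel" and L [measurable]: "swap_leaf q d \<in> sets borel"
    using open_swap_sets[OF d] by (auto intro: borel_open)
  have g [measurable]: "?g \<in> borel_measurable borel" by (rule borel_measurable_matched_excess)
  \<comment> \<open>Mass transport: losing leaves and gaining centres balance.\<close>
  have "(\<integral>\<^sup>+ x. indicator (swap_centre q d) x \<partial>\<mu>) = (\<integral>\<^sup>+ x. indicator (swap_leaf q d) x \<partial>\<mu>)"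
  proof -
    have "indicator (swap_transport q d) \<in> borel_measurable (borel :: (real \<times> bool) rooted measure)"
      using open_swap_sets(4)[OF d] by (intro borel_measurable_indicator borel_open)
    moreover have "mass_out (indicator (swap_transport q d)) = indicator (swap_centre q d)"
      "mass_in (indicator (swap_transport q d)) = indicator (swap_leaf q d)"
      by (intro ext mass_swap_transport d)+
    ultimately show ?thesis using uni unfolding unimodular_def by metis
  qed
  then have CL: "measure \<mu> (swap_centre q d) = measure \<mu> (swap_leaf q d)"
    using sets C L by (simp add: measure_def)
  have R': "swap q d -` ?R \<in> sets \<mu>"
    using measurable_sets[OF S R] sets by simp
  have "measure \<mu> ?R \<le> measure \<mu> (?R - swap_leaf q d) + measure \<mu> (swap_leaf q d)"
    using measure_Un_le[of "?R - swap_leaf q d" \<mu> "swap_leaf q d"]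
      finite_measure_mono[of ?R "?R - swap_leaf q d \<union> swap_leaf q d"] sets by force
  also have "\<dots> = measure \<mu> ((?R - swap_leaf q d) \<union> swap_centre q d)"
    unfolding CL[symmetric] using root_matched_swap(3)[OF d] sets
    by (intro finite_measure_Union[symmetric]) auto
  also have "\<dots> \<le> measure \<mu> (swap q d -` ?R)"
    using root_matched_swap(1,2)[OF d] R' by (intro finite_measure_mono) auto
  also have "\<dots> = matching_size \<nu>"
    unfolding matching_size_def \<nu>_def by (subst measure_distr) (auto simp: space)
  finally have "matching_size \<mu> \<le> matching_size \<nu>" by (simp add: matching_size_def)
  then have size: "matching_size \<nu> = matching_size \<mu>" and weight: "matching_weight \<nu> \<le> matching_weight \<mu>"
    using opt un unfolding optimal_matching_def by force+
  have excess: "integrable \<kappa> ?g \<and> (\<integral>x. ?g x \<partial>\<kappa>) = matching_weight \<kappa> - q * matching_size \<kappa>"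
    if \<kappa>: "unimodular_matching \<pi> \<omega> \<kappa>" for \<kappa>
  proof -
    have s [measurable_cong]: "sets \<kappa> = sets borel" and p: "prob_space \<kappa>"
      and m: "AE x in \<kappa>. matched_graph (map_marks snd x)"
      using \<kappa> by (auto simp: unimodular_matching_def borel_law_def)
    interpret k: prob_space \<kappa> by (rule p)
    have eq: "AE x in \<kappa>. root_matched_weight x - q * indicator ?R x = ?g x"
      using m by eventually_elim (simp add: edge_sum_root_matched)
    have i1: "integrable \<kappa> root_matched_weight" by (rule int[OF \<kappa>])
    have i2: "integrable \<kappa> (\<lambda>x. q * indicator ?R x :: real)"
      using s R by (intro integrable_mult_right integrable_real_indicator) (auto simp: k.emeasure_eq_measure)
    have i: "integrable \<kappa> (\<lambda>x. root_matched_weight x - q * indicator ?R x)"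
      by (intro Bochner_Integration.integrable_diff i1 i2)
    have "integrable \<kappa> ?g"
      by (rule integrable_cong_AE_imp[OF i]) (use eq in auto)
    moreover have "(\<integral>x. ?g x \<partial>\<kappa>) = (\<integral>x. root_matched_weight x - q * indicator ?R x \<partial>\<kappa>)"
      using eq i by (intro integral_cong_AE) auto
    moreover have "\<dots> = matching_weight \<kappa> - q * matching_size \<kappa>"
      using i1 i2 s R by (subst Bochner_Integration.integral_diff)
        (auto simp: matching_weight_def matching_size_def sets_eq_imp_space_eq[OF s])
    ultimately show ?thesis by simp
  qed
  have ig: "integrable \<mu> (\<lambda>x. ?g (swap q d x))"
    using excess[OF un] unfolding \<nu>_def by (subst (asm) integrable_distr_eq) auto
  have "(\<integral>x. ?g (swap q d x) \<partial>\<mu>) = (\<integral>x. ?g x \<partial>\<nu>)"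
    unfolding \<nu>_def by (rule integral_distr[symmetric]) auto
  also have "\<dots> \<le> (\<integral>x. ?g x \<partial>\<mu>)" using excess[OF un] excess[OF um] size weight by simp
  finally have "(\<integral>x. ?g (swap q d x) - ?g x \<partial>\<mu>) \<le> 0"
    using excess[OF um] ig by (simp add: Bochner_Integration.integral_diff)
  moreover have "0 \<le> (\<integral>x. ?g (swap q d x) - ?g x \<partial>\<mu>)"
    using edge_sum_swap(1)[OF d] by (intro integral_nonneg_AE) auto
  ultimately have "AE x in \<mu>. ?g (swap q d x) - ?g x = 0"
    using excess[OF um] ig edge_sum_swap(1)[OF d]
    by (subst integral_nonneg_eq_0_iff_AE[symmetric]) auto
  then show ?thesis by eventually_elim (use edge_sum_swap(2)[OF d, of _ q] in force)
qed

text \<open>What optimality says about the weights around an unmatched centre: up to ties, each of its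
  edges is outweighed by an edge to a leaf.\<close>

definition outweighed_centre :: "nat \<Rightarrow> graph \<Rightarrow> (nat set \<Rightarrow> real) \<Rightarrow> nat \<Rightarrow> bool" where
  "outweighed_centre d G w c \<longleftrightarrow> spider d G c \<and>
     ((\<exists>b\<in>neighbours G c. \<exists>b'\<in>neighbours G c. b \<noteq> b' \<and> w {c, b} = w {c, b'}) \<or>
      (\<forall>b\<in>neighbours G c. \<exists>l\<in>neighbours G b. l \<noteq> c \<and> w {c, b} \<le> w {b, l}))"

definition outweighed_roots :: "nat \<Rightarrow> real rooted set" where
  "outweighed_roots d = rooted_set (\<lambda>G w rs. outweighed_centre d G w (hd rs))"

lemma outweighed_centre_iso:
  assumes G: "rooted_graph G rs" and \<phi>: "graph_iso \<phi> G H"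
    and m: "\<And>e. e \<in> edges G \<Longrightarrow> n (\<phi> ` e) = m e" and c: "c \<in> verts G"
  shows "outweighed_centre d H n (\<phi> c) \<longleftrightarrow> outweighed_centre d G m c"
proof -
  note s = rooted_graph_simple[OF G]
  have inj: "inj_on \<phi> (verts G)" using \<phi> by (auto simp: graph_iso_def bij_betw_def)
  have N: "neighbours H (\<phi> u) = \<phi> ` neighbours G u" if "u \<in> verts G" for u
    using rooted_iso_neighbours[OF s \<phi> that] by (auto simp: bij_betw_def)
  have mark: "n {\<phi> u, \<phi> w} = m {u, w}" if "w \<in> neighbours G u" for u w
    using m[of "{u, w}"] that by (simp add: neighbours_def)
  have v: "b \<in> verts G" if "b \<in> neighbours G u" for b u
    using that neighbours_subset_verts[OF s] by blast
  have eq: "\<phi> u = \<phi> w \<longleftrightarrow> u = w" if "u \<in> verts G" "w \<in> verts G" for u w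
    using inj that by (auto dest: inj_onD)
  have img: "(\<forall>x\<in>\<phi> ` A. Q x) \<longleftrightarrow> (\<forall>x\<in>A. Q (\<phi> x))" "(\<exists>x\<in>\<phi> ` A. Q x) \<longleftrightarrow> (\<exists>x\<in>A. Q (\<phi> x))" for A Q
    by auto
  have tie: "(\<phi> b \<noteq> \<phi> b' \<and> n {\<phi> c, \<phi> b} = n {\<phi> c, \<phi> b'}) = (b \<noteq> b' \<and> m {c, b} = m {c, b'})"
    if "b \<in> neighbours G c" "b' \<in> neighbours G c" for b b'
    using mark[OF that(1)] mark[OF that(2)] eq[OF v[OF that(1)] v[OF that(2)]] by simp
  have "(\<phi> l \<noteq> \<phi> c \<and> n {\<phi> c, \<phi> b} \<le> n {\<phi> b, \<phi> l}) = (l \<noteq> c \<and> m {c, b} \<le> m {b, l})"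
    if "b \<in> neighbours G c" "l \<in> neighbours G b" for b l
    using mark[OF that(1)] mark[OF that(2)] eq[OF v[OF that(2)] c] by simp
  then have leg: "(\<exists>l\<in>neighbours H (\<phi> b). l \<noteq> \<phi> c \<and> n {\<phi> c, \<phi> b} \<le> n {\<phi> b, l}) =
      (\<exists>l\<in>neighbours G b. l \<noteq> c \<and> m {c, b} \<le> m {b, l})" if "b \<in> neighbours G c" for b
    using that unfolding N[OF v[OF that]] img by (intro bex_cong refl)
  show ?thesis
    unfolding outweighed_centre_def spider_iso[OF \<phi> G c] N[OF c] img
    by (intro leg tie conj_cong disj_cong bex_cong ball_cong refl)
qed

lemma iso_invariant_outweighed:
  "iso_invariant (\<lambda>G w rs. outweighed_centre d G w (hd rs))"
  "iso_invariant (\<lambda>G w rs. spider d G (hd rs) \<and> \<not> outweighed_centre d G w (hd rs))"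
  unfolding iso_invariant_def
  using outweighed_centre_iso[of _ _ _ _ _ _ "hd _"]
  by (auto simp: hd_map_root hd_root spider_iso)

lemma sets_outweighed_roots:
  assumes d: "2 \<le> d" shows "outweighed_roots d \<in> sets borel"
proof -
  let ?P = "\<lambda>G w rs. spider d G (hd rs) \<and> \<not> outweighed_centre d G w (hd rs)"
  have fin: "finite (verts G)" if "rooted_graph G rs" "spider d G (hd rs)" for G rs
    using that spider_finite[OF that(2) d] hd_root[OF that(1)] by (auto simp: rooted_graph_def)
  have c: "open {w :: nat set \<Rightarrow> real. w e \<noteq> w e'}" "open {w :: nat set \<Rightarrow> real. w e < w e'}" for e e'
    by (rule open_Collect_neq open_Collect_less; rule continuous_on_product_coordinates)+
  have "open (spider_roots d :: real rooted set)"
    unfolding spider_roots_def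
    by (rule open_rooted_set_finite[OF iso_invariant_spider]) (auto intro: fin)
  moreover have "open (rooted_set ?P)"
  proof (rule open_rooted_set_finite[OF iso_invariant_outweighed(2)])
    fix G rs assume G: "rooted_graph G rs" and fG: "finite (verts G)"
    have "finite (neighbours G v)" for v
      using fG neighbours_subset_verts[OF rooted_graph_simple[OF G]] finite_subset by blast
    then have "open {w :: nat set \<Rightarrow> real. spider d G (hd rs) \<and>
        ((\<forall>b\<in>neighbours G (hd rs). \<forall>b'\<in>neighbours G (hd rs). b = b' \<or> w {hd rs, b} \<noteq> w {hd rs, b'}) \<and>
        (\<exists>b\<in>neighbours G (hd rs). \<forall>l\<in>neighbours G b. l = hd rs \<or> w {b, l} < w {hd rs, b}))}"
      unfolding Bex_def
      by (intro open_Collect_conj open_Collect_const open_Collect_ball open_Collect_disj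
        open_Collect_ex c)
    then show "open {w. ?P G w rs}"
      by (rule back_subst[where P = "open"]) (auto simp: outweighed_centre_def not_le)
  qed (use fin in auto)
  moreover have "outweighed_roots d = spider_roots d - rooted_set ?P"
  proof (rule set_eqI)
    fix x :: "real rooted"
    obtain G m rs where x: "x = abs_rooted (G, m, rs)" and G: "rooted_graph G rs" by (rule rooted_cases)
    show "x \<in> outweighed_roots d \<longleftrightarrow> x \<in> spider_roots d - rooted_set ?P"
      unfolding x outweighed_roots_def spider_roots_def Diff_iff
        mem_rooted_set[OF iso_invariant_outweighed(1) G] mem_rooted_set[OF iso_invariant_outweighed(2) G]
        mem_rooted_set[OF iso_invariant_spider G]
      by (auto simp: outweighed_centre_def)
  qed
  ultimately show ?thesis by auto
qed

text \<open>If an unmatched centre is not outweighed, then take, among its edges that outweigh the matched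
  edge next to them, the heaviest one.  A threshold just below its weight makes this edge the only candidate for a swap.\<close>

lemma swappable_exists:
  assumes d: "2 \<le> d" and G: "rooted_graph G rs" and c: "c \<in> verts G"
    and M: "is_matching G {e \<in> edges G. snd (m e)}"
    and un: "unmatched_centre d G (snd \<circ> m) c" and now: "\<not> outweighed_centre d G (fst \<circ> m) c"
  shows "\<exists>q\<in>\<rat>. \<exists>b l. swappable q d G m c b l"
proof -
  let ?w = "\<lambda>u v. fst (m {u, v})"
  have sp: "spider d G c" and cu: "\<And>b. b \<in> neighbours G c \<Longrightarrow> \<not> snd (m {c, b})"
    and bm: "\<And>b. b \<in> neighbours G c \<Longrightarrow> \<exists>l\<in>neighbours G b. snd (m {b, l})"
    using un by (auto simp: unmatched_centre_def)
  have dist: "\<And>b b'. b \<in> neighbours G c \<Longrightarrow> b' \<in> neighbours G c \<Longrightarrow> b \<noteq> b' \<Longrightarrow> ?w c b \<noteq> ?w c b'"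
    and "\<exists>b\<in>neighbours G c. \<forall>l\<in>neighbours G b. l \<noteq> c \<longrightarrow> ?w b l < ?w c b"
    using now sp by (auto simp: outweighed_centre_def not_le)
  then obtain b1 where b1: "b1 \<in> neighbours G c" "\<And>l. l \<in> neighbours G b1 \<Longrightarrow> l \<noteq> c \<Longrightarrow> ?w b1 l < ?w c b1"
    by blast
  have nc: "l \<noteq> c" if "b \<in> neighbours G c" "snd (m {b, l})" for b l
    using cu[OF that(1)] that(2) by (auto simp: insert_commute)
  have pw: "pairwise disjnt {e \<in> edges G. snd (m e)}" using M by (simp add: is_matching_def)
  have finG: "finite (verts G)"
    using spider_finite[OF sp d _ c] G by (auto simp: rooted_graph_def)
  define I where "I = {b \<in> neighbours G c. \<exists>l\<in>neighbours G b. snd (m {b, l}) \<and> ?w b l < ?w c b}"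
  have "finite (neighbours G c)"
    using finG neighbours_subset_verts[OF rooted_graph_simple[OF G]] finite_subset by blast
  then have "finite I" by (simp add: I_def)
  moreover have "b1 \<in> I" using bm[OF b1(1)] b1 nc by (auto simp: I_def)
  ultimately have "Max (?w c ` I) \<in> ?w c ` I" by (intro Max_in) auto
  then obtain b where "b \<in> I" "?w c b = Max (?w c ` I)" by auto
  then have b: "b \<in> I" "\<And>b'. b' \<in> I \<Longrightarrow> ?w c b' \<le> ?w c b" using \<open>finite I\<close> by simp_all
  then obtain l where l: "b \<in> neighbours G c" "l \<in> neighbours G b" "snd (m {b, l})" "?w b l < ?w c b"
    by (auto simp: I_def)
  define F where "F = {x \<in> (fst \<circ> m) ` edges G. x < ?w c b}"
  have "edges G \<subseteq> Pow (verts G)" using edge_subset_verts[OF rooted_graph_simple[OF G]] by auto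
  then have "finite (edges G)" using finG by (meson finite_Pow_iff finite_subset)
  then have finF: "finite F" by (simp add: F_def)
  have wF: "?w u v \<in> F" if "v \<in> neighbours G u" "?w u v < ?w c b" for u v
    using that by (auto simp: F_def neighbours_def)
  have "F \<noteq> {}" using wF[OF l(2,4)] by auto
  then have "Max F < ?w c b" using Max_in[OF finF] by (auto simp: F_def)
  then obtain q where q: "q \<in> \<rat>" "Max F < q" "q < ?w c b" using Rats_dense_in_real by blast
  have below: "?w u v < q" if "v \<in> neighbours G u" "?w u v < ?w c b" for u v
    using Max_ge[OF finF wF[OF that]] q(2) by simp
  have "swappable q d G m c b l"
    unfolding swappable_def
  proof (intro conjI ballI impI)
    fix l' assume l': "l' \<in> neighbours G b" "l' \<noteq> l"
    show "\<not> snd (m {b, l'})"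
    proof
      assume "snd (m {b, l'})"
      then have "disjnt {b, l'} {b, l}"
        using l l' by (intro pairwiseD(1)[OF pw]) (auto simp: neighbours_def doubleton_eq_iff)
      then show False by (simp add: disjnt_def)
    qed
  next
    fix b' assume b': "b' \<in> neighbours G c" "b' \<noteq> b"
    show "?w c b' < q \<or> (\<forall>l'\<in>neighbours G b'. \<not> snd (m {b', l'}) \<or> q < ?w b' l')"
    proof (cases "?w c b' < ?w c b")
      case True
      then show ?thesis using below[OF b'(1)] by blast
    next
      case False
      then have "?w c b < ?w c b'" using dist[OF b'(1) l(1) b'(2)] by simp
      then have "b' \<notin> I" using b(2)[of b'] by auto
      then have "?w c b' \<le> ?w b' l'" if "l' \<in> neighbours G b'" "snd (m {b', l'})" for l'
        using b'(1) that by (auto simp: I_def not_less)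
      then show ?thesis using q(3) \<open>?w c b < ?w c b'\<close> by force
    qed
  qed (use sp cu l nc q below in auto)
  then show ?thesis using q(1) by blast
qed

lemma optimal_unmatched_centre:
  assumes d: "2 \<le> d" and opt: "optimal_matching \<pi> \<omega> \<mu>"
    and int: "\<And>\<nu>. unimodular_matching \<pi> \<omega> \<nu> \<Longrightarrow> integrable \<nu> root_matched_weight"
  shows "AE x in \<mu>. map_marks snd x \<in> unmatched_centre_roots d \<longrightarrow> map_marks fst x \<in> outweighed_roots d"
proof -
  have "AE x in \<mu>. \<forall>q\<in>\<rat>. x \<notin> swap_centre q d"
    using optimal_swap_centre_null[OF d opt int] by (subst AE_ball_countable) (auto simp: countable_rat)
  moreover have "AE x in \<mu>. matched_graph (map_marks snd x)"
    using opt by (simp add: optimal_matching_def unimodular_matching_def)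
  ultimately show ?thesis
  proof eventually_elim
    case (elim x)
    obtain G m rs where x: "x = abs_rooted (G, m, rs)" and G: "rooted_graph G rs" by (rule rooted_cases)
    show ?case
      using elim swappable_exists[OF d G hd_root[OF G], of m]
      unfolding x map_marks_abs[OF G] matched_graph_abs[OF G] mem_swap_sets[OF G]
        unmatched_centre_roots_def mem_rooted_set[OF clopen_unmatched_centre_roots(1) G]
        outweighed_roots_def mem_rooted_set[OF iso_invariant_outweighed(1) G]
      by auto
  qed
qed

section \<open>The Bienayme-Galton-Watson tree near its root\<close>

abbreviation tree_root :: nat where
  "tree_root \<equiv> to_nat ([] :: nat list)"

lemma ulam_harris_words_Nil: "[] \<in> ulam_harris_words N"
  by (simp add: ulam_harris_words_def)

lemma ulam_harris_words_snoc:
  "u @ [i] \<in> ulam_harris_words N \<longleftrightarrow> u \<in> ulam_harris_words N \<and> i < N u"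
  by (auto simp: ulam_harris_words_def nth_append less_Suc_eq)

lemma edges_ulam_harris_tree:
  "{to_nat u, x} \<in> edges (ulam_harris_tree N) \<longleftrightarrow>
    (\<exists>i. u @ [i] \<in> ulam_harris_words N \<and> x = to_nat (u @ [i])) \<or>
    (\<exists>v i. u = v @ [i] \<and> u \<in> ulam_harris_words N \<and> x = to_nat v)"
  by (auto simp: ulam_harris_tree_def doubleton_eq_iff)

lemma neighbours_ulam_harris_tree:
  assumes "u \<in> ulam_harris_words N"
  shows "neighbours (ulam_harris_tree N) (to_nat u) =
    to_nat ` ((if u = [] then {} else {butlast u}) \<union> (\<lambda>i. u @ [i]) ` {..<N u})"
proof (cases u rule: rev_cases)
  case Nil
  then show ?thesis
    using assms ulam_harris_words_snoc[of "[]" _ N]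
    by (auto simp: neighbours_def edges_ulam_harris_tree)
next
  case (snoc v i)
  then show ?thesis
    using assms by (auto simp: neighbours_def edges_ulam_harris_tree ulam_harris_words_snoc[of "v @ [i]", simplified])
qed

lemma rooted_graph_ulam_harris_tree: "rooted_graph (ulam_harris_tree N) [tree_root]"
proof -
  let ?T = "ulam_harris_tree N"
  have "simple_graph ?T"
    by (auto simp: simple_graph_def ulam_harris_tree_def ulam_harris_words_snoc)
  moreover have "locally_finite_graph ?T"
    unfolding locally_finite_graph_def
    by (auto simp: ulam_harris_tree_def[of N] neighbours_ulam_harris_tree[unfolded ulam_harris_tree_def])
  moreover have "connected_graph ?T"
  proof -
    have root: "(tree_root, to_nat u) \<in> (adj_rel ?T)\<^sup>*" if "u \<in> ulam_harris_words N" for u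
      using that
    proof (induction u rule: rev_induct)
      case (snoc i u)
      then have "(to_nat u, to_nat (u @ [i])) \<in> adj_rel ?T"
        by (auto simp: adj_rel_def edges_ulam_harris_tree)
      then show ?case using snoc by (auto simp: ulam_harris_words_snoc intro: rtrancl_into_rtrancl)
    qed simp
    then show ?thesis by (intro connected_graphI[of _ tree_root]) (auto simp: ulam_harris_tree_def)
  qed
  moreover have "tree_root \<in> verts ?T" by (auto simp: ulam_harris_tree_def ulam_harris_words_Nil)
  ultimately show ?thesis by (simp add: rooted_graph_def)
qed

lemma neighbours_tree_root: "neighbours (ulam_harris_tree N) tree_root = (\<lambda>i. to_nat [i]) ` {..<N []}"
  using neighbours_ulam_harris_tree[OF ulam_harris_words_Nil, of N] by (auto simp: image_image)

lemma neighbours_tree_child: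
  assumes "i < N []"
  shows "neighbours (ulam_harris_tree N) (to_nat [i]) = insert tree_root ((\<lambda>j. to_nat [i, j]) ` {..<N [i]})"
proof -
  have "[i] \<in> ulam_harris_words N"
    using assms ulam_harris_words_snoc[of "[]" i N] ulam_harris_words_Nil by simp
  from neighbours_ulam_harris_tree[OF this] show ?thesis by (auto simp: image_image)
qed

lemma neighbours_tree_grandchild:
  assumes "i < N []" "j < N [i]"
  shows "neighbours (ulam_harris_tree N) (to_nat [i, j]) =
    insert (to_nat [i]) ((\<lambda>k. to_nat [i, j, k]) ` {..<N [i, j]})"
proof -
  have "[i] \<in> ulam_harris_words N"
    using assms ulam_harris_words_snoc[of "[]" i N] ulam_harris_words_Nil by simp
  then have "[i, j] \<in> ulam_harris_words N"
    using assms ulam_harris_words_snoc[of "[i]" j N] by simp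
  from neighbours_ulam_harris_tree[OF this] show ?thesis by (auto simp: image_image)
qed

definition spider_offspring :: "nat \<Rightarrow> (nat list \<Rightarrow> nat) set" where
  "spider_offspring d = {N. N [] = d \<and> (\<forall>i<d. N [i] = d - 1 \<and> (\<forall>j<d - 1. N [i, j] = 0))}"

lemma spider_tree_root:
  assumes d: "1 \<le> d"
  shows "spider d (ulam_harris_tree N) tree_root \<longleftrightarrow> N \<in> spider_offspring d"
proof -
  let ?T = "ulam_harris_tree N"
  have c: "card (neighbours ?T tree_root) = N []"
    by (simp add: neighbours_tree_root card_image inj_on_def)
  have b: "card (neighbours ?T (to_nat [i])) = Suc (N [i])" if "i < N []" for i
    unfolding neighbours_tree_child[where N = N, OF that] by (subst card_insert_disjoint) (auto simp: card_image inj_on_def)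
  have l: "neighbours ?T (to_nat [i, j]) = {to_nat [i]} \<longleftrightarrow> N [i, j] = 0" if "i < N []" "j < N [i]" for i j
    unfolding neighbours_tree_grandchild[where N = N, OF that] by (auto simp: inj_on_def)
  have "(\<forall>l\<in>neighbours ?T (to_nat [i]) - {tree_root}. neighbours ?T l = {to_nat [i]}) \<longleftrightarrow>
      (\<forall>j<N [i]. N [i, j] = 0)" if "i < N []" for i
    using l[OF that] unfolding neighbours_tree_child[where N = N, OF that] by auto
  then have "spider d ?T tree_root \<longleftrightarrow>
      N [] = d \<and> (\<forall>i<N []. Suc (N [i]) = d \<and> (\<forall>j<N [i]. N [i, j] = 0))"
    unfolding spider_def c by (auto simp: neighbours_tree_root b)
  moreover have "Suc (N [i]) = d \<and> (\<forall>j<N [i]. N [i, j] = 0) \<longleftrightarrow>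
      N [i] = d - 1 \<and> (\<forall>j<d - 1. N [i, j] = 0)" for i
    using d by auto
  ultimately show ?thesis by (auto simp: spider_offspring_def)
qed

text \<open>The term \<^term>\<open>distr M L f\<close> denotes the null measure unless the preimages under \<open>f\<close> define a measure
  on the sets of \<open>L\<close>.  So if it is a probability measure, then its values are those of the
  preimages, whether or not \<open>f\<close> is measurable.  This applies to the laws of the random trees: the
  assumptions on matchings and on convergence make them probability measures.\<close>

lemma emeasure_distr_prob_space:
  assumes "prob_space (distr M L f)" "A \<in> sets L"
  shows "emeasure (distr M L f) A = emeasure M (f -` A \<inter> space M)"
proof -
  have "emeasure (distr M L f) (space L) = 1"
    using prob_space.emeasure_space_1[OF assms(1)] by simp
  then have "measure_space (space L) (sets L) (\<lambda>A. emeasure M (f -` A \<inter> space M))"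
    unfolding distr_def by (auto simp: emeasure_measure_of_conv sets.sigma_sets_eq split: if_splits)
  then show ?thesis
    using assms(2) unfolding distr_def by (simp add: emeasure_measure_of_conv sets.sigma_sets_eq)
qed

lemma distr_distr_prob_space:
  assumes p: "prob_space (distr M L f)" and g: "g \<in> L \<rightarrow>\<^sub>M K" and gf: "(\<lambda>x. g (f x)) \<in> M \<rightarrow>\<^sub>M K"
    and f: "f \<in> space M \<rightarrow> space L"
  shows "distr (distr M L f) K g = distr M K (\<lambda>x. g (f x))"
proof (rule measure_eqI)
  fix A assume "A \<in> sets (distr (distr M L f) K g)"
  then have A: "A \<in> sets K" by simp
  have "emeasure (distr (distr M L f) K g) A = emeasure (distr M L f) (g -` A \<inter> space L)"
    using g A by (subst emeasure_distr) auto
  also have "\<dots> = emeasure M (f -` (g -` A \<inter> space L) \<inter> space M)"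
    using measurable_sets[OF g A] by (intro emeasure_distr_prob_space p) auto
  also have "\<dots> = emeasure M ((\<lambda>x. g (f x)) -` A \<inter> space M)"
    using f by (intro arg_cong[where f = "emeasure M"]) auto
  finally show "emeasure (distr (distr M L f) K g) A = emeasure (distr M K (\<lambda>x. g (f x))) A"
    using gf A by (simp add: emeasure_distr)
qed simp

lemma space_offspring_law: "space (offspring_law \<pi>) = UNIV"
  by (auto simp: offspring_law_def space_PiM)

lemma prob_space_offspring_law: "prob_space (offspring_law \<pi>)"
  unfolding offspring_law_def by (intro prob_space_PiM measure_pmf.prob_space_axioms)

lemma measurable_offspring [measurable]: "(\<lambda>N. N u) \<in> offspring_law \<pi> \<rightarrow>\<^sub>M count_space UNIV"
proof -
  have "(\<lambda>N. N u) \<in> offspring_law \<pi> \<rightarrow>\<^sub>M measure_pmf (if u = [] then \<pi> else hat_pmf \<pi>)"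
    unfolding offspring_law_def by (rule measurable_component_singleton) simp
  then show ?thesis by (simp cong: measurable_cong_sets)
qed

lemma sets_spider_offspring [measurable]: "spider_offspring d \<in> sets (offspring_law \<pi>)"
proof -
  have "{N \<in> space (offspring_law \<pi>). N [] = d \<and> (\<forall>i\<in>{..<d}. N [i] = d - 1 \<and> (\<forall>j\<in>{..<d - 1}. N [i, j] = 0))}
      \<in> sets (offspring_law \<pi>)"
    by measurable
  then show ?thesis by (simp add: space_offspring_law spider_offspring_def Ball_def)
qed

text \<open>The event prescribes the values of finitely many independent offspring numbers.\<close>

lemma spider_offspring_pos:
  assumes "pmf \<pi> d > 0" "pmf (hat_pmf \<pi>) (d - 1) > 0" "pmf (hat_pmf \<pi>) 0 > 0"
  shows "0 < measure (offspring_law \<pi>) (spider_offspring d)"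
proof -
  let ?M = "\<lambda>u :: nat list. measure_pmf (if u = [] then \<pi> else hat_pmf \<pi>)"
  interpret product_prob_space ?M UNIV
    by (simp add: product_prob_space_def product_prob_space_axioms_def product_sigma_finite_def
        measure_pmf.prob_space_axioms measure_pmf.sigma_finite_measure_axioms)
  define J where "J = insert [] ((\<lambda>i. [i]) ` {..<d} \<union> (\<lambda>(i, j). [i, j]) ` ({..<d} \<times> {..<d - 1}))"
  define X where "X u = {if length u = 0 then d else if length u = 1 then d - 1 else 0}"
    for u :: "nat list"
  have "(\<forall>u\<in>J. N u \<in> X u) \<longleftrightarrow> N [] = d \<and> (\<forall>i<d. N [i] = d - 1) \<and> (\<forall>i<d. \<forall>j<d - 1. N [i, j] = 0)" for N
  proof -
    have "(\<forall>u\<in>J. P u) \<longleftrightarrow> P [] \<and> (\<forall>i<d. P [i]) \<and> (\<forall>i<d. \<forall>j<d - 1. P [i, j])" for P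
      unfolding J_def by auto
    from this[of "\<lambda>u. N u \<in> X u"] show ?thesis by (simp add: X_def)
  qed
  then have "spider_offspring d = {N \<in> space (PiM UNIV ?M). \<forall>u\<in>J. N u \<in> X u}"
    unfolding spider_offspring_def by (simp add: space_PiM) blast
  then have "emeasure (offspring_law \<pi>) (spider_offspring d) = (\<Prod>u\<in>J. emeasure (?M u) (X u))"
    unfolding offspring_law_def by (subst emeasure_PiM_Collect[symmetric]) (auto simp: J_def)
  also have "\<dots> > 0"
  proof -
    have "emeasure (?M u) (X u) \<noteq> 0" if "u \<in> J" for u
      using assms that by (auto simp: X_def J_def emeasure_pmf_single)
    moreover have "finite J" by (simp add: J_def)
    ultimately show ?thesis by (simp add: zero_less_iff_neq_zero)
  qed
  finally show ?thesis
    by (simp add: finite_measure.emeasure_eq_measure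
        prob_space.finite_measure[OF prob_space_offspring_law])
qed

section \<open>Independent weights without atoms\<close>

locale iid_weights =
  fixes \<omega> :: "real measure" and I :: "'i set"
  assumes law: "borel_law \<omega>" and atomless: "\<And>x. measure \<omega> {x} = 0"
begin

abbreviation W :: "('i \<Rightarrow> real) measure" where
  "W \<equiv> PiM I (\<lambda>_. \<omega>)"

lemma sets_law [measurable_cong]: "sets \<omega> = sets borel" and prob_law: "prob_space \<omega>"
  using law by (auto simp: borel_law_def)

sublocale P: prob_space W
  by (intro prob_space_PiM prob_law)

lemma measurable_weight [measurable]: "i \<in> I \<Longrightarrow> (\<lambda>w. w i) \<in> W \<rightarrow>\<^sub>M borel"
  by measurable

lemma distr_weight: "i \<in> I \<Longrightarrow> distr W borel (\<lambda>w. w i) = \<omega>"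
  using distr_PiM_component[of I "\<lambda>_. \<omega>" i] prob_law
  by (simp add: distr_cong[of W W borel \<omega> "\<lambda>w. w i" "\<lambda>w. w i"] sets_law)

lemma indep_weights: "P.indep_vars (\<lambda>_. borel) (\<lambda>i w. w i) I"
proof (cases "I = {}")
  case True
  then show ?thesis unfolding P.indep_vars_def P.indep_sets_def by blast
next
  case False
  have "distr W (PiM I (\<lambda>_. borel)) (\<lambda>w. \<lambda>i\<in>I. w i) = distr W W (\<lambda>w. w)"
  proof (rule distr_cong)
    show "sets (PiM I (\<lambda>_. borel)) = sets W" by (intro sets_PiM_cong) (auto simp: sets_law)
    show "(\<lambda>i\<in>I. w i) = w" if "w \<in> space W" for w
      using that by (auto simp: space_PiM PiE_def extensional_restrict)
  qed simp
  also have "\<dots> = PiM I (\<lambda>i. distr W borel (\<lambda>w. w i))"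
    by (simp add: distr_weight cong: PiM_cong)
  finally show ?thesis
    using False by (subst P.indep_vars_iff_distr_eq_PiM') auto
qed

lemma ties_null:
  assumes "i \<in> I" "j \<in> I" "i \<noteq> j" shows "P.prob {w \<in> space W. w i = w j} = 0"
proof -
  have "P.indep_var (PiM {i} (\<lambda>_. borel)) (\<lambda>w. restrict (\<lambda>i. w i) {i})
      (PiM {j} (\<lambda>_. borel)) (\<lambda>w. restrict (\<lambda>i. w i) {j})"
    by (rule P.indep_var_restrict[OF indep_weights]) (use assms in auto)
  then have "P.indep_var borel ((\<lambda>z. z i) \<circ> (\<lambda>w. restrict (\<lambda>i. w i) {i}))
      borel ((\<lambda>z. z j) \<circ> (\<lambda>w. restrict (\<lambda>i. w i) {j}))"
    by (rule P.indep_var_compose) auto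
  then have "P.indep_var borel (\<lambda>w. w i) borel (\<lambda>w. w j)" by (simp add: comp_def)
  then have eq: "\<omega> \<Otimes>\<^sub>M \<omega> = distr W (borel \<Otimes>\<^sub>M borel) (\<lambda>w. (w i, w j))"
    unfolding P.indep_var_distribution_eq using assms by (simp add: distr_weight)
  interpret L: prob_space \<omega> by (rule prob_law)
  interpret L2: pair_sigma_finite \<omega> \<omega> ..
  let ?D = "{z :: real \<times> real. fst z = snd z}"
  have "{z \<in> space (borel \<Otimes>\<^sub>M borel). fst z = (snd z :: real)} \<in> sets (borel \<Otimes>\<^sub>M borel)" by measurable
  then have D: "?D \<in> sets (borel \<Otimes>\<^sub>M borel)" by (simp add: space_pair_measure)
  then have D': "?D \<in> sets (\<omega> \<Otimes>\<^sub>M \<omega>)" by (simp add: eq)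
  have "Pair x -` ?D = {x}" for x by auto
  then have "emeasure (\<omega> \<Otimes>\<^sub>M \<omega>) ?D = 0"
    using atomless by (simp add: L.emeasure_pair_measure_alt[OF D'] L.emeasure_eq_measure)
  moreover have "(\<lambda>w. (w i, w j)) -` ?D \<inter> space W = {w \<in> space W. w i = w j}" by auto
  ultimately have "emeasure W {w \<in> space W. w i = w j} = 0"
    using D assms unfolding eq by (subst (asm) emeasure_distr) auto
  then show ?thesis by (simp add: P.emeasure_eq_measure)
qed

text \<open>Exchangeability and absence of ties: each of \<open>d\<close> weights is the largest one with
  probability \<open>1/d\<close>.\<close>

lemma prob_first_largest:
  assumes g: "inj_on g {..<d}" "g ` {..<d} \<subseteq> I" and d: "1 \<le> d"
  shows "P.prob {w \<in> space W. \<forall>k\<in>{1..<d}. w (g k) < w (g 0)} \<ge> 1 / real d"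
proof -
  let ?E = "\<lambda>g. {w \<in> space W. \<forall>k\<in>{1..<d}. w (g k) < w (g 0)}"
  let ?Z = "PiM {..<d} (\<lambda>_. \<omega>)"
  let ?Q = "{z \<in> space ?Z. \<forall>k\<in>{1..<d}. z k < z 0}"
  have law: "P.prob (?E h) = measure ?Z ?Q" if h: "inj_on h {..<d}" "h ` {..<d} \<subseteq> I" for h
  proof -
    have 0: "0 \<in> {..<d}" using d by auto
    have z: "(\<lambda>z. z k) \<in> borel_measurable ?Z" if "k \<in> {..<d}" for k
      using measurable_component_singleton[OF that, of "\<lambda>_. \<omega>"]
      by (simp add: measurable_cong_sets[OF refl sets_law])
    have Q: "?Q \<in> sets ?Z"
      using 0 by (intro sets.sets_Collect_finite_All borel_measurable_less z) auto
    have "distr W ?Z (\<lambda>w. \<lambda>n\<in>{..<d}. w (h n)) = ?Z"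
      using h by (intro distr_PiM_reindex prob_law) auto
    then have "measure ?Z ?Q = measure (distr W ?Z (\<lambda>w. \<lambda>n\<in>{..<d}. w (h n))) ?Q" by simp
    also have "\<dots> = P.prob ((\<lambda>w. \<lambda>n\<in>{..<d}. w (h n)) -` ?Q \<inter> space W)"
      using h Q by (intro measure_distr measurable_restrict) auto
    also have "(\<lambda>w. \<lambda>n\<in>{..<d}. w (h n)) -` ?Q \<inter> space W = ?E h"
      using h d by (auto simp: space_PiM PiE_def Pi_iff)
    finally show ?thesis ..
  qed
  define F where "F k = {w \<in> space W. \<forall>j\<in>{..<d} - {k}. w (g j) < w (g k)}" for k
  have F: "P.prob (F k) = P.prob (?E g)" if k: "k < d" for k
  proof -
    let ?h = "g \<circ> Transposition.transpose 0 k"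
    have b: "bij_betw (Transposition.transpose 0 k) {..<d} {..<d}"
      using k d by (intro bij_betw_byWitness[where f' = "Transposition.transpose 0 k"])
        (auto simp: Transposition.transpose_def)
    have "inj_on ?h {..<d}" using b g(1) by (auto simp: bij_betw_def intro: comp_inj_on)
    moreover have "?h ` {..<d} \<subseteq> I" using b g(2) unfolding image_comp[symmetric] by (simp add: bij_betw_def)
    ultimately have "P.prob (?E ?h) = measure ?Z ?Q" by (rule law)
    also have "\<dots> = P.prob (?E g)" by (rule law[OF g, symmetric])
    finally have "P.prob (?E ?h) = P.prob (?E g)" .
    moreover have "?E ?h = F k"
    proof -
      have T: "Transposition.transpose 0 k ` {1..<d} = {..<d} - {k}"
      proof -
        have "Transposition.transpose 0 k ` ({..<d} - {0}) = {..<d} - {k}"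
          using b d by (subst inj_on_image_set_diff[of _ "{..<d}"]) (auto simp: bij_betw_def)
        moreover have "{..<d} - {0} = {1..<d}" by auto
        ultimately show ?thesis by simp
      qed
      show ?thesis unfolding F_def T[symmetric] by auto
    qed
    ultimately show ?thesis by simp
  qed
  have Fsets: "F k \<in> sets W" if "k < d" for k
    unfolding F_def using that g(2) by (auto intro!: sets.sets_Collect_finite_All borel_measurable_less measurable_weight)
  define T where "T = (\<Union>(j, k)\<in>{(j, k). j < d \<and> k < d \<and> j \<noteq> k}. {w \<in> space W. w (g j) = w (g k)})"
  have fin: "finite {(j, k). j < d \<and> k < d \<and> j \<noteq> k}"
    by (rule finite_subset[of _ "{..<d} \<times> {..<d}"]) auto
  have tie: "{w \<in> space W. w (g j) = w (g k)} \<in> sets W" if "j < d" "k < d" for j k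
    using that g(2) by (auto intro!: borel_measurable_eq measurable_weight)
  have "P.prob T \<le> (\<Sum>(j, k)\<in>{(j, k). j < d \<and> k < d \<and> j \<noteq> k}. P.prob {w \<in> space W. w (g j) = w (g k)})"
    unfolding T_def using measure_UNION_le[OF fin, of "\<lambda>(j, k). {w \<in> space W. w (g j) = w (g k)}" W] tie
    by (auto simp: split_def)
  also have "\<dots> = 0"
    using g by (intro sum.neutral) (auto intro!: ties_null dest: inj_onD)
  finally have T0: "P.prob T \<le> 0" .
  have Tsets: "T \<in> sets W" unfolding T_def using fin tie by (intro sets.finite_UN) auto
  have "space W \<subseteq> (\<Union>k<d. F k) \<union> T"
  proof
    fix w assume w: "w \<in> space W"
    have "Max ((\<lambda>k. w (g k)) ` {..<d}) \<in> (\<lambda>k. w (g k)) ` {..<d}" using d by (intro Max_in) (auto simp: lessThan_empty_iff)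
    then obtain k where k: "k < d" "w (g k) = Max ((\<lambda>k. w (g k)) ` {..<d})" by auto
    then have le: "w (g j) \<le> w (g k)" if "j < d" for j using that by simp
    show "w \<in> (\<Union>k<d. F k) \<union> T"
    proof (cases "\<exists>j<d. j \<noteq> k \<and> w (g j) = w (g k)")
      case True
      then show ?thesis using w k(1) by (auto simp: T_def)
    next
      case False
      then have "w \<in> F k" using w le by (force simp: F_def less_le)
      then show ?thesis using k(1) by auto
    qed
  qed
  then have "1 \<le> P.prob ((\<Union>k<d. F k) \<union> T)"
    using P.finite_measure_mono[of "space W" "(\<Union>k<d. F k) \<union> T"] Fsets Tsets P.prob_space by auto
  also have "\<dots> \<le> P.prob (\<Union>k<d. F k) + P.prob T"
    using Fsets Tsets by (intro measure_Un_le) auto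
  also have "\<dots> \<le> (\<Sum>k<d. P.prob (F k)) + 0"
    using T0 Fsets by (intro add_mono measure_UNION_le) auto
  also have "\<dots> = real d * P.prob (?E g)" using F by simp
  finally show ?thesis using d by (simp add: field_simps)
qed

text \<open>The legs of a spider use disjoint sets of weights, so that the events that the edge at the
  centre is not the heaviest one of its leg are independent.\<close>

lemma prob_outweighed:
  fixes leg :: "nat \<Rightarrow> nat \<Rightarrow> 'i"
  assumes leg: "inj_on (\<lambda>(i, k). leg i k) ({..<d} \<times> {..<d})"
    "\<And>i k. i < d \<Longrightarrow> k < d \<Longrightarrow> leg i k \<in> I" and d: "1 \<le> d"
  defines "B \<equiv> {w \<in> space W. (\<exists>i<d. \<exists>j<d. i \<noteq> j \<and> w (leg i 0) = w (leg j 0)) \<or>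
      (\<forall>i<d. \<exists>k\<in>{1..<d}. w (leg i 0) \<le> w (leg i k))}"
  shows "B \<in> sets W" and "P.prob B \<le> (1 - 1 / real d) ^ d"
proof -
  define T where "T = (\<Union>(i, j)\<in>{(i, j). i < d \<and> j < d \<and> i \<noteq> j}. {w \<in> space W. w (leg i 0) = w (leg j 0)})"
  define A where "A = (\<Inter>i\<in>{..<d}. {w \<in> space W. \<exists>k\<in>{1..<d}. w (leg i 0) \<le> w (leg i k)})"
  have inj: "leg i k = leg j l \<longleftrightarrow> i = j \<and> k = l" if "i < d" "k < d" "j < d" "l < d" for i j k l
    using inj_onD[OF leg(1), of "(i, k)" "(j, l)"] that by auto
  have fin: "finite {(i, j). i < d \<and> j < d \<and> i \<noteq> j}"
    by (rule finite_subset[of _ "{..<d} \<times> {..<d}"]) auto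
  have tie: "{w \<in> space W. w (leg i 0) = w (leg j 0)} \<in> sets W" if "i < d" "j < d" for i j
    using that d leg(2) by (auto intro!: borel_measurable_eq measurable_weight)
  have "P.prob T \<le> (\<Sum>(i, j)\<in>{(i, j). i < d \<and> j < d \<and> i \<noteq> j}. P.prob {w \<in> space W. w (leg i 0) = w (leg j 0)})"
    unfolding T_def using measure_UNION_le[OF fin, of "\<lambda>(i, j). {w \<in> space W. w (leg i 0) = w (leg j 0)}" W] tie
    by (auto simp: split_def)
  also have "\<dots> = 0"
    using d leg(2) inj by (intro sum.neutral) (auto intro!: ties_null)
  finally have T0: "P.prob T \<le> 0" .
  have Tsets: "T \<in> sets W" unfolding T_def using fin tie by (intro sets.finite_UN) auto
  have Asets: "{w \<in> space W. \<exists>k\<in>{1..<d}. w (leg i 0) \<le> w (leg i k)} \<in> sets W" if "i < d" for i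
    using that leg(2) by (auto intro!: sets.sets_Collect_finite_Ex borel_measurable_le measurable_weight)
  have "0 \<in> {..<d}" using d by simp
  then have "A = {w \<in> space W. \<forall>i<d. \<exists>k\<in>{1..<d}. w (leg i 0) \<le> w (leg i k)}"
    unfolding A_def by blast
  then have BTA: "B = T \<union> A" by (auto simp: B_def T_def)
  have "A \<in> sets W" unfolding A_def using Asets d by (intro sets.finite_INT) (auto simp: lessThan_empty_iff)
  then show "B \<in> sets W" using Tsets by (simp add: BTA)
  let ?K = "\<lambda>i. leg i ` {..<d}"
  let ?X = "\<lambda>i w. restrict (\<lambda>e. w e) (?K i)"
  let ?A = "\<lambda>i. {z \<in> space (PiM (?K i) (\<lambda>_. borel :: real measure)). \<exists>k\<in>{1..<d}. z (leg i 0) \<le> z (leg i k)}"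
  have "P.indep_vars (\<lambda>i. PiM (?K i) (\<lambda>_. borel)) ?X {..<d}"
    by (rule P.indep_vars_restrict[OF indep_weights])
       (use leg(2) inj in \<open>auto simp: disjoint_family_on_def\<close>)
  moreover have "?A i \<in> sets (PiM (?K i) (\<lambda>_. borel))" for i
  proof -
    have z: "(\<lambda>z. z e) \<in> borel_measurable (PiM (?K i) (\<lambda>_. borel :: real measure))" if "e \<in> ?K i" for e
      using that by (rule measurable_component_singleton)
    show ?thesis
      using d by (intro sets.sets_Collect_finite_Ex borel_measurable_le z) auto
  qed
  ultimately have ind: "P.prob (\<Inter>i\<in>{..<d}. ?X i -` ?A i \<inter> space W) = (\<Prod>i\<in>{..<d}. P.prob (?X i -` ?A i \<inter> space W))"
    using d by (intro P.indep_varsD) (auto simp: lessThan_empty_iff)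
  have X: "?X i -` ?A i \<inter> space W = {w \<in> space W. \<exists>k\<in>{1..<d}. w (leg i 0) \<le> w (leg i k)}"
    if "i < d" for i
    using d by (auto simp: space_PiM)
  have "A = (\<Inter>i\<in>{..<d}. ?X i -` ?A i \<inter> space W)"
    unfolding A_def by (intro INF_cong refl X[symmetric]) simp
  then have "P.prob A = (\<Prod>i\<in>{..<d}. P.prob (?X i -` ?A i \<inter> space W))" by (simp only: ind)
  also have "\<dots> = (\<Prod>i\<in>{..<d}. P.prob {w \<in> space W. \<exists>k\<in>{1..<d}. w (leg i 0) \<le> w (leg i k)})"
    by (intro prod.cong refl arg_cong[where f = P.prob] X) simp
  also have "\<dots> \<le> (\<Prod>i\<in>{..<d}. 1 - 1 / real d)"
  proof (intro prod_mono conjI)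
    fix i assume i: "i \<in> {..<d}"
    let ?E = "{w \<in> space W. \<forall>k\<in>{1..<d}. w (leg i k) < w (leg i 0)}"
    have "1 / real d \<le> P.prob ?E"
      using i inj leg(2) d by (intro prob_first_largest) (auto simp: inj_on_def)
    moreover have "{w \<in> space W. \<exists>k\<in>{1..<d}. w (leg i 0) \<le> w (leg i k)} = space W - ?E"
      by (auto simp: not_less)
    moreover have E: "?E = space W - {w \<in> space W. \<exists>k\<in>{1..<d}. w (leg i 0) \<le> w (leg i k)}"
      by (auto simp: not_le)
    have "?E \<in> sets W" using Asets[of i] i by (subst E) (intro sets.compl_sets, simp)
    ultimately show "P.prob {w \<in> space W. \<exists>k\<in>{1..<d}. w (leg i 0) \<le> w (leg i k)} \<le> 1 - 1 / real d"
      by (simp add: P.prob_compl)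
  qed simp
  finally have "P.prob A \<le> (1 - 1 / real d) ^ d" by simp
  moreover have "P.prob B \<le> P.prob T + P.prob A"
    unfolding BTA using Tsets \<open>A \<in> sets W\<close> by (rule measure_Un_le)
  ultimately show "P.prob B \<le> (1 - 1 / real d) ^ d" using T0 by simp
qed

end

section \<open>The weighted tree\<close>

lemma ubgw_spider_roots:
  assumes "prob_space (ubgw_law \<pi>)" "1 \<le> d"
  shows "measure (ubgw_law \<pi>) (spider_roots d) = measure (offspring_law \<pi>) (spider_offspring d)"
proof -
  let ?f = "\<lambda>N. abs_rooted (ulam_harris_tree N, \<lambda>_. (), [tree_root])"
  have "?f -` spider_roots d \<inter> space (offspring_law \<pi>) = spider_offspring d"
    by (auto simp: space_offspring_law spider_roots_def spider_tree_root[OF assms(2)]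
      mem_rooted_set[OF iso_invariant_spider rooted_graph_ulam_harris_tree])
  moreover have "spider_roots d \<in> sets (borel :: unit rooted measure)"
    using clopen_spider_roots(1) by (rule borel_open)
  ultimately show ?thesis
    using emeasure_distr_prob_space[of "offspring_law \<pi>" borel ?f "spider_roots d"] assms(1)
    by (simp add: ubgw_law_def measure_def)
qed

text \<open>Leg \<open>i\<close> of the spider at the root of the tree consists of its edge at the centre, numbered \<open>0\<close>,
  and of its edges to leaves.\<close>

definition leg_edge :: "nat \<Rightarrow> nat \<Rightarrow> nat set" where
  "leg_edge i k = (if k = 0 then {tree_root, to_nat [i]} else {to_nat [i], to_nat [i, k - 1]})"

lemma leg_edge_inj: "leg_edge i k = leg_edge j l \<longleftrightarrow> i = j \<and> k = l"
  by (cases k; cases l) (auto simp: leg_edge_def doubleton_eq_iff)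

lemma card_leg_edge: "card (leg_edge i k) = 2"
  by (auto simp: leg_edge_def)

lemma outweighed_tree_root:
  assumes "outweighed_centre d (ulam_harris_tree N) w tree_root" "1 \<le> d"
  shows "N \<in> spider_offspring d"
    and "(\<exists>i<d. \<exists>j<d. i \<noteq> j \<and> w (leg_edge i 0) = w (leg_edge j 0)) \<or>
      (\<forall>i<d. \<exists>k\<in>{1..<d}. w (leg_edge i 0) \<le> w (leg_edge i k))"
proof -
  let ?T = "ulam_harris_tree N"
  show N: "N \<in> spider_offspring d"
    using assms spider_tree_root by (simp add: outweighed_centre_def)
  have c: "neighbours ?T tree_root = (\<lambda>i. to_nat [i]) ` {..<d}"
    using N by (simp add: neighbours_tree_root spider_offspring_def)
  have b: "neighbours ?T (to_nat [i]) = insert tree_root ((\<lambda>j. to_nat [i, j]) ` {..<d - 1})" if "i < d" for i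
    using N that neighbours_tree_child[of i N] by (simp add: spider_offspring_def)
  consider i j where "i < d" "j < d" "i \<noteq> j" "w {tree_root, to_nat [i]} = w {tree_root, to_nat [j]}"
    | "\<forall>i<d. \<exists>l\<in>neighbours ?T (to_nat [i]). l \<noteq> tree_root \<and> w {tree_root, to_nat [i]} \<le> w {to_nat [i], l}"
    using assms(1) unfolding outweighed_centre_def c by auto
  then show "(\<exists>i<d. \<exists>j<d. i \<noteq> j \<and> w (leg_edge i 0) = w (leg_edge j 0)) \<or>
      (\<forall>i<d. \<exists>k\<in>{1..<d}. w (leg_edge i 0) \<le> w (leg_edge i k))"
  proof cases
    case 1
    then show ?thesis by (auto simp: leg_edge_def)
  next
    case 2
    have "\<exists>k\<in>{1..<d}. w (leg_edge i 0) \<le> w (leg_edge i k)" if i: "i < d" for i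
    proof -
      obtain j where "j < d - 1" "w {tree_root, to_nat [i]} \<le> w {to_nat [i], to_nat [i, j]}"
        using 2 i b[OF i] by auto
      then show ?thesis by (intro bexI[of _ "Suc j"]) (auto simp: leg_edge_def)
    qed
    then show ?thesis by blast
  qed
qed

lemma iid_weights_admissible: "admissible_weights \<omega> \<Longrightarrow> iid_weights \<omega>"
  by (simp add: iid_weights_def admissible_weights_def)

text \<open>The shape of the tree is independent of the weights.\<close>

lemma weighted_ubgw_outweighed:
  assumes adm: "admissible_weights \<omega>" and p: "prob_space (weighted_ubgw_law \<pi> \<omega>)" and d: "2 \<le> d"
  shows "measure (weighted_ubgw_law \<pi> \<omega>) (outweighed_roots d) \<le>
    measure (offspring_law \<pi>) (spider_offspring d) * (1 - 1 / real d) ^ d"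
proof -
  let ?I = "{e :: nat set. card e = 2}"
  interpret iid_weights \<omega> ?I by (rule iid_weights_admissible[OF adm])
  interpret O: prob_space "offspring_law \<pi>" by (rule prob_space_offspring_law)
  interpret Q: prob_space "weighted_ubgw_law \<pi> \<omega>" by (rule p)
  let ?f = "\<lambda>(N, w). abs_rooted (ulam_harris_tree N, w, [tree_root])"
  define B where "B = {w \<in> space W. (\<exists>i<d. \<exists>j<d. i \<noteq> j \<and> w (leg_edge i 0) = w (leg_edge j 0)) \<or>
      (\<forall>i<d. \<exists>k\<in>{1..<d}. w (leg_edge i 0) \<le> w (leg_edge i k))}"
  have inj: "inj_on (\<lambda>(i, k). leg_edge i k) ({..<d} \<times> {..<d})" by (auto simp: inj_on_def leg_edge_inj)
  have B: "B \<in> sets W" "P.prob B \<le> (1 - 1 / real d) ^ d"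
    unfolding B_def by (rule prob_outweighed[OF inj]; use d in \<open>simp add: card_leg_edge\<close>)+
  have sub: "?f -` outweighed_roots d \<inter> space (offspring_law \<pi> \<Otimes>\<^sub>M W) \<subseteq> spider_offspring d \<times> B"
  proof
    fix z assume z: "z \<in> ?f -` outweighed_roots d \<inter> space (offspring_law \<pi> \<Otimes>\<^sub>M W)"
    obtain N w where Nw: "z = (N, w)" by (cases z)
    have "outweighed_centre d (ulam_harris_tree N) w tree_root" "w \<in> space W"
      using z mem_rooted_set[OF iso_invariant_outweighed(1) rooted_graph_ulam_harris_tree]
      by (auto simp: Nw outweighed_roots_def space_pair_measure)
    then show "z \<in> spider_offspring d \<times> B"
      using outweighed_tree_root[of d N w] d unfolding Nw B_def mem_Times_iff by simp
  qed
  have "emeasure (weighted_ubgw_law \<pi> \<omega>) (outweighed_roots d) =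
      emeasure (offspring_law \<pi> \<Otimes>\<^sub>M W) (?f -` outweighed_roots d \<inter> space (offspring_law \<pi> \<Otimes>\<^sub>M W))"
    using p sets_outweighed_roots[OF d] unfolding weighted_ubgw_law_def
    by (rule emeasure_distr_prob_space)
  also have "\<dots> \<le> emeasure (offspring_law \<pi> \<Otimes>\<^sub>M W) (spider_offspring d \<times> B)"
    using B(1) sub by (intro emeasure_mono) auto
  also have "\<dots> = emeasure (offspring_law \<pi>) (spider_offspring d) * emeasure W B"
    using B(1) by (intro P.emeasure_pair_measure_Times) auto
  finally have "measure (weighted_ubgw_law \<pi> \<omega>) (outweighed_roots d) \<le>
      measure (offspring_law \<pi>) (spider_offspring d) * P.prob B"
    by (simp add: Q.emeasure_eq_measure O.emeasure_eq_measure P.emeasure_eq_measure ennreal_mult[symmetric])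
  also have "\<dots> \<le> measure (offspring_law \<pi>) (spider_offspring d) * (1 - 1 / real d) ^ d"
    by (intro mult_left_mono B) simp
  finally show ?thesis .
qed

text \<open>The expectation is the product of the mean degree of the root and the mean absolute weight.\<close>

lemma nn_integral_weighted_ubgw_edge_sum:
  assumes adm: "admissible_weights \<omega>" and p: "prob_space (weighted_ubgw_law \<pi> \<omega>)"
    and int: "integrable (measure_pmf \<pi>) real"
  shows "(\<integral>\<^sup>+ x. ennreal (edge_sum abs x) \<partial>weighted_ubgw_law \<pi> \<omega>) < \<infinity>"
proof -
  let ?I = "{e :: nat set. card e = 2}"
  interpret iid_weights \<omega> ?I by (rule iid_weights_admissible[OF adm])
  interpret O: prob_space "offspring_law \<pi>" by (rule prob_space_offspring_law)
  let ?M = "offspring_law \<pi> \<Otimes>\<^sub>M W"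
  let ?f = "\<lambda>(N, w). abs_rooted (ulam_harris_tree N, w, [tree_root])"
  have e: "leg_edge i k \<in> ?I" for i k by (simp add: card_leg_edge)
  define h where "h = (\<lambda>(N :: nat list \<Rightarrow> nat, w). \<Sum>i<N []. \<bar>w (leg_edge i 0)\<bar> :: real)"
  have gf: "edge_sum abs (?f z) = h z" for z
  proof (cases z)
    case (Pair N w)
    show ?thesis
      unfolding Pair h_def prod.case edge_sum_abs[OF rooted_graph_ulam_harris_tree]
      by (simp add: neighbours_tree_root sum.reindex inj_on_def leg_edge_def)
  qed
  have "(\<lambda>z. \<Sum>i<n. \<bar>snd z (leg_edge i 0)\<bar>) \<in> borel_measurable ?M" for n
    using measurable_weight[OF e] by measurable
  then have "(\<lambda>z. \<Sum>i<fst z []. \<bar>snd z (leg_edge i 0)\<bar>) \<in> borel_measurable ?M"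
    by (rule measurable_compose_countable) measurable
  then have h [measurable]: "h \<in> borel_measurable ?M" by (simp add: h_def split_def)
  have g: "(edge_sum abs :: real rooted \<Rightarrow> real) \<in> borel_measurable borel"
    by (intro borel_measurable_continuous_onI continuous_edge_sum continuous_intros)
  have "distr (weighted_ubgw_law \<pi> \<omega>) borel (edge_sum abs) = distr ?M borel (\<lambda>z. edge_sum abs (?f z))"
    unfolding weighted_ubgw_law_def
    using p g h by (intro distr_distr_prob_space) (auto simp: weighted_ubgw_law_def gf)
  then have eq: "distr (weighted_ubgw_law \<pi> \<omega>) borel (edge_sum abs) = distr ?M borel h" by (simp add: gf)
  have "(\<integral>\<^sup>+ x. ennreal (edge_sum abs x) \<partial>weighted_ubgw_law \<pi> \<omega>) =
      (\<integral>\<^sup>+ y. ennreal y \<partial>distr (weighted_ubgw_law \<pi> \<omega>) borel (edge_sum abs))"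
    using g by (subst nn_integral_distr) (auto simp: weighted_ubgw_law_def)
  also have "\<dots> = (\<integral>\<^sup>+ z. ennreal (h z) \<partial>?M)" unfolding eq by (subst nn_integral_distr) auto
  also have "\<dots> = (\<integral>\<^sup>+ N. \<integral>\<^sup>+ w. ennreal (h (N, w)) \<partial>W \<partial>offspring_law \<pi>)"
    by (rule P.nn_integral_fst[symmetric]) measurable
  also have "\<dots> = (\<integral>\<^sup>+ N. of_nat (N []) * (\<integral>\<^sup>+ x. ennreal \<bar>x\<bar> \<partial>\<omega>) \<partial>offspring_law \<pi>)"
  proof (rule nn_integral_cong)
    fix N :: "nat list \<Rightarrow> nat"
    have one: "(\<integral>\<^sup>+ w. ennreal \<bar>w (leg_edge i 0)\<bar> \<partial>W) = (\<integral>\<^sup>+ x. ennreal \<bar>x\<bar> \<partial>\<omega>)" for i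
      using measurable_weight[OF e]
      by (subst distr_weight[OF e[of i 0], symmetric], subst nn_integral_distr) auto
    have "(\<integral>\<^sup>+ w. ennreal (h (N, w)) \<partial>W) = (\<integral>\<^sup>+ w. (\<Sum>i<N []. ennreal \<bar>w (leg_edge i 0)\<bar>) \<partial>W)"
      by (simp add: h_def sum_ennreal)
    also have "\<dots> = (\<Sum>i<N []. \<integral>\<^sup>+ w. ennreal \<bar>w (leg_edge i 0)\<bar> \<partial>W)"
      using measurable_weight[OF e] by (intro nn_integral_sum) auto
    finally show "(\<integral>\<^sup>+ w. ennreal (h (N, w)) \<partial>W) = of_nat (N []) * (\<integral>\<^sup>+ x. ennreal \<bar>x\<bar> \<partial>\<omega>)"
      by (simp add: one)
  qed
  also have "\<dots> = (\<integral>\<^sup>+ N. ennreal (real (N [])) \<partial>offspring_law \<pi>) * (\<integral>\<^sup>+ x. ennreal \<bar>x\<bar> \<partial>\<omega>)"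
    using measurable_compose[OF measurable_offspring[of "[]" \<pi>], of real borel]
    by (subst nn_integral_multc[symmetric]) (auto simp: ennreal_of_nat_eq_real_of_nat)
  also have "(\<integral>\<^sup>+ N. ennreal (real (N [])) \<partial>offspring_law \<pi>) = (\<integral>\<^sup>+ n. ennreal (real n) \<partial>measure_pmf \<pi>)"
  proof -
    have "distr (offspring_law \<pi>) (measure_pmf \<pi>) (\<lambda>N. N []) = measure_pmf \<pi>"
      using distr_PiM_component[of UNIV "\<lambda>u. measure_pmf (if u = [] then \<pi> else hat_pmf \<pi>)" "[]"]
      by (simp add: offspring_law_def measure_pmf.prob_space_axioms)
    then have "(\<integral>\<^sup>+ n. ennreal (real n) \<partial>measure_pmf \<pi>) =
        (\<integral>\<^sup>+ n. ennreal (real n) \<partial>distr (offspring_law \<pi>) (measure_pmf \<pi>) (\<lambda>N. N []))" by simp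
    also have "\<dots> = (\<integral>\<^sup>+ N. ennreal (real (N [])) \<partial>offspring_law \<pi>)"
      using measurable_offspring[of "[]" \<pi>] by (intro nn_integral_distr) (auto cong: measurable_cong_sets)
    finally show ?thesis ..
  qed
  also have "\<dots> * (\<integral>\<^sup>+ x. ennreal \<bar>x\<bar> \<partial>\<omega>) < \<infinity>"
  proof -
    have "integrable \<omega> (\<lambda>x. x)" using adm by (simp add: admissible_weights_def)
    then have "(\<integral>\<^sup>+ x. ennreal \<bar>x\<bar> \<partial>\<omega>) < \<infinity>" by (simp add: integrable_iff_bounded)
    moreover have "(\<integral>\<^sup>+ n. ennreal (real n) \<partial>measure_pmf \<pi>) < \<infinity>"
      using int by (simp add: integrable_iff_bounded)
    ultimately show ?thesis by (simp add: ennreal_mult_less_top)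
  qed
  finally show ?thesis .
qed

text \<open>Matching weights of different laws can be compared only because of this: the integral of a
  function that is not integrable is \<open>0\<close> by convention.\<close>

lemma integrable_root_matched_weight:
  assumes adm: "admissible_weights \<omega>" and int: "integrable (measure_pmf \<pi>) real"
    and \<mu>: "unimodular_matching \<pi> \<omega> \<mu>"
  shows "integrable \<mu> root_matched_weight"
proof (rule integrableI_bounded)
  have sets [measurable_cong]: "sets \<mu> = sets borel" and p: "prob_space \<mu>"
    and w: "distr \<mu> borel (map_marks fst) = weighted_ubgw_law \<pi> \<omega>"
    using \<mu> by (auto simp: unimodular_matching_def borel_law_def)
  show "root_matched_weight \<in> borel_measurable \<mu>"
    using borel_measurable_matched_excess[of 0] sets
    by (simp add: root_matched_weight_edge_sum cong: measurable_cong_sets)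
  have f [measurable]: "map_marks fst \<in> borel \<rightarrow>\<^sub>M (borel :: real rooted measure)"
    by (intro measurable_map_marks continuous_on_fst continuous_on_id)
  have g [measurable]: "(edge_sum abs :: real rooted \<Rightarrow> real) \<in> borel_measurable borel"
    by (intro borel_measurable_continuous_onI continuous_edge_sum continuous_intros)
  have pw: "prob_space (weighted_ubgw_law \<pi> \<omega>)"
    unfolding w[symmetric] using f by (intro prob_space.prob_space_distr p) measurable
  have "norm (root_matched_weight x) \<le> edge_sum abs (map_marks fst x)" for x
  proof -
    obtain G m rs where x: "x = abs_rooted (G, m, rs)" and G: "rooted_graph G rs" by (rule rooted_cases)
    show ?thesis
      unfolding x root_matched_weight_abs[OF G] map_marks_abs[OF G] edge_sum_abs[OF G] real_norm_def
      by (rule order_trans[OF sum_abs]) (auto intro!: sum_mono)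
  qed
  then have "(\<integral>\<^sup>+ x. ennreal (norm (root_matched_weight x)) \<partial>\<mu>) \<le>
      (\<integral>\<^sup>+ x. ennreal (edge_sum abs (map_marks fst x)) \<partial>\<mu>)"
    by (intro nn_integral_mono ennreal_leI)
  also have "\<dots> = (\<integral>\<^sup>+ x. ennreal (edge_sum abs x) \<partial>weighted_ubgw_law \<pi> \<omega>)"
    unfolding w[symmetric] by (rule nn_integral_distr[symmetric]) measurable
  also have "\<dots> < \<infinity>" by (rule nn_integral_weighted_ubgw_edge_sum[OF adm pw int])
  finally show "(\<integral>\<^sup>+ x. ennreal (norm (root_matched_weight x)) \<partial>\<mu>) < \<infinity>" .
qed

text \<open>By optimality, an unmatched centre is outweighed almost surely, and this is an event of the
  weighted tree alone.\<close>

lemma optimal_matching_unmatched_centre_le: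
  assumes adm: "admissible_weights \<omega>" and int: "integrable (measure_pmf \<pi>) real"
    and opt: "optimal_matching \<pi> \<omega> \<mu>" and d: "2 \<le> d"
  shows "measure (distr \<mu> borel (map_marks snd)) (unmatched_centre_roots d) \<le>
    measure (offspring_law \<pi>) (spider_offspring d) * (1 - 1 / real d) ^ d"
proof -
  have um: "unimodular_matching \<pi> \<omega> \<mu>" using opt by (simp add: optimal_matching_def)
  have sets [measurable_cong]: "sets \<mu> = sets borel" and p: "prob_space \<mu>"
    and w: "distr \<mu> borel (map_marks fst) = weighted_ubgw_law \<pi> \<omega>"
    using um by (auto simp: unimodular_matching_def borel_law_def)
  interpret prob_space \<mu> by (rule p)
  have f [measurable]: "map_marks fst \<in> borel \<rightarrow>\<^sub>M (borel :: real rooted measure)"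
    "map_marks snd \<in> borel \<rightarrow>\<^sub>M (borel :: bool rooted measure)"
    by (intro measurable_map_marks continuous_on_fst continuous_on_snd continuous_on_id)+
  have A [measurable]: "unmatched_centre_roots d \<in> sets borel"
    by (intro borel_open clopen_unmatched_centre_roots)
  note [measurable] = sets_outweighed_roots[OF d]
  have pw: "prob_space (weighted_ubgw_law \<pi> \<omega>)"
    unfolding w[symmetric] by (intro prob_space_distr) measurable
  have "measure (distr \<mu> borel (map_marks snd)) (unmatched_centre_roots d) =
      prob (map_marks snd -` unmatched_centre_roots d \<inter> space \<mu>)"
    by (rule measure_distr) measurable
  also have "\<dots> \<le> prob (map_marks fst -` outweighed_roots d \<inter> space \<mu>)"
    using optimal_unmatched_centre[OF d opt integrable_root_matched_weight[OF adm int]]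
    by (intro finite_measure_mono_AE) auto
  also have "\<dots> = measure (weighted_ubgw_law \<pi> \<omega>) (outweighed_roots d)"
    unfolding w[symmetric] by (rule measure_distr[symmetric]) measurable
  also have "\<dots> \<le> measure (offspring_law \<pi>) (spider_offspring d) * (1 - 1 / real d) ^ d"
    by (rule weighted_ubgw_outweighed[OF adm pw d])
  finally show ?thesis .
qed

section \<open>Uniform maximum matchings\<close>

lemma finite_graph_finite_edges: "finite_graph G \<Longrightarrow> finite (edges G)"
  by (rule finite_subset[of _ "Pow (verts G)"]) (auto simp: finite_graph_def simple_graph_def)

lemma maximum_matchings_finite_nonempty:
  assumes "finite_graph G"
  shows "finite (maximum_matchings G)" "maximum_matchings G \<noteq> {}"
proof -
  have fin: "finite {M. is_matching G M}"
    by (rule finite_subset[of _ "Pow (edges G)"])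
       (use finite_graph_finite_edges[OF assms] in \<open>auto simp: is_matching_def\<close>)
  then show "finite (maximum_matchings G)"
    by (rule finite_subset[rotated]) (auto simp: maximum_matchings_def)
  have ne: "{M. is_matching G M} \<noteq> {}" by (auto simp: is_matching_def intro: exI[of _ "{}"])
  have "Max (card ` {M. is_matching G M}) \<in> card ` {M. is_matching G M}"
    using fin ne by (intro Max_in) auto
  then obtain M where M: "is_matching G M" "card M = Max (card ` {M. is_matching G M})" by auto
  have "card M' \<le> card M" if "is_matching G M'" for M'
    unfolding M(2) using fin that by (intro Max_ge) auto
  then have "M \<in> maximum_matchings G" using M(1) by (simp add: maximum_matchings_def)
  then show "maximum_matchings G \<noteq> {}" by blast
qed

text \<open>If a maximum matching leaves the centre unmatched then it covers the neighbours of the centre,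
  since otherwise an edge could be added.\<close>

lemma maximum_matching_unmatched_centre:
  assumes G: "finite_graph G" and sp: "spider d G c" and M: "M \<in> maximum_matchings G"
    and c: "\<forall>b\<in>neighbours G c. {c, b} \<notin> M"
  shows "unmatched_centre d G (\<lambda>e. e \<in> M) c"
  unfolding unmatched_centre_def
proof (intro conjI ballI sp)
  fix b assume b: "b \<in> neighbours G c"
  show "{c, b} \<notin> M" using b c by blast
  have s: "simple_graph G" using G by (simp add: finite_graph_def)
  have ME: "M \<subseteq> edges G" and pw: "pairwise disjnt M" and max: "\<And>M'. is_matching G M' \<Longrightarrow> card M' \<le> card M"
    using M by (auto simp: maximum_matchings_def is_matching_def)
  show "\<exists>l\<in>neighbours G b. {b, l} \<in> M"
  proof (rule ccontr)
    assume no: "\<not> (\<exists>l\<in>neighbours G b. {b, l} \<in> M)"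
    have "disjnt {c, b} e" if e: "e \<in> M" for e
    proof -
      obtain u v where uv: "e = {u, v}" "v \<in> neighbours G u" using edgeE[OF s] e ME by blast
      then have "e = {v, u}" "u \<in> neighbours G v" using neighbours_sym by auto
      with uv have "c \<notin> e" "b \<notin> e" using c no e by auto
      then show ?thesis by (auto simp: disjnt_def)
    qed
    then have "is_matching G (insert {c, b} M)"
      using ME pw b by (auto simp: is_matching_def pairwise_insert edge_neighbour disjnt_sym)
    from max[OF this] show False
      using \<open>{c, b} \<notin> M\<close> finite_subset[OF ME finite_graph_finite_edges[OF G]] by simp
  qed
qed

text \<open>A maximum matching that uses the edge from the centre to \<open>b\<close> may instead use the edge from
  \<open>b\<close> to any of its \<open>d - 1\<close> leaves.  So for each of the \<open>d\<close> neighbours \<open>b\<close> there are at most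
  \<open>1 / (d - 1)\<close> times as many such matchings as there are matchings that avoid the centre.\<close>

lemma card_unmatched_centre:
  assumes G: "finite_graph G" and sp: "spider d G c" and d: "2 \<le> d"
  defines "X \<equiv> {M \<in> maximum_matchings G. unmatched_centre d G (\<lambda>e. e \<in> M) c}"
  shows "(d - 1) * card (maximum_matchings G) \<le> (2 * d - 1) * card X"
proof -
  have s: "simple_graph G" using G by (simp add: finite_graph_def)
  define Y where "Y b = {M \<in> maximum_matchings G. {c, b} \<in> M}" for b
  have finM: "finite (maximum_matchings G)" by (rule maximum_matchings_finite_nonempty[OF G])
  have leg: "(d - 1) * card (Y b) \<le> card X" if b: "b \<in> neighbours G c" for b
  proof -
    let ?f = "\<lambda>(M, l). insert {b, l} (M - {{c, b}})"
    have cb: "c \<noteq> b" "c \<in> neighbours G b" using b not_self_neighbour[OF s] neighbours_sym by auto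
    have card: "card (neighbours G b - {c}) = d - 1"
      using cb(2) spider_card_neighbour[OF sp b] by simp
    have away: "c \<notin> e" "b \<notin> e" if "M \<in> Y b" "e \<in> M - {{c, b}}" for M e
    proof -
      have "pairwise disjnt M" "{c, b} \<in> M"
        using that by (auto simp: Y_def maximum_matchings_def is_matching_def)
      then have "disjnt {c, b} e" using that(2) pairwiseD(1) by fastforce
      then show "c \<notin> e" "b \<notin> e" by auto
    qed
    have "?f z \<in> X" if z: "z \<in> Y b \<times> (neighbours G b - {c})" for z
    proof -
      obtain M l where Ml: "z = (M, l)" "M \<in> Y b" "l \<in> neighbours G b" "l \<noteq> c" using z by auto
      have M: "M \<in> maximum_matchings G" "{c, b} \<in> M" using Ml(2) by (auto simp: Y_def)
      then have ME: "M \<subseteq> edges G" and pw: "pairwise disjnt M"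
        by (auto simp: maximum_matchings_def is_matching_def)
      have fM: "finite M" using ME finite_graph_finite_edges[OF G] finite_subset by blast
      have "l \<notin> e" if e: "e \<in> M - {{c, b}}" for e
      proof
        assume "l \<in> e"
        moreover obtain u v where "e = {u, v}" "v \<in> neighbours G u" using edgeE[OF s] e ME by blast
        ultimately obtain x where "e = {l, x}" "x \<in> neighbours G l"
          using neighbours_sym[of v G u] by (auto simp: insert_commute)
        then have "b \<in> e" using spider_leaf[OF sp b Ml(3,4)] by auto
        then show False using away(2)[OF Ml(2) e] by blast
      qed
      then have dis: "\<forall>e\<in>M - {{c, b}}. disjnt {b, l} e" using away(2)[OF Ml(2)] by (auto simp: disjnt_def)
      have "pairwise disjnt (M - {{c, b}})" using pw by (rule pairwise_subset) auto
      then have "is_matching G (?f z)"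
        using ME dis Ml by (auto simp: is_matching_def pairwise_insert edge_neighbour disjnt_sym)
      moreover have "card (?f z) = card M"
      proof -
        have "{b, l} \<notin> M - {{c, b}}" using away(2)[OF Ml(2)] by blast
        then have "card (insert {b, l} (M - {{c, b}})) = Suc (card (M - {{c, b}}))"
          using fM by (intro card_insert_disjoint) auto
        also have "\<dots> = card M" by (rule card_Suc_Diff1[OF fM M(2)])
        finally show ?thesis by (simp only: Ml(1) prod.case)
      qed
      ultimately have max: "?f z \<in> maximum_matchings G" using M(1) by (auto simp: maximum_matchings_def)
      have "{c, b'} \<notin> ?f z" for b'
        using away(1)[OF Ml(2), of "{c, b'}"] Ml cb(1) by (auto simp: doubleton_eq_iff)
      then have "unmatched_centre d G (\<lambda>e. e \<in> ?f z) c"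
        by (intro maximum_matching_unmatched_centre[OF G sp max]) blast
      with max show ?thesis by (simp add: X_def)
    qed
    then have "?f ` (Y b \<times> (neighbours G b - {c})) \<subseteq> X" by blast
    moreover have "inj_on ?f (Y b \<times> (neighbours G b - {c}))"
    proof (rule inj_onI)
      fix z z' assume zz': "z \<in> Y b \<times> (neighbours G b - {c})" "z' \<in> Y b \<times> (neighbours G b - {c})" "?f z = ?f z'"
      obtain M l M' l' where Ml: "z = (M, l)" "z' = (M', l')" by (cases z, cases z')
      with zz' have *: "M \<in> Y b" "M' \<in> Y b" "l \<noteq> c" "l' \<noteq> c"
        "insert {b, l} (M - {{c, b}}) = insert {b, l'} (M' - {{c, b}})"
        by auto
      have no: "{b, x} \<notin> N - {{c, b}}" if "N \<in> Y b" for N x using away(2)[OF that] by blast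
      have "{b, l} = {b, l'}" using *(5) no[OF *(2), of l] by blast
      then have l: "l = l'" by (auto simp: doubleton_eq_iff)
      have "M - {{c, b}} = M' - {{c, b}}"
        using *(5) insert_ident[OF no[OF *(1)] no[OF *(2)]] unfolding l by simp
      moreover have "{c, b} \<in> M" "{c, b} \<in> M'" using *(1,2) by (auto simp: Y_def)
      ultimately have "M = M'" using insert_Diff by metis
      with l show "z = z'" by (simp add: Ml)
    qed
    ultimately have "card (Y b \<times> (neighbours G b - {c})) \<le> card X"
      using finM by (intro card_inj_on_le[of ?f]) (auto simp: X_def)
    then show ?thesis by (simp add: card_cartesian_product card mult.commute)
  qed
  have "maximum_matchings G \<subseteq> X \<union> (\<Union>b\<in>neighbours G c. Y b)"
    using maximum_matching_unmatched_centre[OF G sp] by (auto simp: X_def Y_def)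
  moreover have fin: "finite (neighbours G c)"
    using spider_card[OF sp] d by (intro card_ge_0_finite) simp
  ultimately have "card (maximum_matchings G) \<le> card (X \<union> (\<Union>b\<in>neighbours G c. Y b))"
    using finM by (intro card_mono) (auto simp: X_def Y_def)
  also have "\<dots> \<le> card X + (\<Sum>b\<in>neighbours G c. card (Y b))"
    using card_Un_le[of X "\<Union>b\<in>neighbours G c. Y b"] card_UN_le[OF fin, of Y] by linarith
  finally have "(d - 1) * card (maximum_matchings G) \<le>
      (d - 1) * (card X + (\<Sum>b\<in>neighbours G c. card (Y b)))"
    by (rule mult_le_mono2)
  also have "\<dots> = (d - 1) * card X + (\<Sum>b\<in>neighbours G c. (d - 1) * card (Y b))"
    by (simp add: distrib_left sum_distrib_left)
  also have "\<dots> \<le> (d - 1) * card X + (\<Sum>b\<in>neighbours G c. card X)"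
    by (intro add_left_mono sum_mono leg)
  also have "\<dots> = (2 * d - 1) * card X"
    using d spider_card[OF sp] by (simp add: algebra_simps diff_mult_distrib)
  finally show ?thesis .
qed

lemma prob_unmatched_centre:
  assumes G: "finite_graph G" and sp: "spider d G c" and d: "2 \<le> d"
  shows "(real d - 1) / (2 * real d - 1) \<le>
    measure_pmf.prob (pmf_of_set (maximum_matchings G)) {M. unmatched_centre d G (\<lambda>e. e \<in> M) c}"
proof -
  let ?MM = "maximum_matchings G"
  have fin: "finite ?MM" "?MM \<noteq> {}" by (rule maximum_matchings_finite_nonempty[OF G])+
  have "real ((d - 1) * card ?MM) \<le> real ((2 * d - 1) * card {M \<in> ?MM. unmatched_centre d G (\<lambda>e. e \<in> M) c})"
    using card_unmatched_centre[OF G sp d] by (rule of_nat_mono)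
  moreover have "{M \<in> ?MM. unmatched_centre d G (\<lambda>e. e \<in> M) c} = ?MM \<inter> {M. unmatched_centre d G (\<lambda>e. e \<in> M) c}"
    by blast
  ultimately have "(real d - 1) * card ?MM \<le> (2 * real d - 1) * card (?MM \<inter> {M. unmatched_centre d G (\<lambda>e. e \<in> M) c})"
    using d by (simp add: of_nat_diff)
  moreover have "real (card ?MM) > 0" using fin by (simp add: card_gt_0_iff)
  ultimately show ?thesis using fin d by (simp add: measure_pmf_of_set field_simps)
qed

lemma graph_component_simps:
  "verts (graph_component G v) = verts G \<inter> {u. (v, u) \<in> (adj_rel G)\<^sup>*}"
  "edges (graph_component G v) = {e \<in> edges G. e \<subseteq> {u. (v, u) \<in> (adj_rel G)\<^sup>*}}"
  by (simp_all add: graph_component_def induced_subgraph_def)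

lemma neighbours_graph_component:
  assumes "(v, u) \<in> (adj_rel G)\<^sup>*" shows "neighbours (graph_component G v) u = neighbours G u"
proof -
  have "(v, w) \<in> (adj_rel G)\<^sup>*" if "{u, w} \<in> edges G" for w
    using assms that by (auto simp: adj_rel_def intro: rtrancl_into_rtrancl)
  then show ?thesis using assms by (auto simp: neighbours_def graph_component_simps)
qed

lemma rooted_graph_component:
  assumes G: "finite_graph G" and v: "v \<in> verts G"
  shows "rooted_graph (graph_component G v) [v]"
proof -
  let ?H = "graph_component G v"
  have s: "simple_graph G" and fin: "finite (verts G)" using G by (auto simp: finite_graph_def)
  have "simple_graph ?H" using s by (auto simp: simple_graph_def graph_component_simps)
  moreover have "locally_finite_graph ?H"
    unfolding locally_finite_graph_def
  proof
    fix u
    have "neighbours ?H u \<subseteq> verts G"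
      using neighbours_subset_verts[OF s, of u] by (auto simp: neighbours_def graph_component_simps)
    then show "finite (neighbours ?H u)" using fin finite_subset by blast
  qed
  moreover have "connected_graph ?H"
  proof -
    have reach: "(v, u) \<in> (adj_rel ?H)\<^sup>*" if "(v, u) \<in> (adj_rel G)\<^sup>*" for u
      using that
    proof (induction rule: rtrancl_induct)
      case (step u w)
      then have "w \<in> neighbours ?H u"
        using neighbours_graph_component[OF step(1)] by (simp add: adj_rel_def neighbours_def)
      then have "(u, w) \<in> adj_rel ?H" by (simp add: adj_rel_def neighbours_def)
      then show ?case using step(3) by simp
    qed simp
    then show ?thesis by (intro connected_graphI[of _ v]) (simp add: graph_component_simps)
  qed
  moreover have "v \<in> verts ?H" using v by (simp add: graph_component_simps)
  ultimately show ?thesis by (simp add: rooted_graph_def)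
qed

lemma spider_graph_component: "spider d (graph_component G v) v \<longleftrightarrow> spider d G v"
proof -
  have "(v, b) \<in> (adj_rel G)\<^sup>*" if "b \<in> neighbours G v" for b
    using that by (auto simp: adj_rel_def neighbours_def)
  moreover from this have "(v, l) \<in> (adj_rel G)\<^sup>*" if "b \<in> neighbours G v" "l \<in> neighbours G b" for b l
    using that by (auto simp: adj_rel_def neighbours_def intro: rtrancl_into_rtrancl)
  ultimately have "neighbours (graph_component G v) u = neighbours G u" if "u \<in> within_two G v" for u
    using that neighbours_graph_component by (auto simp: within_two_def)
  then have "spider d (graph_component G v) (id v) \<longleftrightarrow> spider d G v"
    by (intro spider_transport) (auto simp: bij_betw_def)
  then show ?thesis by simp
qed

lemma unmatched_centre_graph_component:
  "unmatched_centre d (graph_component G v) m v \<longleftrightarrow> unmatched_centre d G m v"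
proof -
  have "neighbours (graph_component G v) b = neighbours G b" if "b \<in> neighbours G v" for b
    using that by (intro neighbours_graph_component) (auto simp: adj_rel_def neighbours_def)
  then show ?thesis
    using neighbours_graph_component[of v v G]
    by (auto simp: unmatched_centre_def spider_graph_component)
qed

lemma emeasure_uniform_root_law:
  assumes "B \<in> sets borel"
  shows "emeasure (uniform_root_law p) B = (\<integral>\<^sup>+ z. emeasure (measure_pmf (pmf_of_set (verts (fst z))))
      {v. abs_rooted (graph_component (fst z) v, snd z, [v]) \<in> B} \<partial>measure_pmf p)"
  unfolding uniform_root_law_def using assms
  by (subst emeasure_distr) (auto simp: emeasure_bind_pmf emeasure_map_pmf split_def vimage_def)

lemma uniform_root_law_spider:
  assumes G: "\<forall>G\<in>set_pmf p. finite_graph G"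
  shows "emeasure (uniform_root_law (map_pmf (\<lambda>G. (G, \<lambda>_. ())) p)) (spider_roots d) =
    (\<integral>\<^sup>+ G. emeasure (measure_pmf (pmf_of_set (verts G))) {v. spider d G v} \<partial>measure_pmf p)"
proof -
  have "emeasure (uniform_root_law (map_pmf (\<lambda>G. (G, \<lambda>_. ())) p)) (spider_roots d) =
      (\<integral>\<^sup>+ G. emeasure (measure_pmf (pmf_of_set (verts G)))
        {v. abs_rooted (graph_component G v, \<lambda>_. (), [v]) \<in> spider_roots d} \<partial>measure_pmf p)"
    by (subst emeasure_uniform_root_law) (auto intro: borel_open clopen_spider_roots)
  also have "\<dots> = (\<integral>\<^sup>+ G. emeasure (measure_pmf (pmf_of_set (verts G))) {v. spider d G v} \<partial>measure_pmf p)"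
  proof (intro nn_integral_cong_AE AE_pmfI emeasure_eq_AE)
    fix G v assume "G \<in> set_pmf p" "v \<in> set_pmf (pmf_of_set (verts G))"
    then have "finite_graph G" "v \<in> verts G" using G by (auto simp: finite_graph_def)
    from rooted_graph_component[OF this]
    show "(v \<in> {v. abs_rooted (graph_component G v, \<lambda>_. (), [v]) \<in> spider_roots d}) = (v \<in> {v. spider d G v})"
      by (simp add: spider_roots_def mem_rooted_set[OF iso_invariant_spider] spider_graph_component)
  qed auto
  finally show ?thesis .
qed

text \<open>The root and the matching are chosen independently given the graph, so the root may be chosen
  first.\<close>

lemma uniform_root_law_unmatched_centre:
  assumes G: "\<forall>G\<in>set_pmf p. finite_graph G" and d: "2 \<le> d"
  shows "ennreal ((real d - 1) / (2 * real d - 1)) *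
      emeasure (uniform_root_law (map_pmf (\<lambda>G. (G, \<lambda>_. ())) p)) (spider_roots d) \<le>
    emeasure (uniform_root_law (uniform_maximum_matching p)) (unmatched_centre_roots d)"
proof -
  let ?k = "ennreal ((real d - 1) / (2 * real d - 1))"
  let ?V = "\<lambda>G. pmf_of_set (verts G)" and ?M = "\<lambda>G. pmf_of_set (maximum_matchings G)"
  let ?S = "\<lambda>G M. {v. abs_rooted (graph_component G v, \<lambda>e. e \<in> M, [v]) \<in> unmatched_centre_roots d}"
  have "?k * emeasure (measure_pmf (?V G)) {v. spider d G v} \<le>
      (\<integral>\<^sup>+ M. emeasure (measure_pmf (?V G)) (?S G M) \<partial>measure_pmf (?M G))"
    if "G \<in> set_pmf p" for G
  proof -
    have fG: "finite_graph G" using G that by blast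
    then have fin: "finite (verts G)" "verts G \<noteq> {}" by (auto simp: finite_graph_def)
    have "?k * emeasure (measure_pmf (?V G)) {v. spider d G v} =
        (\<integral>\<^sup>+ v. ?k * indicator {v. spider d G v} v \<partial>measure_pmf (?V G))"
      by (simp add: nn_integral_cmult)
    also have "\<dots> \<le> (\<integral>\<^sup>+ v. emeasure (measure_pmf (?M G)) {M. v \<in> ?S G M} \<partial>measure_pmf (?V G))"
    proof (intro nn_integral_mono_AE AE_pmfI)
      fix v assume "v \<in> set_pmf (?V G)"
      then have v: "v \<in> verts G" using fin by simp
      have eq: "v \<in> ?S G M \<longleftrightarrow> unmatched_centre d G (\<lambda>e. e \<in> M) v" for M
        by (simp add: unmatched_centre_roots_def unmatched_centre_graph_component
            mem_rooted_set[OF clopen_unmatched_centre_roots(1) rooted_graph_component[OF fG v]])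
      show "?k * indicator {v. spider d G v} v \<le> emeasure (measure_pmf (?M G)) {M. v \<in> ?S G M}"
        unfolding eq using prob_unmatched_centre[OF fG _ d, of v]
        by (auto simp: indicator_def measure_pmf.emeasure_eq_measure intro: ennreal_leI)
    qed
    also have "\<dots> = emeasure (bind_pmf (?V G) (\<lambda>v. map_pmf (\<lambda>M. (v, M)) (?M G))) {(v, M). v \<in> ?S G M}"
      by (simp add: emeasure_bind_pmf emeasure_map_pmf vimage_def)
    also have "bind_pmf (?V G) (\<lambda>v. map_pmf (\<lambda>M. (v, M)) (?M G)) =
        bind_pmf (?M G) (\<lambda>M. map_pmf (\<lambda>v. (v, M)) (?V G))"
      unfolding map_pmf_def by (rule bind_commute_pmf)
    also have "emeasure \<dots> {(v, M). v \<in> ?S G M} =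
        (\<integral>\<^sup>+ M. emeasure (measure_pmf (?V G)) (?S G M) \<partial>measure_pmf (?M G))"
      by (simp add: emeasure_bind_pmf emeasure_map_pmf vimage_def)
    finally show ?thesis .
  qed
  then have "(\<integral>\<^sup>+ G. ?k * emeasure (measure_pmf (?V G)) {v. spider d G v} \<partial>measure_pmf p) \<le>
      (\<integral>\<^sup>+ G. \<integral>\<^sup>+ M. emeasure (measure_pmf (?V G)) (?S G M) \<partial>measure_pmf (?M G) \<partial>measure_pmf p)"
    by (intro nn_integral_mono_AE AE_pmfI)
  then show ?thesis
    unfolding uniform_root_law_spider[OF G] uniform_maximum_matching_def
    by (subst emeasure_uniform_root_law)
       (simp_all add: nn_integral_cmult nn_integral_bind_pmf nn_integral_map_pmf
         borel_open clopen_unmatched_centre_roots)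
qed

lemma continuous_indicator_clopen:
  fixes S :: "'a::topological_space set"
  assumes "open S" "closed S" shows "continuous_on UNIV (indicator S :: 'a \<Rightarrow> real)"
proof (rule continuous_on_UNIV_I)
  fix Q :: "real set"
  have "indicator S -` Q = (if 1 \<in> Q then S else {}) \<union> (if 0 \<in> Q then - S else {})"
  proof (rule set_eqI)
    fix x
    show "x \<in> indicator S -` Q \<longleftrightarrow> x \<in> (if 1 \<in> Q then S else {}) \<union> (if 0 \<in> Q then - S else {})"
      by (cases "x \<in> S") auto
  qed
  then show "open (indicator S -` Q)" using assms by (auto simp: open_Compl)
qed

lemma converges_in_law_clopen:
  fixes S :: "'a::topological_space set"
  assumes conv: "converges_in_law \<mu>s \<mu>" and S: "open S" "closed S"
  shows "(\<lambda>n. measure (\<mu>s n) S) \<longlonglongrightarrow> measure \<mu> S"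
proof -
  have "bounded (range (indicator S :: 'a \<Rightarrow> real))"
    by (rule bounded_subset[of "{0, 1}"]) (auto simp: indicator_def)
  moreover have "\<forall>f :: 'a \<Rightarrow> real. continuous_on UNIV f \<and> bounded (range f) \<longrightarrow>
      (\<lambda>n. \<integral>x. f x \<partial>\<mu>s n) \<longlonglongrightarrow> (\<integral>x. f x \<partial>\<mu>)"
    using conv unfolding converges_in_law_def by (elim conjE)
  ultimately have "(\<lambda>n. \<integral>x. indicator S x \<partial>\<mu>s n) \<longlonglongrightarrow> (\<integral>x. indicator S x \<partial>\<mu> :: real)"
    using continuous_indicator_clopen[OF S] by blast
  moreover have "space M = UNIV" if "borel_law M" for M :: "'a measure"
    using that sets_eq_imp_space_eq[of M borel] by (simp add: borel_law_def)
  then have "space (\<mu>s n) = UNIV" "space \<mu> = UNIV" for n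
    using conv unfolding converges_in_law_def by simp_all
  ultimately show ?thesis by simp
qed

text \<open>The bound for finite graphs passes to the limit on both sides, since the two events are open and
  closed.\<close>

lemma uniform_limit_unmatched_centre_ge:
  assumes d: "2 \<le> d" and fin: "\<forall>n. \<forall>G\<in>set_pmf (Gs n). finite_graph G"
    and conv: "BS_converges (\<lambda>n. map_pmf (\<lambda>G. (G, \<lambda>_. ())) (Gs n)) (ubgw_law \<pi>)"
    and s: "strict_mono s" and lim: "BS_converges (\<lambda>n. uniform_maximum_matching (Gs (s n))) \<mu>"
  shows "measure (offspring_law \<pi>) (spider_offspring d) * ((real d - 1) / (2 * real d - 1)) \<le>
    measure \<mu> (unmatched_centre_roots d)"
proof -
  let ?k = "(real d - 1) / (2 * real d - 1)"
  let ?U = "\<lambda>n. uniform_root_law (map_pmf (\<lambda>G. (G, \<lambda>_. ())) (Gs n)) :: unit rooted measure"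
  let ?M = "\<lambda>n. uniform_root_law (uniform_maximum_matching (Gs (s n)))"
  have pU: "prob_space (?U n)" "prob_space (?M n)" for n
    using conv lim by (auto simp: BS_converges_def converges_in_law_def borel_law_def)
  have "prob_space (ubgw_law \<pi>)"
    using conv by (auto simp: BS_converges_def converges_in_law_def borel_law_def)
  then have "(\<lambda>n. measure (?U n) (spider_roots d)) \<longlonglongrightarrow> measure (offspring_law \<pi>) (spider_offspring d)"
    using converges_in_law_clopen[OF conv[unfolded BS_converges_def] clopen_spider_roots, of d] d
      ubgw_spider_roots[of \<pi> d] by (simp only: order_trans[OF one_le_numeral])
  from LIMSEQ_subseq_LIMSEQ[OF this s]
  have 1: "(\<lambda>n. measure (?U (s n)) (spider_roots d) * ?k) \<longlonglongrightarrow>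
      measure (offspring_law \<pi>) (spider_offspring d) * ?k"
    by (intro tendsto_mult_right) (simp only: comp_def)
  have 2: "(\<lambda>n. measure (?M n) (unmatched_centre_roots d)) \<longlonglongrightarrow> measure \<mu> (unmatched_centre_roots d)"
    using lim unfolding BS_converges_def
    by (rule converges_in_law_clopen) (rule clopen_unmatched_centre_roots)+
  have "measure (?U (s n)) (spider_roots d) * ?k \<le> measure (?M n) (unmatched_centre_roots d)" for n
  proof -
    interpret U: prob_space "?U (s n)" by (rule pU)
    interpret M: prob_space "?M n" by (rule pU)
    have "ennreal ?k * ennreal (measure (?U (s n)) (spider_roots d)) \<le>
        ennreal (measure (?M n) (unmatched_centre_roots d))"
      using uniform_root_law_unmatched_centre[of "Gs (s n)" d] fin d
      by (simp add: U.emeasure_eq_measure M.emeasure_eq_measure)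
    then show ?thesis using d by (simp add: ennreal_mult[symmetric] mult.commute)
  qed
  then show ?thesis by (intro LIMSEQ_le[OF 1 2]) auto
qed

section \<open>The size-biased offspring law\<close>

context
  fixes \<pi> :: "nat pmf"
  assumes int: "integrable (measure_pmf \<pi>) real"
    and pos: "0 < measure_pmf.expectation \<pi> real"
begin

lemma summable_mean: "summable (\<lambda>k. pmf \<pi> k * real k)"
proof -
  have "(\<integral>\<^sup>+ k. ennreal (real k) \<partial>measure_pmf \<pi>) < \<infinity>"
    using int by (simp add: integrable_iff_bounded)
  also have "(\<integral>\<^sup>+ k. ennreal (real k) \<partial>measure_pmf \<pi>) = (\<Sum>k. ennreal (pmf \<pi> k * real k))"
    by (simp add: nn_integral_measure_pmf nn_integral_count_space_nat ennreal_mult)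
  finally show ?thesis by (intro summable_suminf_not_top) auto
qed

text \<open>The series of derivatives converges uniformly on the closed unit interval, so it may be
  differentiated term by term up to the end point.\<close>

lemma gen_fun_deriv_1: "gen_fun_deriv \<pi> 1 = (\<Sum>k. pmf \<pi> k * real k)"
proof -
  let ?f = "\<lambda>k t. pmf \<pi> k * t ^ k" and ?f' = "\<lambda>k t. pmf \<pi> k * (real k * t ^ (k - 1))"
  have "uniform_limit {0..1} (\<lambda>n t. \<Sum>k<n. ?f' k t) (\<lambda>t. \<Sum>k. ?f' k t) sequentially"
  proof (rule Weierstrass_m_test[OF _ summable_mean])
    fix k and t :: real assume "t \<in> {0..1}"
    then have "t ^ (k - 1) \<le> 1" "0 \<le> t ^ (k - 1)" by (auto intro: power_le_one)
    then show "norm (?f' k t) \<le> pmf \<pi> k * real k"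
      using mult_left_le[of "t ^ (k - 1)" "real k"] by (auto simp: abs_mult intro!: mult_left_mono)
  qed
  moreover have "(?f k has_field_derivative ?f' k t) (at t within {0..1})" for k t
    by (auto intro!: derivative_eq_intros)
  moreover have "summable (\<lambda>k. ?f k 0)"
    by (rule summable_finite[of "{0}"]) auto
  ultimately have "\<exists>g. \<forall>t\<in>{0..1}. (\<lambda>k. ?f k t) sums g t \<and>
      (g has_field_derivative (\<Sum>k. ?f' k t)) (at t within {0..1})"
    by (intro has_field_derivative_series[of "{0..1}" ?f ?f' "\<lambda>t. \<Sum>k. ?f' k t" 0]) auto
  then obtain g where g: "\<And>t. t \<in> {0..1} \<Longrightarrow> (\<lambda>k. ?f k t) sums g t"
    "\<And>t. t \<in> {0..1} \<Longrightarrow> (g has_field_derivative (\<Sum>k. ?f' k t)) (at t within {0..1})"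
    by blast
  have "gen_fun \<pi> t = g t" if "t \<in> {0..1}" for t
    using g(1)[OF that] by (simp add: gen_fun_def sums_iff)
  then have "(gen_fun \<pi> has_field_derivative (\<Sum>k. ?f' k 1)) (at 1 within {0..1})"
    unfolding has_field_derivative_def
    by (intro has_derivative_transform[OF _ _ g(2)[unfolded has_field_derivative_def]]) auto
  then have "(gen_fun \<pi> has_vector_derivative (\<Sum>k. ?f' k 1)) (at 1 within {0..1})"
    by (simp add: has_real_derivative_iff_has_vector_derivative)
  then show ?thesis
    unfolding gen_fun_deriv_def by (subst vector_derivative_within_closed_interval) auto
qed

lemma gen_fun_deriv_1_pos: "0 < gen_fun_deriv \<pi> 1"
proof -
  have "\<exists>k\<in>set_pmf \<pi>. k \<noteq> 0"
  proof (rule ccontr)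
    assume "\<not> ?thesis"
    then have "measure_pmf.expectation \<pi> real = measure_pmf.expectation \<pi> (\<lambda>_. 0)"
      by (intro integral_cong_AE AE_pmfI) auto
    then show False using pos by simp
  qed
  then obtain k where "k \<in> set_pmf \<pi>" "k \<noteq> 0" by blast
  then have "0 < pmf \<pi> k * real k" using pmf_positive[of k \<pi>] by simp
  then show ?thesis
    unfolding gen_fun_deriv_1 by (intro suminf_pos2[OF summable_mean]) auto
qed

text \<open>The weights in the definition of \<^const>\<open>hat_pmf\<close> sum to one because the derivative of the
  generating function at \<open>1\<close> is the mean.\<close>

lemma pmf_hat_pmf: "pmf (hat_pmf \<pi>) k = real (Suc k) * pmf \<pi> (Suc k) / gen_fun_deriv \<pi> 1"
proof -
  let ?h = "\<lambda>k. real (Suc k) * pmf \<pi> (Suc k) / gen_fun_deriv \<pi> 1"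
  have "(\<lambda>k. pmf \<pi> (Suc k) * real (Suc k)) sums gen_fun_deriv \<pi> 1"
    using summable_mean by (subst sums_Suc_iff) (simp add: gen_fun_deriv_1 summable_sums)
  from sums_divide[OF this, of "gen_fun_deriv \<pi> 1"] have "?h sums 1"
    using gen_fun_deriv_1_pos by (simp add: mult.commute)
  moreover have nn: "0 \<le> ?h k" for k using gen_fun_deriv_1_pos by simp
  ultimately have "(\<integral>\<^sup>+ k. ennreal (?h k) \<partial>count_space UNIV) = 1"
    by (simp add: nn_integral_count_space_nat suminf_ennreal2 sums_iff del: of_nat_Suc)
  then show ?thesis
    unfolding hat_pmf_def using nn by (intro pmf_embed_pmf) auto
qed

end

section \<open>Separation of the two hulls\<close>

lemma law_hull_measure_bounds:
  assumes "\<mu> \<in> law_hull S" "A \<in> sets borel"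
  shows "(\<And>\<nu>. \<nu> \<in> S \<Longrightarrow> measure \<nu> A \<le> a) \<Longrightarrow> measure \<mu> A \<le> a"
    and "(\<And>\<nu>. \<nu> \<in> S \<Longrightarrow> a \<le> measure \<nu> A) \<Longrightarrow> a \<le> measure \<mu> A"
proof -
  obtain F c where F: "F \<subseteq> S" "\<forall>\<nu>\<in>F. 0 \<le> c \<nu>" "sum c F = 1"
    "measure \<mu> A = (\<Sum>\<nu>\<in>F. c \<nu> * measure \<nu> A)"
    using assms by (auto simp: law_hull_def)
  have a: "a = (\<Sum>\<nu>\<in>F. c \<nu> * a)" using F(3) by (simp add: sum_distrib_right[symmetric])
  show "measure \<mu> A \<le> a" if "\<And>\<nu>. \<nu> \<in> S \<Longrightarrow> measure \<nu> A \<le> a"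
    unfolding F(4) by (subst a, intro sum_mono mult_left_mono) (use F(1,2) that in auto)
  show "a \<le> measure \<mu> A" if "\<And>\<nu>. \<nu> \<in> S \<Longrightarrow> a \<le> measure \<nu> A"
    unfolding F(4) by (subst a, intro sum_mono mult_left_mono) (use F(1,2) that in auto)
qed

lemma dTV_ge:
  assumes "borel_law \<mu>" "borel_law \<nu>" "A \<in> sets borel"
  shows "measure \<nu> A - measure \<mu> A \<le> dTV \<mu> \<nu>"
proof -
  interpret M: prob_space \<mu> using assms(1) by (simp add: borel_law_def)
  interpret N: prob_space \<nu> using assms(2) by (simp add: borel_law_def)
  have "\<bar>measure \<mu> B - measure \<nu> B\<bar> \<le> 1" for B
    using M.prob_le_1[of B] N.prob_le_1[of B] measure_nonneg[of \<mu> B] measure_nonneg[of \<nu> B]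
    by (intro abs_leI) linarith+
  then have "\<bar>measure \<mu> A - measure \<nu> A\<bar> \<le> dTV \<mu> \<nu>"
    unfolding dTV_def by (intro cSUP_upper assms(3) bdd_aboveI2[of _ _ 1])
  then show ?thesis by simp
qed

text \<open>By Bernoulli's inequality \<open>(1 - 1/d)^(d - 1) \<le> 1/2\<close>, so that the left-hand side is at most
  \<open>(d - 1) / (2 d)\<close>.\<close>

lemma spider_probabilities_less:
  assumes d: "2 \<le> d" shows "(1 - 1 / real d) ^ d < (real d - 1) / (2 * real d - 1)"
proof -
  obtain n where n: "d = Suc n" "1 \<le> n" using d by (cases d) auto
  have "- 1 \<le> 1 / real n" by (rule order_trans[of _ 0]) auto
  then have "2 \<le> (1 + 1 / real n) ^ n"
    using Bernoulli_inequality[of "1 / real n" n] n(2) by simp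
  have "1 - 1 / real d = 1 / (1 + 1 / real n)" using n by (simp add: field_simps)
  then have "(1 - 1 / real d) ^ n = 1 / (1 + 1 / real n) ^ n" by (simp only: power_one_over)
  also have "\<dots> \<le> 1 / 2"
    using \<open>2 \<le> (1 + 1 / real n) ^ n\<close> by (intro divide_left_mono) auto
  finally have "(1 - 1 / real d) ^ n \<le> 1 / 2" .
  then have "(1 - 1 / real d) ^ d \<le> (1 - 1 / real d) * (1 / 2)"
    unfolding n(1) power_Suc using n by (intro mult_left_mono) (auto simp: field_simps)
  also have "\<dots> = (real d - 1) / (2 * real d)" using d by (simp add: field_simps)
  also have "\<dots> < (real d - 1) / (2 * real d - 1)" using d by (intro divide_strict_left_mono) auto
  finally show ?thesis .
qed

theorem proposition7p1:
  fixes \<pi> :: "nat pmf"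
  assumes "integrable (measure_pmf \<pi>) real"
    and "0 < measure_pmf.expectation \<pi> real"
    and "hat_pmf \<pi> \<noteq> return_pmf 0"
    and "0 < pmf (hat_pmf \<pi>) 0"
    and "finite {t \<in> {0..1}. hat_gen_fun \<pi> (1 - hat_gen_fun \<pi> (1 - t)) = t}"
  shows "0 < set_dTV (C_w \<pi>) (C_U \<pi>)"
proof -
  obtain k where k: "k \<noteq> 0" "0 < pmf (hat_pmf \<pi>) k"
  proof -
    have "\<not> set_pmf (hat_pmf \<pi>) \<subseteq> {0}" using assms(3) by (simp add: set_pmf_subset_singleton)
    then obtain j where "j \<in> set_pmf (hat_pmf \<pi>)" "j \<noteq> 0" by blast
    then show thesis using that[of j] pmf_positive[of j] by blast
  qed
  define d where "d = Suc k"
  have d: "2 \<le> d" using k(1) by (simp add: d_def)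
  have "0 < pmf \<pi> d"
    using k(2) pmf_hat_pmf[OF assms(1,2), of k] gen_fun_deriv_1_pos[OF assms(1,2)]
    by (simp add: d_def zero_less_divide_iff zero_less_mult_iff del: of_nat_Suc)
  then have p0: "0 < measure (offspring_law \<pi>) (spider_offspring d)" (is "0 < ?p")
    using k(2) assms(4) by (intro spider_offspring_pos) (simp_all add: d_def)
  \<comment> \<open>\<open>a\<close> and \<open>b\<close> bound the probability of \<open>?A\<close> from above on the first and from below on the second
    hull.\<close>
  let ?A = "unmatched_centre_roots d"
  define a where "a = ?p * (1 - 1 / real d) ^ d"
  define b where "b = ?p * ((real d - 1) / (2 * real d - 1))"
  have "a < b" unfolding a_def b_def by (intro mult_strict_left_mono spider_probabilities_less d p0)
  have A: "?A \<in> sets borel" by (intro borel_open clopen_unmatched_centre_roots)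
  have "ereal (b - a) \<le> ereal (dTV \<mu> \<nu>)" if \<mu>: "\<mu> \<in> C_w \<pi>" and \<nu>: "\<nu> \<in> C_U \<pi>" for \<mu> \<nu>
  proof -
    have "measure \<mu> ?A \<le> a"
      using \<mu> unfolding C_w_def
      by (rule law_hull_measure_bounds(1)[OF _ A])
        (auto simp: a_def intro!: optimal_matching_unmatched_centre_le assms(1) d)
    moreover have "b \<le> measure \<nu> ?A"
      using \<nu> unfolding C_U_def
      by (rule law_hull_measure_bounds(2)[OF _ A])
        (auto simp: b_def simp del: times_divide_eq_right intro!: uniform_limit_unmatched_centre_ge d)
    moreover have "measure \<nu> ?A - measure \<mu> ?A \<le> dTV \<mu> \<nu>"
      using \<mu> \<nu> by (intro dTV_ge A) (auto simp: C_w_def C_U_def law_hull_def)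
    ultimately show ?thesis by simp
  qed
  then have "ereal (b - a) \<le> set_dTV (C_w \<pi>) (C_U \<pi>)"
    unfolding set_dTV_def by (intro INF_greatest)
  moreover have "0 < ereal (b - a)" using \<open>a < b\<close> by simp
  ultimately show ?thesis by (rule less_le_trans[rotated])
qed

end
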